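(* Let $H=\sum_{|\alpha|\le m}c_\alpha D^\alpha$ ($c_\alpha\in\mathbb{C}$) be an $m$th-order partial differential operator with constant coefficients on $\mathbb{R}^d$, with symbol $P(\xi)=\sum_{|\alpha|\le m}c_\alpha\xi^\alpha$. Let $\Omega\subset\mathbb{R}^d$ be open, $V\in C^\infty(\Omega,\mathbb{C})$, $\lambda\in\mathbb{C}$ with $|\lambda|\ge1$, and let $\psi_\lambda$ be a smooth solution of $(H+V)\psi_\lambda=\lambda\psi_\lambda$ on $\Omega$. Let $\delta,r>0$ and let $\gamma$ be any multi-index. Then for any ball $B(x,r)\subset\Omega$, $$|D^\gamma\psi_\lambda(x)|\lesssim_{d,r,\delta}|\lambda|^{|\gamma|/m}\left(1+\mathcal{N}_\lambda^{1/2}\right)\|\psi_\lambda\|_{L^2(B(x,r))},$$ where $\mathcal{N}_\lambda=\#\{\xi\in\mathbb{Z}^d:\ |P(\xi)-\lambda|\le|\xi|^{m-1+\delta}\}$. Here the implied constant depends on $d,r,\delta$.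
   Context: For a multi-index $\alpha\in\mathbb{N}^d$, $|\alpha|=\alpha_1+\dots+\alpha_d$, $D^\alpha=(-i\partial_{x_1})^{\alpha_1}\cdots(-i\partial_{x_d})^{\alpha_d}$ and $\xi^\alpha=\xi_1^{\alpha_1}\cdots\xi_d^{\alpha_d}$. $|\xi|$ is the Euclidean norm and $B(x,r)$ is the Euclidean ball of center $x$ and radius $r$. $A\lesssim_{d,r,\delta}B$ means $A\le CB$ with a constant $C$ depending on $d,r,\delta$.
   Formalization: The implied constant may depend on H, V, Ω and γ as well as d, r, δ, and is uniform in λ, ψ_λ and in balls with centre in a given bounded set; with dependence on d, r, δ alone the claim is false (H=D², V=−K, λ=1, ψ=sin(√(1+K)x), K→∞). *)

theory Defs
  imports "HOL-Analysis.Analysis"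
begin

text \<open>
  Points of d-dimensional Euclidean space are vectors of type \<open>real ^ 'n\<close> with \<open>d = CARD('n)\<close>.
  The linear order on \<open>'n\<close> only serves to fix the order in which the factors of a mixed
  derivative are composed.
\<close>

type_synonym 'n multi_index = "'n \<Rightarrow> nat"

definition mi_order :: "'n::finite multi_index \<Rightarrow> nat"
  where "mi_order \<alpha> = (\<Sum>i\<in>UNIV. \<alpha> i)"

lemma finite_mi_order_le: "finite {\<alpha> :: 'n::finite multi_index. mi_order \<alpha> \<le> m}"
proof (rule finite_subset)
  show "{\<alpha> :: 'n multi_index. mi_order \<alpha> \<le> m} \<subseteq> (UNIV :: 'n set) \<rightarrow>\<^sub>E {..m}"
  proof
    fix \<alpha> :: "'n multi_index"
    assume "\<alpha> \<in> {\<alpha>. mi_order \<alpha> \<le> m}"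
    hence "(\<Sum>i\<in>UNIV. \<alpha> i) \<le> m" by (simp add: mi_order_def)
    moreover have "\<alpha> i \<le> (\<Sum>i\<in>UNIV. \<alpha> i)" for i by (rule member_le_sum) auto
    ultimately have "\<alpha> i \<le> m" for i using le_trans by blast
    thus "\<alpha> \<in> (UNIV :: 'n set) \<rightarrow>\<^sub>E {..m}" by auto
  qed
  show "finite ((UNIV :: 'n set) \<rightarrow>\<^sub>E {..m})" by (rule finite_PiE) auto
qed

definition partial :: "'n::finite \<Rightarrow> (real ^ 'n \<Rightarrow> complex) \<Rightarrow> real ^ 'n \<Rightarrow> complex"
  where "partial i f x = vector_derivative (\<lambda>t. f (x + t *\<^sub>R axis i 1)) (at 0)"

text \<open>
  The functions below are total, but all notions are used at points of an open set \<open>S\<close> only,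
  where the iterated partial derivatives depend only on the values of the function on \<open>S\<close>.
  On an open set, requiring all iterated partial derivatives to be (totally) differentiable is
  the same as requiring them all to exist and be continuous.
\<close>

definition smooth_on :: "(real ^ 'n::finite) set \<Rightarrow> (real ^ 'n \<Rightarrow> complex) \<Rightarrow> bool"
  where "smooth_on S f \<longleftrightarrow> (\<forall>js. \<forall>x\<in>S. foldr partial js f differentiable (at x))"

definition D1 :: "'n::finite \<Rightarrow> (real ^ 'n \<Rightarrow> complex) \<Rightarrow> real ^ 'n \<Rightarrow> complex"
  where "D1 i f = (\<lambda>x. - \<i> * partial i f x)"

definition D :: "'n::{finite,linorder} multi_index \<Rightarrow> (real ^ 'n::_ \<Rightarrow> complex) \<Rightarrow> real ^ 'n::_ \<Rightarrow> complex"
  where "D \<alpha> f = foldr (\<lambda>i. D1 i ^^ \<alpha> i) (sorted_list_of_set UNIV) f"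

definition diff_op ::
    "('n::{finite,linorder} multi_index \<Rightarrow> complex) \<Rightarrow> nat \<Rightarrow> (real ^ 'n::_ \<Rightarrow> complex) \<Rightarrow> real ^ 'n::_ \<Rightarrow> complex"
  where "diff_op c m f x = (\<Sum>\<alpha> | mi_order \<alpha> \<le> m. c \<alpha> * D \<alpha> f x)"

definition op_symbol :: "('n::finite multi_index \<Rightarrow> complex) \<Rightarrow> nat \<Rightarrow> real ^ 'n \<Rightarrow> complex"
  where "op_symbol c m \<xi> = (\<Sum>\<alpha> | mi_order \<alpha> \<le> m. c \<alpha> * (\<Prod>i\<in>UNIV. of_real (\<xi> $ i) ^ \<alpha> i))"

definition near_level_set ::
    "('n::finite multi_index \<Rightarrow> complex) \<Rightarrow> nat \<Rightarrow> real \<Rightarrow> complex \<Rightarrow> (real ^ 'n) set"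
  where "near_level_set c m \<delta> lam =
    {\<xi>. (\<forall>i. \<xi> $ i \<in> \<int>) \<and> cmod (op_symbol c m \<xi> - lam) \<le> norm \<xi> powr (real m - 1 + \<delta>)}"

text \<open>The cardinality is \<open>\<infinity>\<close> for an infinite set, which does occur (e.g. if the operator is not
  elliptic); \<open>card\<close> would be \<open>0\<close> there.\<close>

definition near_level_count ::
    "('n::finite multi_index \<Rightarrow> complex) \<Rightarrow> nat \<Rightarrow> real \<Rightarrow> complex \<Rightarrow> ennreal"
  where "near_level_count c m \<delta> lam = emeasure (count_space UNIV) (near_level_set c m \<delta> lam)"

definition ennsqrt :: "ennreal \<Rightarrow> ennreal"
  where "ennsqrt a = (if a = \<infinity> then \<infinity> else ennreal (sqrt (enn2real a)))"

text \<open>Possibly \<open>\<infinity>\<close>: a function that is smooth on an open set containing an open ball need not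
  be square integrable on that ball.\<close>

definition L2_norm_on :: "(real ^ 'n::finite) set \<Rightarrow> (real ^ 'n \<Rightarrow> complex) \<Rightarrow> ennreal"
  where "L2_norm_on S f = ennsqrt (\<integral>\<^sup>+ y\<in>S. ennreal ((cmod (f y))\<^sup>2) \<partial>lborel)"

end

theory Submission
  imports Defs "HOL-Real_Asymp.Real_Asymp"
begin

text \<open>
  Localise \<open>\<psi>\<close> near \<open>x\<close> with a smooth bump \<open>a\<close> supported in a small ball \<open>K\<close>, so that \<open>a \<psi>\<close> can
  be regarded as a function on the torus of period \<open>2 \<pi>\<close>, and bound \<open>D\<^sup>\<gamma> \<psi> x\<close> by the sum over the
  lattice of \<open>\<bar>\<xi>\<^sup>\<gamma>\<bar>\<close> times the Fourier coefficient of \<open>a \<psi>\<close> at \<open>\<xi>\<close>.  Write \<open>M\<close> for the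
  \<open>L\<^sup>2\<close> norm of \<open>\<psi>\<close> on \<open>K\<close>.

  Away from the near level set the coefficients decay.  Multiplying the equation by \<open>a\<close> and taking
  Fourier coefficients shows that \<open>(P \<xi> - \<lambda>)\<close> times the coefficient of \<open>a \<psi>\<close> comes from the potential
  and from the commutator of \<open>a\<close> with the operator, hence is at most \<open>(1 + \<bar>\<xi>\<bar>)\<^bsup>m-1\<^esup>\<close> times a
  sum of coefficients of finitely many functions \<open>b \<psi>\<close>, where each \<open>b\<close> is again a test function
  supported in \<open>K\<close> (\<open>fcoeff_equation_bound\<close>).  If \<open>\<bar>P \<xi> - \<lambda>\<bar> \<ge> c \<bar>\<xi>\<bar>\<^bsup>m-1+\<delta>\<^esup>\<close> this gains a
  factor \<open>\<bar>\<xi>\<bar>\<^bsup>-\<delta>\<^esup>\<close>; as the class of test functions reproduces itself, the argument can be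
  iterated at a fixed \<open>\<xi>\<close>, and the coefficient is \<open>O(\<bar>\<xi>\<bar>\<^bsup>-k\<delta>\<^esup> M)\<close> for every \<open>k\<close>
  (\<open>fcoeff_decay\<close>).  For large \<open>k\<close> these frequencies contribute \<open>O(M)\<close>.

  On the near level set only Bessel's inequality is available: its \<open>N\<close> frequencies contribute at most
  the largest \<open>\<bar>\<xi>\<bar>\<^bsup>\<bar>\<gamma>\<bar>\<^esup>\<close> times a constant times \<open>N\<^bsup>1/2\<^esup> M\<close> (\<open>sum_fcoeff_le\<close>).  To replace
  \<open>\<bar>\<xi>\<bar>\<close> by \<open>\<bar>\<lambda>\<bar>\<^bsup>1/m\<^esup>\<close>, ellipticity is needed, and it comes for free.  If the principal
  symbol vanishes at a unit vector \<open>\<omega>\<close>, the lattice points nearest to \<open>k \<omega>\<close> have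
  \<open>\<bar>P \<xi>\<bar> = O(\<bar>\<xi>\<bar>\<^bsup>m-1\<^esup>)\<close> and the near level set is infinite; it is also infinite when \<open>\<delta> > 1\<close>.
  Otherwise the operator is elliptic, and every lattice point with \<open>\<bar>\<xi>\<bar> \<ge> Q \<bar>\<lambda>\<bar>\<^bsup>1/m\<^esup>\<close> satisfies the lower
  bound above, near or not (\<open>symbol_lower_bound_off_near_set\<close>).  If the near level set is infinite,
  the claim reduces to \<open>D\<^sup>\<gamma> \<psi> x = 0\<close> when \<open>M = 0\<close>, where all Fourier coefficients vanish.

  Finitely many balls \<open>K\<close> serve all points \<open>x\<close> of the bounded set, so no uniformity in \<open>x\<close> of the
  cut-offs or of the potential has to be tracked.
\<close>

section \<open>Calculus of iterated partial derivatives\<close>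

lemma has_derivative_partial:
  assumes "(f has_derivative f') (at x)"
  shows "partial i f x = f' (axis i 1)"
proof -
  have "((\<lambda>t. f (x + t *\<^sub>R axis i 1)) has_derivative (\<lambda>t. f' (t *\<^sub>R axis i 1))) (at 0)"
    using assms
    by (intro has_derivative_compose[of "\<lambda>t. x + t *\<^sub>R axis i 1" _ 0 UNIV f, simplified])
       (auto intro!: derivative_eq_intros)
  moreover have "linear f'"
    using assms has_derivative_linear by blast
  ultimately have "((\<lambda>t. f (x + t *\<^sub>R axis i 1)) has_vector_derivative f' (axis i 1)) (at 0)"
    by (simp add: has_vector_derivative_def linear_cmul)
  then show ?thesis
    unfolding partial_def by (rule vector_derivative_at)
qed

lemma partial_cong:
  assumes "open S" "x \<in> S" "\<And>y. y \<in> S \<Longrightarrow> f y = g y"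
  shows "partial i f x = partial i g x"
proof -
  have "\<forall>\<^sub>F t in nhds (0::real). x + t *\<^sub>R axis i 1 \<in> S"
  proof -
    have "isCont (\<lambda>t. x + t *\<^sub>R axis i 1) (0::real)"
      by (intro continuous_intros)
    then have "(\<lambda>t. x + t *\<^sub>R axis i 1) \<midarrow>0\<rightarrow> x"
      by (simp add: isCont_def)
    then have "\<forall>\<^sub>F t in at (0::real). x + t *\<^sub>R axis i 1 \<in> S"
      using assms(1,2) topological_tendstoD by blast
    then show ?thesis
      using assms(2) by (simp add: eventually_nhds_conv_at)
  qed
  then have "\<forall>\<^sub>F t in nhds (0::real). t \<in> UNIV \<longrightarrow> f (x + t *\<^sub>R axis i 1) = g (x + t *\<^sub>R axis i 1)"
    using assms(3) by (auto elim: eventually_mono)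
  then show ?thesis
    unfolding partial_def by (rule vector_derivative_cong_eq) auto
qed

lemma differentiable_cong_open:
  assumes "open S" "x \<in> S" "\<And>y. y \<in> S \<Longrightarrow> f y = g y"
  shows "f differentiable (at x) \<longleftrightarrow> g differentiable (at x)"
proof -
  have "g differentiable (at x)" if "f differentiable (at x)" "\<And>y. y \<in> S \<Longrightarrow> f y = g y" for f g :: "'a \<Rightarrow> 'b"
    using that has_derivative_transform_within_open[OF _ assms(1,2)]
    unfolding differentiable_def by metis
  then show ?thesis using assms(3) by metis
qed

lemma foldr_partial_cong:
  assumes "open S" "x \<in> S" "\<And>y. y \<in> S \<Longrightarrow> f y = g y"
  shows "foldr partial js f x = foldr partial js g x"
  using assms(2)
proof (induction js arbitrary: x)
  case (Cons i js)
  then show ?case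
    using partial_cong[OF assms(1) Cons.prems, of "foldr partial js f" "foldr partial js g"] by simp
qed (use assms in auto)

lemma smooth_on_cong:
  assumes "open S" "\<And>y. y \<in> S \<Longrightarrow> f y = g y"
  shows "smooth_on S f \<longleftrightarrow> smooth_on S g"
proof -
  have "foldr partial js f differentiable (at x) \<longleftrightarrow> foldr partial js g differentiable (at x)"
    if "x \<in> S" for js x
    by (rule differentiable_cong_open[OF assms(1) that]) (rule foldr_partial_cong[OF assms(1) _ assms(2)])
  then show ?thesis
    unfolding smooth_on_def by simp
qed

lemma smooth_on_subset: "smooth_on T f \<Longrightarrow> S \<subseteq> T \<Longrightarrow> smooth_on S f"
  unfolding smooth_on_def by blast

lemma smooth_on_partial:
  assumes "smooth_on S f"
  shows "smooth_on S (partial i f)"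
  unfolding smooth_on_def
proof (intro allI ballI)
  fix js x assume "x \<in> S"
  then have "foldr partial (js @ [i]) f differentiable (at x)"
    using assms unfolding smooth_on_def by blast
  then show "foldr partial js (partial i f) differentiable (at x)"
    by simp
qed

lemma smooth_on_differentiable: "smooth_on S f \<Longrightarrow> x \<in> S \<Longrightarrow> f differentiable (at x)"
  unfolding smooth_on_def by (metis foldr.simps(1) id_apply)

text \<open>
  Smoothness is the largest property that implies differentiability and is closed under partial
  derivatives. Agreement with a member of the class is only required on the open set, since off
  it the derivatives are junk values.
\<close>

lemma smooth_on_coinduct:
  assumes "open S" "f \<in> \<A>"
    and diff: "\<And>g x. g \<in> \<A> \<Longrightarrow> x \<in> S \<Longrightarrow> g differentiable (at x)"
    and closed: "\<And>g i. g \<in> \<A> \<Longrightarrow> \<exists>h\<in>\<A>. \<forall>x\<in>S. partial i g x = h x"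
  shows "smooth_on S f"
proof -
  have "foldr partial js g differentiable (at x)" if "x \<in> S" "g \<in> \<A>" for js g x
    using that
  proof (induction js arbitrary: g rule: rev_induct)
    case (snoc i js)
    obtain h where h: "h \<in> \<A>" "\<forall>x\<in>S. partial i g x = h x"
      using closed snoc.prems by blast
    have "foldr partial (js @ [i]) g y = foldr partial js h y" if "y \<in> S" for y
      using foldr_partial_cong[OF assms(1) that, of "partial i g" h js] h(2) by simp
    then show ?case
      using differentiable_cong_open[OF assms(1) snoc.prems(1)] snoc.IH[OF snoc.prems(1) h(1)] by metis
  qed (use diff in auto)
  then show ?thesis
    using assms(2) unfolding smooth_on_def by blast
qed

section \<open>Smooth bump functions\<close>

text \<open>
  All powers of \<open>1/t\<close> are admitted so that the linear span of the family is closed under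
  differentiation.
\<close>

definition flat_exp :: "nat \<Rightarrow> real \<Rightarrow> real"
  where "flat_exp n t = (if t \<le> 0 then 0 else exp (- 1 / t) / t ^ n)"

lemma flat_exp_deriv:
  "(flat_exp n has_real_derivative flat_exp (n + 2) t - real n * flat_exp (n + 1) t) (at t)"
proof -
  consider "t > 0" | "t < 0" | "t = 0" by linarith
  then show ?thesis
  proof cases
    case 1
    have "((\<lambda>t. exp (- 1 / t) / t ^ n) has_real_derivative
        flat_exp (n + 2) t - real n * flat_exp (n + 1) t) (at t)"
    proof -
      have pow: "real n * t ^ (n - 1) = real n * t ^ n / t"
        using 1 by (cases n) auto
      have "((\<lambda>t. exp (- 1 / t)) has_real_derivative exp (- 1 / t) / t\<^sup>2) (at t)"
        using 1 by (auto intro!: derivative_eq_intros simp: power2_eq_square)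
      moreover have "((\<lambda>t. t ^ n) has_real_derivative real n * t ^ n / t) (at t)"
        using pow by (auto intro!: derivative_eq_intros)
      ultimately have "((\<lambda>t. exp (- 1 / t) / t ^ n) has_real_derivative
          (exp (- 1 / t) / t\<^sup>2 * t ^ n - exp (- 1 / t) * (real n * t ^ n / t)) / (t ^ n * t ^ n)) (at t)"
        using 1 by (intro DERIV_divide) auto
      moreover have "(exp (- 1 / t) / t\<^sup>2 * t ^ n - exp (- 1 / t) * (real n * t ^ n / t)) / (t ^ n * t ^ n) =
          flat_exp (n + 2) t - real n * flat_exp (n + 1) t"
        using 1 by (simp add: flat_exp_def divide_simps power2_eq_square) (simp add: algebra_simps)
      ultimately show ?thesis by simp
    qed
    then show ?thesis
      by (rule has_field_derivative_transform_within_open[where S="{0<..}"]) (use 1 in \<open>auto simp: flat_exp_def\<close>)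
  next
    case 2
    have "((\<lambda>t. 0) has_real_derivative flat_exp (n + 2) t - real n * flat_exp (n + 1) t) (at t)"
      using 2 by (auto simp: flat_exp_def)
    then show ?thesis
      by (rule has_field_derivative_transform_within_open[where S="{..<0}"]) (use 2 in \<open>auto simp: flat_exp_def\<close>)
  next
    case 3
    have "((\<lambda>h. flat_exp n h / h) \<longlongrightarrow> 0) (at_left 0)"
      by (rule tendsto_eventually) (auto simp: flat_exp_def eventually_at_filter)
    moreover have "((\<lambda>h. flat_exp n h / h) \<longlongrightarrow> 0) (at_right 0)"
    proof (rule Lim_transform_eventually)
      show "((\<lambda>h::real. exp (- 1 / h) / h ^ n / h) \<longlongrightarrow> 0) (at_right 0)"
        by real_asymp
      show "\<forall>\<^sub>F h in at_right 0. exp (- 1 / h) / h ^ n / h = flat_exp n h / h"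
        by (auto simp: flat_exp_def eventually_at_filter)
    qed
    ultimately have "((\<lambda>h. flat_exp n h / h) \<longlongrightarrow> 0) (at 0)"
      by (simp add: filterlim_at_split)
    then show ?thesis
      using 3 by (simp add: DERIV_def flat_exp_def)
  qed
qed

text \<open>
  A class of functions that contains the smooth ones and whose generators are all differentiated
  by the product and chain rules into the same class. By coinduction its members are smooth,
  which gives products of smooth functions and compositions with \<open>flat_exp\<close> at once.
\<close>

inductive_set smooth_alg :: "(real ^ 'n::finite) set \<Rightarrow> (real ^ 'n \<Rightarrow> complex) set"
  for S where
  base: "smooth_on S f \<Longrightarrow> f \<in> smooth_alg S"
| const: "(\<lambda>_. c) \<in> smooth_alg S"
| coord: "(\<lambda>x. of_real (x $ i)) \<in> smooth_alg S"
| add: "f \<in> smooth_alg S \<Longrightarrow> g \<in> smooth_alg S \<Longrightarrow> (\<lambda>x. f x + g x) \<in> smooth_alg S"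
| mult: "f \<in> smooth_alg S \<Longrightarrow> g \<in> smooth_alg S \<Longrightarrow> (\<lambda>x. f x * g x) \<in> smooth_alg S"
| Re: "f \<in> smooth_alg S \<Longrightarrow> (\<lambda>x. of_real (Re (f x))) \<in> smooth_alg S"
| flat: "f \<in> smooth_alg S \<Longrightarrow> (\<lambda>x. of_real (flat_exp n (Re (f x)))) \<in> smooth_alg S"

lemma smooth_alg_derivative:
  fixes S :: "(real ^ 'n::finite) set"
  assumes "f \<in> smooth_alg S"
  shows "(\<forall>x\<in>S. f differentiable (at x)) \<and> (\<forall>i. \<exists>h\<in>smooth_alg S. \<forall>x\<in>S. partial i f x = h x)"
  using assms
proof induction
  case (base f)
  then show ?case
    using smooth_alg.base smooth_on_differentiable smooth_on_partial by blast
next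
  case (const c)
  have *: "((\<lambda>_. c) has_derivative (\<lambda>_. 0)) (at x)" for x :: "real^'n" by simp
  then show ?case
    using has_derivative_partial[OF *] smooth_alg.const[of 0 S]
    by (intro conjI allI ballI bexI[of _ "\<lambda>_. 0"]) (auto simp: differentiable_def)
next
  case (coord j)
  have *: "((\<lambda>x. complex_of_real (x $ j)) has_derivative (\<lambda>h. of_real (h $ j))) (at x)" for x :: "real^'n"
    by (intro has_derivative_of_real bounded_linear_imp_has_derivative bounded_linear_vec_nth)
  have "partial i (\<lambda>x. complex_of_real (x $ j)) x = of_real (axis i 1 $ j)" for i and x :: "real^'n"
    using has_derivative_partial[OF *] by simp
  then show ?case
    using * smooth_alg.const[of "of_real (axis _ 1 $ j)" S] by (intro conjI allI ballI rev_bexI) (auto simp: differentiable_def)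
next
  case (add f g)
  have D: "(f has_derivative frechet_derivative f (at x)) (at x)" "(g has_derivative frechet_derivative g (at x)) (at x)"
    if "x \<in> S" for x
    using add.IH that frechet_derivative_works by blast+
  have "partial i (\<lambda>x. f x + g x) x = partial i f x + partial i g x" if "x \<in> S" for x i
    using has_derivative_partial[OF has_derivative_add[OF D[OF that]]]
      D[OF that, THEN has_derivative_partial] by metis
  moreover have "\<exists>h\<in>smooth_alg S. \<forall>x\<in>S. partial i f x + partial i g x = h x" for i
    using add.IH smooth_alg.add by (metis (no_types, lifting))
  ultimately show ?case
    using add.IH by (auto intro!: differentiable_add)
next
  case (mult f g)
  have D: "(f has_derivative frechet_derivative f (at x)) (at x)" "(g has_derivative frechet_derivative g (at x)) (at x)"
    if "x \<in> S" for x
    using mult.IH that frechet_derivative_works by blast+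
  have P: "partial i (\<lambda>x. f x * g x) x = f x * partial i g x + partial i f x * g x" if "x \<in> S" for x i
    using has_derivative_partial[OF has_derivative_mult[OF D[OF that]]]
      D[OF that, THEN has_derivative_partial] by metis
  have "\<exists>h\<in>smooth_alg S. \<forall>x\<in>S. f x * partial i g x + partial i f x * g x = h x" for i
  proof -
    obtain f' g' where "f' \<in> smooth_alg S" "\<forall>x\<in>S. partial i f x = f' x"
       "g' \<in> smooth_alg S" "\<forall>x\<in>S. partial i g x = g' x"
      using mult.IH by meson
    then show ?thesis
      using smooth_alg.add[OF smooth_alg.mult[OF mult.hyps(1), of g'] smooth_alg.mult[OF _ mult.hyps(2), of f']]
      by fastforce
  qed
  moreover have "(\<lambda>x. f x * g x) differentiable (at x)" if "x \<in> S" for x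
    using has_derivative_mult[OF D[OF that]] by (auto simp: differentiable_def)
  ultimately show ?case
    using P by simp
next
  case (Re f)
  have D: "(f has_derivative frechet_derivative f (at x)) (at x)" if "x \<in> S" for x
    using Re.IH that frechet_derivative_works by blast
  have D': "((\<lambda>x. complex_of_real (Re (f x))) has_derivative (\<lambda>h. of_real (Re (frechet_derivative f (at x) h)))) (at x)"
    if "x \<in> S" for x
    using D[OF that] by (intro has_derivative_of_real has_derivative_Re)
  have P: "partial i (\<lambda>x. complex_of_real (Re (f x))) x = of_real (Re (partial i f x))" if "x \<in> S" for x i
    using has_derivative_partial[OF D'[OF that]] has_derivative_partial[OF D[OF that]] by simp
  have "\<exists>h\<in>smooth_alg S. \<forall>x\<in>S. of_real (Re (partial i f x)) = h x" for i
    using Re.IH smooth_alg.Re by metis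
  then show ?case
    using P differentiableI[OF D'] by simp
next
  case (flat f n)
  have D: "(f has_derivative frechet_derivative f (at x)) (at x)" if "x \<in> S" for x
    using flat.IH that frechet_derivative_works by blast
  have D': "((\<lambda>x. complex_of_real (flat_exp n (Re (f x)))) has_derivative
      (\<lambda>h. of_real ((flat_exp (n + 2) (Re (f x)) - real n * flat_exp (n + 1) (Re (f x))) * Re (frechet_derivative f (at x) h)))) (at x)"
    if "x \<in> S" for x
    using has_derivative_compose[OF has_derivative_Re[OF D[OF that]] flat_exp_deriv[unfolded has_field_derivative_def]]
    by (intro has_derivative_of_real)
  let ?P = "\<lambda>x i. complex_of_real ((flat_exp (n + 2) (Re (f x)) - real n * flat_exp (n + 1) (Re (f x))) * Re (partial i f x))"
  have P: "partial i (\<lambda>x. complex_of_real (flat_exp n (Re (f x)))) x = ?P x i" if "x \<in> S" for x i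
    using has_derivative_partial[OF D'[OF that]] has_derivative_partial[OF D[OF that]] by simp
  have "\<exists>h\<in>smooth_alg S. \<forall>x\<in>S. ?P x i = h x" for i
  proof -
    obtain g where g: "g \<in> smooth_alg S" "\<forall>x\<in>S. partial i f x = g x"
      using flat.IH by meson
    have "(\<lambda>x. (of_real (flat_exp (n+2) (Re (f x))) + of_real (- real n) * of_real (flat_exp (n+1) (Re (f x)))) * of_real (Re (g x))) \<in> smooth_alg S"
      by (intro smooth_alg.mult smooth_alg.add smooth_alg.flat smooth_alg.Re smooth_alg.const g flat.hyps)
    then show ?thesis
      by (rule rev_bexI) (use g in simp)
  qed
  then show ?case
    using P differentiableI[OF D'] by simp
qed

lemma smooth_alg_smooth:
  assumes "open S" "f \<in> smooth_alg S"
  shows "smooth_on S f"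
proof (rule smooth_on_coinduct[OF assms])
  fix g x i
  assume "g \<in> smooth_alg S"
  note * = smooth_alg_derivative[OF this]
  show "\<exists>h\<in>smooth_alg S. \<forall>x\<in>S. partial i g x = h x"
    using * by (rule spec[OF conjunct2])
  show "g differentiable (at x)" if "x \<in> S"
    using * that by (rule bspec[OF conjunct1])
qed

lemma smooth_on_mult:
  "open S \<Longrightarrow> smooth_on S f \<Longrightarrow> smooth_on S g \<Longrightarrow> smooth_on S (\<lambda>x. f x * g x)"
  by (rule smooth_alg_smooth, assumption) (intro smooth_alg.mult smooth_alg.base)

lemma smooth_on_const: "open S \<Longrightarrow> smooth_on S (\<lambda>_. c)"
  by (rule smooth_alg_smooth, assumption) (intro smooth_alg.const)

lemma smooth_on_D1: "open S \<Longrightarrow> smooth_on S f \<Longrightarrow> smooth_on S (D1 i f)"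
  unfolding D1_def by (intro smooth_on_mult smooth_on_const smooth_on_partial)

lemma smooth_on_foldr_D1: "open S \<Longrightarrow> smooth_on S f \<Longrightarrow> smooth_on S (foldr D1 L f)"
  by (induction L) (auto intro: smooth_on_D1)

lemma smooth_on_continuous: "smooth_on S f \<Longrightarrow> continuous_on S f"
  by (simp add: smooth_on_differentiable continuous_at_imp_continuous_on differentiable_imp_continuous_within)

lemma partial_mult:
  assumes "f differentiable (at x)" "g differentiable (at x)"
  shows "partial i (\<lambda>x. f x * g x) x = f x * partial i g x + partial i f x * g x"
proof -
  have D: "(f has_derivative frechet_derivative f (at x)) (at x)" "(g has_derivative frechet_derivative g (at x)) (at x)"
    using assms frechet_derivative_works by blast+
  show ?thesis
    using has_derivative_partial[OF has_derivative_mult[OF D]] D[THEN has_derivative_partial] by metis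
qed

text \<open>
  With \<open>f t = exp (-1/t)\<close> for \<open>t > 0\<close> and \<open>c = f 1\<close>, the composition \<open>f (c - f t)\<close> is the constant
  \<open>f c > 0\<close> for \<open>t \<le> 0\<close>, where the inner function vanishes, and is 0 for \<open>t \<ge> 1\<close>, where \<open>f t \<ge> c\<close>. This
  produces a plateau without any quotient of smooth functions. The argument \<open>t\<close> is an affine
  function of the squared distance to the centre.
\<close>

lemma smooth_bump_exists:
  fixes x0 :: "real ^ 'n::finite"
  assumes "\<rho> > 0"
  obtains \<eta> where "smooth_on UNIV \<eta>" "\<And>y. y \<in> ball x0 (\<rho>/2) \<Longrightarrow> \<eta> y = 1"
    "\<And>y. y \<notin> cball x0 \<rho> \<Longrightarrow> \<eta> y = 0"
proof -
  define q where "q = (\<lambda>y::real^'n. \<Sum>i\<in>UNIV. (complex_of_real (y $ i) + of_real (- (x0 $ i))) * (of_real (y $ i) + of_real (- (x0 $ i))))"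
  have q: "Re (q y) = (dist x0 y)\<^sup>2" for y
  proof -
    have "(dist x0 y)\<^sup>2 = (\<Sum>i\<in>UNIV. (x0 $ i - y $ i)\<^sup>2)"
      by (simp add: dist_vec_def L2_set_def sum_nonneg dist_real_def)
    then show ?thesis
      by (simp add: q_def power2_eq_square algebra_simps)
  qed
  have sum: "(\<lambda>y. \<Sum>i\<in>I. f i y) \<in> smooth_alg UNIV" if "finite I" "\<And>i. f i \<in> smooth_alg UNIV" for f and I :: "'n set"
    using that(1)
    by induction (auto intro: smooth_alg.intros that(2))
  have qs: "q \<in> smooth_alg UNIV"
    unfolding q_def
    by (rule sum[OF finite]) (intro smooth_alg.add smooth_alg.mult smooth_alg.coord smooth_alg.const)
  define c where "c = flat_exp 0 1"
  define \<kappa> where "\<kappa> = flat_exp 0 c"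
  \<comment> \<open>the affine rescaling sends squared distance \<open>(\<rho>/2)\<^sup>2\<close> to 0 and \<open>\<rho>\<^sup>2\<close> to 1\<close>
  define p where "p = (\<lambda>y. of_real (4 / (3 * \<rho>\<^sup>2)) * q y + of_real (-1/3))"
  have p: "Re (p y) = (4 * (dist x0 y)\<^sup>2 / \<rho>\<^sup>2 - 1) / 3" for y
    using q[of y] assms by (simp add: p_def field_simps)
  define \<eta> where "\<eta> = (\<lambda>y. of_real (1 / \<kappa>) * complex_of_real (flat_exp 0 (Re (of_real c + (-1) * complex_of_real (flat_exp 0 (Re (p y)))))))"
  have c0: "c > 0" by (simp add: c_def flat_exp_def)
  then have k0: "\<kappa> > 0" by (simp add: \<kappa>_def flat_exp_def)
  show thesis
  proof
    show "smooth_on UNIV \<eta>"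
      unfolding \<eta>_def p_def
      by (rule smooth_alg_smooth[OF open_UNIV]) (intro smooth_alg.intros(2-) qs)
    show "\<eta> y = 1" if "y \<in> ball x0 (\<rho>/2)" for y
    proof -
      have "(dist x0 y)\<^sup>2 \<le> (\<rho>/2)\<^sup>2"
        using that assms by (intro power_mono) auto
      then have "Re (p y) \<le> 0"
        using assms by (simp add: p field_simps)
      then have "flat_exp 0 (Re (p y)) = 0"
        by (simp add: flat_exp_def)
      then show ?thesis
        using k0 by (simp add: \<eta>_def \<kappa>_def)
    qed
    show "\<eta> y = 0" if "y \<notin> cball x0 \<rho>" for y
    proof -
      have "(dist x0 y)\<^sup>2 \<ge> \<rho>\<^sup>2"
        using that assms by (intro power_mono) auto
      then have *: "Re (p y) \<ge> 1"
        using assms by (simp add: p field_simps)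
      then have "1 / Re (p y) \<le> 1" by simp
      then have "flat_exp 0 (Re (p y)) \<ge> c"
        using * by (simp add: flat_exp_def c_def)
      then show ?thesis
        by (simp add: \<eta>_def flat_exp_def)
    qed
  qed
qed

section \<open>Integration by parts\<close>

lemma integrable_compact_support:
  fixes f :: "'a::euclidean_space \<Rightarrow> 'b::{banach, second_countable_topology}"
  assumes "compact K" "continuous_on K f" "\<And>y. y \<notin> K \<Longrightarrow> f y = 0"
  shows "integrable lborel f"
proof -
  have "(\<lambda>x. indicator K x *\<^sub>R f x) = f"
    using assms(3) by (auto simp: indicator_def)
  then show ?thesis
    using borel_integrable_compact[OF assms(1,2)] by simp
qed

lemma integral_lborel_shift:
  fixes f :: "'a::euclidean_space \<Rightarrow> 'b::{banach, second_countable_topology}"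
  assumes [measurable]: "f \<in> borel_measurable borel"
  shows "(\<integral>x. f (c + x) \<partial>lborel) = (\<integral>x. f x \<partial>lborel)"
proof -
  have "(\<integral>x. f x \<partial>lborel) = (\<integral>x. f x \<partial>distr lborel borel ((+) c))"
    by (simp add: lborel_distr_plus)
  also have "\<dots> = (\<integral>x. f (c + x) \<partial>lborel)"
    by (rule integral_distr) auto
  finally show ?thesis ..
qed

lemma has_vector_derivative_line_partial:
  assumes "f differentiable (at (x + t *\<^sub>R axis i 1))"
  shows "((\<lambda>t. f (x + t *\<^sub>R axis i 1)) has_vector_derivative partial i f (x + t *\<^sub>R axis i 1)) (at t)"
proof -
  obtain f' where f': "(f has_derivative f') (at (x + t *\<^sub>R axis i 1))"
    using assms by (auto simp: differentiable_def)
  then have "((\<lambda>t. f (x + t *\<^sub>R axis i 1)) has_derivative (\<lambda>t. f' (t *\<^sub>R axis i 1))) (at t)"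
    by (intro has_derivative_compose[of "\<lambda>t. x + t *\<^sub>R axis i 1" _ t UNIV f, simplified])
       (auto intro!: derivative_eq_intros)
  moreover have "linear f'"
    using f' has_derivative_linear by blast
  ultimately show ?thesis
    by (simp add: has_vector_derivative_def linear_cmul has_derivative_partial[OF f'])
qed

text \<open>
  By translation invariance every difference quotient of \<open>g\<close> has integral 0. The quotients converge
  to the partial derivative and are dominated by a multiple of the indicator of a compact set, so
  the integral of the limit is 0 as well.
\<close>

lemma integral_partial_eq_0:
  fixes g :: "real ^ 'n::finite \<Rightarrow> complex"
  assumes K: "compact K" and g0: "\<And>y. y \<notin> K \<Longrightarrow> g y = 0"
    and diff: "\<And>y. g differentiable (at y)" and cont: "continuous_on UNIV (partial i g)"
  shows "(\<integral>y. partial i g y \<partial>lborel) = 0"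
proof -
  define e :: "real ^ 'n" where "e = axis i 1"
  have gcont: "continuous_on UNIV g"
    using diff by (simp add: continuous_at_imp_continuous_on differentiable_imp_continuous_within)
  have [measurable]: "g \<in> borel_measurable borel" "partial i g \<in> borel_measurable borel"
    using gcont cont by (simp_all add: borel_measurable_continuous_onI)
  have p0: "partial i g y = 0" if "y \<notin> K" for y
  proof -
    have "open (- K)" using K compact_imp_closed by blast
    then have "partial i g y = partial i (\<lambda>_. 0) y"
      using partial_cong[of "-K" y g "\<lambda>_. 0"] that g0 by simp
    then show ?thesis
      using has_derivative_partial[OF has_derivative_const, of i 0 y] by simp
  qed
  obtain B where B: "B > 0" "\<And>y. norm (partial i g y) \<le> B"
  proof -
    have "compact (partial i g ` K)"
      using K cont compact_continuous_image continuous_on_subset by blast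
    then obtain B where "B > 0" "\<forall>y\<in>partial i g ` K. norm y \<le> B"
      using compact_imp_bounded bounded_pos by blast
    then show thesis
      using that[of B] p0 by (metis imageI less_imp_le norm_zero)
  qed
  define s :: "nat \<Rightarrow> real" where "s n = 1 / real (Suc n)" for n
  have s: "0 < s n" "s n \<le> 1" for n by (auto simp: s_def)
  \<comment> \<open>the difference quotients in direction \<open>i\<close> with step \<open>1 / (n + 1)\<close>\<close>
  define h where "h n x = (g (x + s n *\<^sub>R e) - g x) /\<^sub>R s n" for n x
  \<comment> \<open>all difference quotients with step at most 1 vanish outside this compact set\<close>
  define K' where "K' = (\<lambda>p. fst p - snd p *\<^sub>R e) ` (K \<times> {0..1})"
  have K': "compact K'"
    unfolding K'_def using K by (intro compact_continuous_image compact_Times continuous_intros) auto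
  have bound: "norm (h n x) \<le> B * indicator K' x" for n x
  proof (cases "x \<in> K'")
    case True
    obtain t where "norm (g (x + s n *\<^sub>R e) - g (x + 0 *\<^sub>R e)) \<le> norm ((s n - 0) *\<^sub>R partial i g (x + t *\<^sub>R e))"
      using mvt_general[of 0 "s n" "\<lambda>t. g (x + t *\<^sub>R e)" "\<lambda>t h. h *\<^sub>R partial i g (x + t *\<^sub>R e)"] s[of n]
        has_vector_derivative_line_partial[OF diff] continuous_on_subset[OF gcont]
      unfolding e_def has_vector_derivative_def
      by (force intro!: continuous_on_compose2[OF gcont] continuous_intros)
    also have "\<dots> \<le> s n * B"
      using B(2) s[of n] by (simp add: mult_left_mono)
    finally show ?thesis
      using s[of n] True by (simp add: h_def divide_simps mult.commute)
  next
    case False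
    have "x + t *\<^sub>R e \<notin> K" if "t \<in> {0..1}" for t
    proof
      assume "x + t *\<^sub>R e \<in> K"
      then have "(\<lambda>p. fst p - snd p *\<^sub>R e) (x + t *\<^sub>R e, t) \<in> K'"
        unfolding K'_def using that by (intro imageI) auto
      then show False using False by simp
    qed
    from this[of 0] this[of "s n"] show ?thesis
      using s[of n] False by (simp add: h_def g0)
  qed
  have "(\<lambda>n. \<integral>x. h n x \<partial>lborel) \<longlonglongrightarrow> (\<integral>x. partial i g x \<partial>lborel)"
  proof (rule integral_dominated_convergence[where w="\<lambda>x. B * indicator K' x"])
    show "partial i g \<in> borel_measurable lborel" by simp
    show "h n \<in> borel_measurable lborel" for n unfolding h_def by measurable
    show "integrable lborel (\<lambda>x. B * indicator K' x)"
      using emeasure_compact_finite[OF K'] borel_compact[OF K']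
      by (auto intro!: integrable_mult_right integrable_real_indicator)
    show "AE x in lborel. norm (h n x) \<le> B * indicator K' x" for n
      using bound by simp
    show "AE x in lborel. (\<lambda>n. h n x) \<longlonglongrightarrow> partial i g x"
    proof (rule AE_I2)
      fix x
      have "((\<lambda>t. g (x + t *\<^sub>R e)) has_vector_derivative partial i g x) (at 0)"
        using has_vector_derivative_line_partial[OF diff, where x=x and t=0 and i=i] by (simp add: e_def)
      then have "((\<lambda>t. norm ((g (x + t *\<^sub>R e) - g x) /\<^sub>R t - partial i g x)) \<longlongrightarrow> 0) (at 0)"
      proof (rule Lim_transform_eventually[OF conjunct2[OF iffD1[OF has_derivative_at]], OF iffD1[OF has_vector_derivative_def]])
        show "\<forall>\<^sub>F t in at 0. norm (g (x + (0 + t) *\<^sub>R e) - g (x + 0 *\<^sub>R e) - t *\<^sub>R partial i g x) / norm t =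
          norm ((g (x + t *\<^sub>R e) - g x) /\<^sub>R t - partial i g x)"
        proof (rule eventually_at_filter[THEN iffD2], rule always_eventually, intro allI impI)
          fix t :: real assume t: "t \<noteq> 0"
          have "(g (x + t *\<^sub>R e) - g x) /\<^sub>R t - partial i g x = (g (x + t *\<^sub>R e) - g x - t *\<^sub>R partial i g x) /\<^sub>R t"
            using t by (simp add: scaleR_diff_right)
          then show "norm (g (x + (0 + t) *\<^sub>R e) - g (x + 0 *\<^sub>R e) - t *\<^sub>R partial i g x) / norm t =
            norm ((g (x + t *\<^sub>R e) - g x) /\<^sub>R t - partial i g x)"
            by (simp add: divide_inverse mult.commute)
        qed
      qed
      then have "((\<lambda>t. (g (x + t *\<^sub>R e) - g x) /\<^sub>R t) \<longlongrightarrow> partial i g x) (at 0)"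
        by (rule LIM_zero_cancel[OF tendsto_norm_zero_cancel])
      moreover have "filterlim s (at 0) sequentially"
        unfolding filterlim_at s_def
        using LIMSEQ_Suc[OF lim_1_over_n] by (auto simp: )
      ultimately show "(\<lambda>n. h n x) \<longlonglongrightarrow> partial i g x"
        unfolding h_def by (rule filterlim_compose)
    qed
  qed
  moreover have "(\<integral>x. h n x \<partial>lborel) = 0" for n
  proof -
    have i: "integrable lborel g"
      using integrable_compact_support[OF K continuous_on_subset[OF gcont] g0] by simp
    have i': "integrable lborel (\<lambda>x. g (x + s n *\<^sub>R e))"
    proof -
      have "integrable (distr lborel borel ((+) (s n *\<^sub>R e))) g"
        using i by (simp add: lborel_distr_plus)
      then show ?thesis
        by (subst (asm) integrable_distr_eq) (auto simp: add.commute)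
    qed
    show ?thesis
      unfolding h_def using i i' integral_lborel_shift[of g "s n *\<^sub>R e"]
      by (simp add: add.commute)
  qed
  ultimately show ?thesis
    by (simp add: LIMSEQ_const_iff)
qed

section \<open>Fourier coefficients of localised functions\<close>

definition fcoeff :: "(real ^ 'n::finite \<Rightarrow> complex) \<Rightarrow> real ^ 'n \<Rightarrow> complex"
  where "fcoeff f \<xi> = (\<integral>y. f y * cis (- (\<xi> \<bullet> y)) \<partial>lborel)"

text \<open>
  Smooth on the whole space, although the potential and the solutions are smooth near \<open>K\<close> only:
  their products with a test function vanish off \<open>K\<close>, hence are smooth everywhere whatever values
  those functions take far away.
\<close>

definition test_fun :: "(real ^ 'n::finite) set \<Rightarrow> (real ^ 'n \<Rightarrow> complex) \<Rightarrow> bool"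
  where "test_fun K a \<longleftrightarrow> smooth_on UNIV a \<and> (\<forall>y. y \<notin> K \<longrightarrow> a y = 0)"

lemma test_fun_mult:
  assumes "open \<Omega>" "closed K" "K \<subseteq> \<Omega>" "test_fun K a" "smooth_on \<Omega> f"
  shows "test_fun K (\<lambda>y. a y * f y)"
proof -
  have "smooth_on \<Omega> (\<lambda>y. a y * f y)"
    using assms smooth_on_subset unfolding test_fun_def by (intro smooth_on_mult) blast+
  moreover have "smooth_on (- K) (\<lambda>y. a y * f y)"
    using smooth_on_cong[of "-K" "\<lambda>y. a y * f y" "\<lambda>_. 0"] assms smooth_on_const[of "-K" 0]
    by (auto simp: test_fun_def)
  ultimately have "smooth_on UNIV (\<lambda>y. a y * f y)"
    unfolding smooth_on_def using assms(3) by blast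
  then show ?thesis
    using assms(4) by (simp add: test_fun_def)
qed

lemma test_fun_D1:
  assumes "closed K" "test_fun K a"
  shows "test_fun K (D1 i a)"
proof -
  have "D1 i a y = 0" if "y \<notin> K" for y
    using partial_cong[of "-K" y a "\<lambda>_. 0" i] that assms has_derivative_partial[OF has_derivative_const, of i 0 y]
    by (auto simp: D1_def test_fun_def)
  then show ?thesis
    using assms smooth_on_D1[of UNIV a i] by (simp add: test_fun_def)
qed

lemma test_fun_continuous: "test_fun K a \<Longrightarrow> continuous_on S a"
  using smooth_on_continuous continuous_on_subset unfolding test_fun_def by blast

lemma test_fun_fcoeff_integrable:
  assumes "compact K" "test_fun K a"
  shows "integrable lborel (\<lambda>y. a y * cis (- (\<xi> \<bullet> y)))"
  using assms
  by (intro integrable_compact_support[where K=K] continuous_intros test_fun_continuous[OF assms(2)])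
     (auto simp: test_fun_def)

text \<open>
  The integral of the derivative of \<open>g\<close> times the exponential vanishes; the product rule turns this
  into the claim.
\<close>

lemma fcoeff_D1:
  fixes g :: "real ^ 'n::finite \<Rightarrow> complex"
  assumes K: "compact K" and g: "test_fun K g"
  shows "fcoeff (D1 i g) \<xi> = of_real (\<xi> $ i) * fcoeff g \<xi>"
proof -
  let ?e = "\<lambda>y. cis (- (\<xi> \<bullet> y))"
  have e: "(?e has_derivative (\<lambda>h. (- (\<xi> \<bullet> h)) *\<^sub>R (\<i> * ?e x))) (at x)" for x
    by (auto intro!: derivative_eq_intros)
  have gd: "g differentiable (at x)" for x
    using g smooth_on_differentiable by (auto simp: test_fun_def)
  have p: "partial i (\<lambda>y. g y * ?e y) x = (- \<i> * of_real (\<xi> $ i)) * (g x * ?e x) + \<i> * (D1 i g x * ?e x)" for x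
    using partial_mult[OF gd differentiableI[OF e], of i x] has_derivative_partial[OF e, of i x]
    by (simp add: D1_def inner_axis scaleR_conv_of_real complex_i_mult_minus mult.assoc)
  have "(\<integral>y. partial i (\<lambda>y. g y * ?e y) y \<partial>lborel) = 0"
  proof (rule integral_partial_eq_0[OF K])
    show "g y * ?e y = 0" if "y \<notin> K" for y using g that by (simp add: test_fun_def)
    show "(\<lambda>y. g y * ?e y) differentiable (at y)" for y
      using gd differentiableI[OF e] by (intro differentiable_mult)
    show "continuous_on UNIV (partial i (\<lambda>y. g y * ?e y))"
      unfolding p
      by (intro continuous_intros test_fun_continuous[OF g] test_fun_continuous[OF test_fun_D1[OF compact_imp_closed[OF K] g]])
  qed
  then have "0 = (- \<i> * of_real (\<xi> $ i)) * fcoeff g \<xi> + \<i> * fcoeff (D1 i g) \<xi>"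
    using test_fun_fcoeff_integrable[OF K g] test_fun_fcoeff_integrable[OF K test_fun_D1[OF compact_imp_closed[OF K] g]]
    by (simp add: p fcoeff_def)
  then have "\<i> * (fcoeff (D1 i g) \<xi> - of_real (\<xi> $ i) * fcoeff g \<xi>) = 0"
    by (simp add: algebra_simps)
  then show ?thesis by simp
qed

lemma fcoeff_foldr_D1:
  assumes K: "compact K" and g: "test_fun K g"
  shows "test_fun K (foldr D1 L g) \<and> fcoeff (foldr D1 L g) \<xi> = (\<Prod>i\<leftarrow>L. of_real (\<xi> $ i)) * fcoeff g \<xi>"
  by (induction L) (use g test_fun_D1[OF compact_imp_closed[OF K]] fcoeff_D1[OF K] in auto)

text \<open>
  From \<open>a D\<^sub>i g = D\<^sub>i (a g) - (D\<^sub>i a) g\<close> each derivative can be moved off \<open>u\<close>, either producing a factor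
  \<open>\<xi>\<^sub>i\<close> or falling on \<open>a\<close>. The terms of the second kind have lost one power of \<open>\<xi>\<close>. The list \<open>A\<close> depends
  neither on \<open>u\<close> nor on \<open>\<xi>\<close>, which is what permits iteration. The extra factor \<open>1 + \<bar>\<xi>\<bar>\<close> on the left
  states the gain without the exponent \<open>length L - 1\<close>, which would be wrong for the empty list. A
  list of test functions rather than a set keeps repeated functions in the sum.
\<close>

lemma fcoeff_commutator:
  fixes a :: "real ^ 'n::finite \<Rightarrow> complex"
  assumes \<Omega>: "open \<Omega>" and K: "compact K" "K \<subseteq> \<Omega>" and a: "test_fun K a"
  shows "\<exists>A. (\<forall>b\<in>set A. test_fun K b) \<and>
    (\<forall>u \<xi>. smooth_on \<Omega> u \<longrightarrow>
      cmod (fcoeff (\<lambda>y. a y * foldr D1 L u y) \<xi> - (\<Prod>i\<leftarrow>L. of_real (\<xi> $ i)) * fcoeff (\<lambda>y. a y * u y) \<xi>) * (1 + norm \<xi>)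
        \<le> (1 + norm \<xi>) ^ length L * (\<Sum>b\<leftarrow>A. cmod (fcoeff (\<lambda>y. b y * u y) \<xi>)))"
  using a
proof (induction L arbitrary: a)
  case Nil
  show ?case by (rule exI[of _ "[]"]) simp
next
  case (Cons i L)
  have Kc: "closed K" using K compact_imp_closed by blast
  let ?a' = "D1 i a"
  have a': "test_fun K ?a'"
    using test_fun_D1[OF Kc Cons.prems] .
  obtain A where A: "\<forall>b\<in>set A. test_fun K b"
    "\<And>u \<xi>. smooth_on \<Omega> u \<Longrightarrow>
      cmod (fcoeff (\<lambda>y. a y * foldr D1 L u y) \<xi> - (\<Prod>i\<leftarrow>L. of_real (\<xi> $ i)) * fcoeff (\<lambda>y. a y * u y) \<xi>) * (1 + norm \<xi>)
        \<le> (1 + norm \<xi>) ^ length L * (\<Sum>b\<leftarrow>A. cmod (fcoeff (\<lambda>y. b y * u y) \<xi>))"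
    using Cons.IH[OF Cons.prems] by blast
  obtain A' where A': "\<forall>b\<in>set A'. test_fun K b"
    "\<And>u \<xi>. smooth_on \<Omega> u \<Longrightarrow>
      cmod (fcoeff (\<lambda>y. ?a' y * foldr D1 L u y) \<xi> - (\<Prod>i\<leftarrow>L. of_real (\<xi> $ i)) * fcoeff (\<lambda>y. ?a' y * u y) \<xi>) * (1 + norm \<xi>)
        \<le> (1 + norm \<xi>) ^ length L * (\<Sum>b\<leftarrow>A'. cmod (fcoeff (\<lambda>y. b y * u y) \<xi>))"
    using Cons.IH[OF a'] by blast
  have "cmod (fcoeff (\<lambda>y. a y * foldr D1 (i # L) u y) \<xi> - (\<Prod>i\<leftarrow>i # L. of_real (\<xi> $ i)) * fcoeff (\<lambda>y. a y * u y) \<xi>) * (1 + norm \<xi>)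
        \<le> (1 + norm \<xi>) ^ length (i # L) * (\<Sum>b\<leftarrow>A @ A' @ [?a']. cmod (fcoeff (\<lambda>y. b y * u y) \<xi>))"
    if u: "smooth_on \<Omega> u" for u \<xi>
  proof -
    define g where "g = foldr D1 L u"
    have g: "smooth_on \<Omega> g"
      using u \<Omega> smooth_on_foldr_D1 unfolding g_def by blast
    define \<Phi> where "\<Phi> b = fcoeff (\<lambda>y. b y * u y) \<xi>" for b
    define S where "S B = (\<Sum>b\<leftarrow>B. cmod (\<Phi> b))" for B
    define \<pi> where "\<pi> = (\<Prod>i\<leftarrow>L. complex_of_real (\<xi> $ i))"
    define N where "N = 1 + norm \<xi>"
    have tag: "test_fun K (\<lambda>y. a y * g y)" and ta'g: "test_fun K (\<lambda>y. ?a' y * g y)"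
      using test_fun_mult[OF \<Omega> Kc K(2) Cons.prems g] test_fun_mult[OF \<Omega> Kc K(2) a' g] .
    have leib: "a y * D1 i g y = D1 i (\<lambda>y. a y * g y) y - ?a' y * g y" for y
    proof (cases "y \<in> K")
      case True
      have "a differentiable (at y)" "g differentiable (at y)"
        using smooth_on_differentiable[OF g] True K smooth_on_differentiable[of UNIV a y] Cons.prems
        by (auto simp: test_fun_def)
      from partial_mult[OF this, of i] show ?thesis
        by (simp add: D1_def algebra_simps)
    next
      case False
      then show ?thesis
        using Cons.prems a' test_fun_D1[OF Kc tag] by (simp add: test_fun_def)
    qed
    have 1: "fcoeff (\<lambda>y. a y * D1 i g y) \<xi> = of_real (\<xi> $ i) * fcoeff (\<lambda>y. a y * g y) \<xi> - fcoeff (\<lambda>y. ?a' y * g y) \<xi>"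
      unfolding leib fcoeff_D1[OF K(1) tag, symmetric]
      using test_fun_fcoeff_integrable[OF K(1) test_fun_D1[OF Kc tag]] test_fun_fcoeff_integrable[OF K(1) ta'g]
      by (simp add: fcoeff_def left_diff_distrib)
    have N: "N \<ge> 1" "\<bar>\<xi> $ i\<bar> \<le> N"
      using component_le_norm_cart[of \<xi> i] by (auto simp: N_def)
    have \<pi>: "cmod \<pi> \<le> N ^ length L"
    proof -
      have "cmod (\<Prod>i\<leftarrow>L. complex_of_real (\<xi> $ i)) \<le> N ^ length L" for L
      proof (induction L)
        case (Cons j L)
        have "\<bar>\<xi> $ j\<bar> \<le> N"
          using component_le_norm_cart[of \<xi> j] by (auto simp: N_def)
        then show ?case
          using Cons N by (simp add: norm_mult mult_mono)
      qed simp
      then show ?thesis unfolding \<pi>_def .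
    qed
    have "fcoeff (\<lambda>y. a y * D1 i g y) \<xi> - of_real (\<xi> $ i) * \<pi> * \<Phi> a =
       of_real (\<xi> $ i) * (fcoeff (\<lambda>y. a y * g y) \<xi> - \<pi> * \<Phi> a) -
       (fcoeff (\<lambda>y. ?a' y * g y) \<xi> - \<pi> * \<Phi> ?a') - \<pi> * \<Phi> ?a'"
      unfolding 1 by (simp add: algebra_simps)
    then have "cmod (fcoeff (\<lambda>y. a y * D1 i g y) \<xi> - of_real (\<xi> $ i) * \<pi> * \<Phi> a) \<le>
      \<bar>\<xi> $ i\<bar> * cmod (fcoeff (\<lambda>y. a y * g y) \<xi> - \<pi> * \<Phi> a) +
      cmod (fcoeff (\<lambda>y. ?a' y * g y) \<xi> - \<pi> * \<Phi> ?a') + cmod \<pi> * cmod (\<Phi> ?a')"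
      by (smt (verit) norm_triangle_ineq4 norm_mult norm_of_real)
    then have "cmod (fcoeff (\<lambda>y. a y * D1 i g y) \<xi> - of_real (\<xi> $ i) * \<pi> * \<Phi> a) * N \<le>
      (\<bar>\<xi> $ i\<bar> * cmod (fcoeff (\<lambda>y. a y * g y) \<xi> - \<pi> * \<Phi> a) +
      cmod (fcoeff (\<lambda>y. ?a' y * g y) \<xi> - \<pi> * \<Phi> ?a') + cmod \<pi> * cmod (\<Phi> ?a')) * N"
      using N by (intro mult_right_mono) auto
    also have "\<dots> = \<bar>\<xi> $ i\<bar> * (cmod (fcoeff (\<lambda>y. a y * g y) \<xi> - \<pi> * \<Phi> a) * N) +
      cmod (fcoeff (\<lambda>y. ?a' y * g y) \<xi> - \<pi> * \<Phi> ?a') * N + cmod \<pi> * N * cmod (\<Phi> ?a')"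
      by (simp add: algebra_simps)
    also have "\<dots> \<le> N * (N ^ length L * S A) + N ^ length L * S A' + N ^ length L * N * cmod (\<Phi> ?a')"
    proof (intro add_mono)
      have S: "S A \<ge> 0" by (auto simp: S_def intro!: sum_list_nonneg)
      show "\<bar>\<xi> $ i\<bar> * (cmod (fcoeff (\<lambda>y. a y * g y) \<xi> - \<pi> * \<Phi> a) * N) \<le> N * (N ^ length L * S A)"
        using A(2)[OF u, of \<xi>] N S
        unfolding g_def[symmetric] \<pi>_def[symmetric] \<Phi>_def[symmetric] N_def[symmetric] S_def[symmetric]
        by (intro mult_mono[OF N(2)]) auto
      show "cmod (fcoeff (\<lambda>y. ?a' y * g y) \<xi> - \<pi> * \<Phi> ?a') * N \<le> N ^ length L * S A'"
        using A'(2)[OF u, of \<xi>]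
        unfolding g_def[symmetric] \<pi>_def[symmetric] \<Phi>_def[symmetric] N_def[symmetric] S_def[symmetric] .
      show "cmod \<pi> * N * cmod (\<Phi> ?a') \<le> N ^ length L * N * cmod (\<Phi> ?a')"
        using \<pi> N by (intro mult_right_mono) auto
    qed
    also have "\<dots> \<le> N ^ Suc (length L) * (S A + S A' + S [?a'])"
    proof -
      have "N ^ length L * S A' \<le> N ^ Suc (length L) * S A'"
        using N by (intro mult_right_mono power_increasing) (auto simp: S_def intro!: sum_list_nonneg)
      then show ?thesis by (simp add: S_def algebra_simps)
    qed
    finally have main: "cmod (fcoeff (\<lambda>y. a y * D1 i g y) \<xi> - of_real (\<xi> $ i) * \<pi> * \<Phi> a) * N \<le>
      N ^ Suc (length L) * (S A + S A' + S [?a'])" .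
    show ?thesis
      using main by (simp add: g_def \<pi>_def \<Phi>_def N_def S_def algebra_simps)
  qed
  moreover have "\<forall>b\<in>set (A @ A' @ [?a']). test_fun K b"
    using A(1) A'(1) a' by auto
  ultimately show ?case by (intro exI[of _ "A @ A' @ [?a']"]) blast
qed

section \<open>Orthogonality of lattice exponentials\<close>

definition lattice :: "(real ^ 'n::finite) set"
  where "lattice = {\<xi>. \<forall>i. \<xi> $ i \<in> \<int>}"

lemma lattice_add: "\<xi> \<in> lattice \<Longrightarrow> \<eta> \<in> lattice \<Longrightarrow> \<xi> + \<eta> \<in> lattice"
  and lattice_diff: "\<xi> \<in> lattice \<Longrightarrow> \<eta> \<in> lattice \<Longrightarrow> \<xi> - \<eta> \<in> lattice"
  and lattice_0: "0 \<in> lattice"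
  and lattice_axis: "n \<in> \<int> \<Longrightarrow> axis i n \<in> lattice"
  by (auto simp: lattice_def axis_def)

definition period_box :: "real ^ 'n \<Rightarrow> (real ^ 'n) set"
  where "period_box a = cbox (\<chi> i. a $ i - pi) (\<chi> i. a $ i + pi)"

lemma mem_period_box: "y \<in> period_box a \<longleftrightarrow> (\<forall>i. \<bar>y $ i - a $ i\<bar> \<le> pi)"
  unfolding period_box_def mem_box_cart by (auto simp: abs_le_iff) (smt (verit))+

lemma compact_period_box: "compact (period_box a)"
  by (simp add: period_box_def)

lemma cball_subset_period_box:
  assumes "x \<in> cball x0 1"
  shows "cball x0 1 \<subseteq> period_box x"
proof
  fix y assume "y \<in> cball x0 1"
  then have "dist y x \<le> 2"
    using assms dist_triangle[of y x x0] by (simp add: dist_commute)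
  then have "\<bar>y $ i - x $ i\<bar> \<le> 2" for i
    using component_le_norm_cart[of "y - x" i] by (simp add: dist_norm)
  then show "y \<in> period_box x"
    using pi_ge_two by (auto simp: mem_period_box intro: order_trans)
qed

text \<open>
  Fubini for product functions, read off from the description of Lebesgue measure as the image of
  a product measure.
\<close>

lemma integral_prod_components:
  fixes f :: "'n::finite \<Rightarrow> real \<Rightarrow> complex"
  assumes int: "\<And>i. integrable lborel (f i)"
  shows "(\<integral>y. (\<Prod>i\<in>UNIV. f i (y $ i)) \<partial>(lborel :: (real ^ 'n) measure)) = (\<Prod>i\<in>UNIV. \<integral>t. f i t \<partial>lborel)"
proof -
  interpret product_sigma_finite "\<lambda>_::real ^ 'n. lborel :: real measure"
    by standard
  have [measurable]: "f i \<in> borel_measurable borel" for i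
    using borel_measurable_integrable[OF int[of i]] by simp
  have basis: "(Basis :: (real ^ 'n) set) = (\<lambda>i. axis i 1) ` UNIV"
    by (auto simp: Basis_vec_def)
  have inj: "inj (\<lambda>i::'n. axis i (1::real))"
    by (auto simp: inj_def axis_eq_axis)
  have prod: "(\<Prod>i\<in>UNIV. g i) = (\<Prod>b\<in>(Basis :: (real ^ 'n) set). g (axis_index b))" for g :: "'n \<Rightarrow> complex"
    unfolding basis by (subst prod.reindex[OF inj]) simp
  have coord: "(\<Sum>c\<in>Basis. p c *\<^sub>R c) $ axis_index b = p b" if "b \<in> Basis" for p and b :: "real ^ 'n"
  proof -
    have "(\<Sum>c\<in>Basis. p c *\<^sub>R c) $ axis_index b = (\<Sum>c\<in>Basis. p c *\<^sub>R c) \<bullet> b"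
      by (subst cart_eq_inner_axis) (simp add: axis_index[OF that, symmetric])
    then show ?thesis
      using that by simp
  qed
  have "(\<integral>y. (\<Prod>i\<in>UNIV. f i (y $ i)) \<partial>(lborel :: (real ^ 'n) measure)) =
      (\<integral>p. (\<Prod>i\<in>UNIV. f i ((\<Sum>b\<in>Basis. p b *\<^sub>R b :: real ^ 'n) $ i)) \<partial>(\<Pi>\<^sub>M b\<in>Basis. lborel))"
    by (subst lborel_eq, subst integral_distr) auto
  also have "\<dots> = (\<integral>p. (\<Prod>b\<in>(Basis :: (real ^ 'n) set). f (axis_index b) (p b)) \<partial>(\<Pi>\<^sub>M b\<in>Basis. lborel))"
    unfolding prod by (intro Bochner_Integration.integral_cong prod.cong refl) (simp only: coord)
  also have "\<dots> = (\<Prod>b\<in>(Basis :: (real ^ 'n) set). \<integral>t. f (axis_index b) t \<partial>lborel)"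
    by (rule product_integral_prod) (use int in auto)
  also have "\<dots> = (\<Prod>i\<in>UNIV. \<integral>t. f i t \<partial>lborel)"
    unfolding prod ..
  finally show ?thesis .
qed

lemma cis_sum: "cis (\<Sum>i\<in>I. f i) = (\<Prod>i\<in>I. cis (f i))"
  by (induction I rule: infinite_finite_induct) (auto simp: cis_mult[symmetric])

lemma integral_cis_period:
  assumes "k \<in> \<int>"
  shows "(\<integral>t. indicator {a - pi..a + pi} t *\<^sub>R cis (k * t) \<partial>lborel) = (if k = 0 then of_real (2 * pi) else 0)"
proof (cases "k = 0")
  case False
  have "(\<integral>t. indicator {a - pi..a + pi} t *\<^sub>R cis (k * t) \<partial>lborel) =
      cis (k * (a + pi)) / (\<i> * of_real k) - cis (k * (a - pi)) / (\<i> * of_real k)"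
  proof (rule integral_FTC_atLeastAtMost)
    show "((\<lambda>t. cis (k * t) / (\<i> * of_real k)) has_vector_derivative cis (k * x)) (at x within {a - pi..a + pi})" for x
      using False
      by (auto simp: has_vector_derivative_def scaleR_conv_of_real field_simps
          intro!: derivative_eq_intros)
  qed (auto intro!: continuous_intros)
  moreover have "cis (k * (a + pi)) = cis (k * (a - pi))"
  proof -
    have "k * (a + pi) = k * (a - pi) + 2 * pi * k" by (simp add: algebra_simps)
    then show ?thesis
      using cis_multiple_2pi[OF assms] by (metis cis_mult mult.right_neutral)
  qed
  ultimately show ?thesis using False by simp
next
  case True
  have "(\<integral>t. indicator {a - pi..a + pi} t *\<^sub>R (1::complex) \<partial>lborel) = of_real (2 * pi)"
    using integral_FTC_atLeastAtMost[of "a - pi" "a + pi" of_real "\<lambda>_. 1::complex"]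
    by (simp add: has_vector_derivative_def scaleR_conv_of_real bounded_linear_imp_has_derivative bounded_linear_of_real)
  then show ?thesis using True by simp
qed

definition period_volume :: "'n::finite itself \<Rightarrow> real"
  where "period_volume _ = (2 * pi) ^ CARD('n)"

lemma period_volume_pos: "period_volume TYPE('n::finite) > 0"
  by (simp add: period_volume_def)

lemma integral_cis_period_box:
  fixes \<xi> a :: "real ^ 'n::finite"
  assumes "\<xi> \<in> lattice"
  shows "(\<integral>y. indicator (period_box a) y *\<^sub>R cis (\<xi> \<bullet> y) \<partial>lborel) =
    (if \<xi> = 0 then of_real (period_volume TYPE('n)) else 0)"
proof -
  let ?f = "\<lambda>i t. indicator {a $ i - pi..a $ i + pi} t *\<^sub>R cis (\<xi> $ i * t)"
  have ind: "(indicator (period_box a) y :: real) = (\<Prod>i\<in>UNIV. indicator {a $ i - pi..a $ i + pi} (y $ i))" for y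
  proof (cases "y \<in> period_box a")
    case True
    then show ?thesis by (simp add: period_box_def mem_box_cart)
  next
    case False
    then obtain i where "y $ i \<notin> {a $ i - pi..a $ i + pi}"
      by (auto simp: period_box_def mem_box_cart)
    then have "(\<Prod>i\<in>UNIV. indicator {a $ i - pi..a $ i + pi} (y $ i) :: real) = 0"
      by (intro prod_zero bexI[of _ i]) auto
    then show ?thesis using False by simp
  qed
  have "indicator (period_box a) y *\<^sub>R cis (\<xi> \<bullet> y) = (\<Prod>i\<in>UNIV. ?f i (y $ i))" for y
    unfolding ind scaleR_conv_of_real prod.distrib inner_vec_def cis_sum by (simp add: prod.distrib)
  then have "(\<integral>y. indicator (period_box a) y *\<^sub>R cis (\<xi> \<bullet> y) \<partial>lborel) = (\<Prod>i\<in>UNIV. \<integral>t. ?f i t \<partial>lborel)"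
    by (simp only:, subst integral_prod_components)
       (auto intro!: borel_integrable_compact continuous_intros)
  also have "\<dots> = (\<Prod>i\<in>UNIV. if \<xi> $ i = 0 then of_real (2 * pi) else 0)"
    using assms by (intro prod.cong refl integral_cis_period) (auto simp: lattice_def)
  also have "\<dots> = (if \<xi> = 0 then of_real (period_volume TYPE('n)) else 0)"
  proof (cases "\<xi> = 0")
    case False
    then obtain i where "\<xi> $ i \<noteq> 0" by (auto simp: vec_eq_iff)
    then show ?thesis using False by (auto intro!: prod_zero)
  qed (simp add: period_volume_def)
  finally show ?thesis .
qed

lemma parseval_trig_sum:
  fixes a :: "real ^ 'n::finite"
  assumes F: "finite F" "F \<subseteq> lattice"
  shows "(\<integral>y. indicator (period_box a) y * (cmod (\<Sum>\<xi>\<in>F. s \<xi> * cis (- (\<xi> \<bullet> y))))\<^sup>2 \<partial>lborel) =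
    period_volume TYPE('n) * (\<Sum>\<xi>\<in>F. (cmod (s \<xi>))\<^sup>2)"
proof -
  let ?g = "\<lambda>y. \<Sum>\<xi>\<in>F. s \<xi> * cis (- (\<xi> \<bullet> y))"
  have int: "integrable lborel (\<lambda>y. indicator (period_box a) y *\<^sub>R cis (\<zeta> \<bullet> y))" for \<zeta>
    by (intro borel_integrable_compact compact_period_box continuous_intros)
  have "complex_of_real (indicator (period_box a) y * (cmod (?g y))\<^sup>2) =
      (\<Sum>\<xi>\<in>F. \<Sum>\<eta>\<in>F. s \<xi> * cnj (s \<eta>) * (indicator (period_box a) y *\<^sub>R cis ((\<eta> - \<xi>) \<bullet> y)))" for y
  proof -
    have "complex_of_real ((cmod (?g y))\<^sup>2) = ?g y * cnj (?g y)"
      by (rule complex_norm_square)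
    also have "\<dots> = (\<Sum>\<xi>\<in>F. \<Sum>\<eta>\<in>F. (s \<xi> * cis (- (\<xi> \<bullet> y))) * (cnj (s \<eta>) * cis (\<eta> \<bullet> y)))"
      by (simp add: sum_product cis_cnj)
    also have "\<dots> = (\<Sum>\<xi>\<in>F. \<Sum>\<eta>\<in>F. s \<xi> * cnj (s \<eta>) * cis ((\<eta> - \<xi>) \<bullet> y))"
    proof (intro sum.cong refl)
      fix \<xi> \<eta>
      have "cis ((\<eta> - \<xi>) \<bullet> y) = cis (- (\<xi> \<bullet> y)) * cis (\<eta> \<bullet> y)"
        by (simp add: cis_mult inner_diff_left)
      then show "(s \<xi> * cis (- (\<xi> \<bullet> y))) * (cnj (s \<eta>) * cis (\<eta> \<bullet> y)) = s \<xi> * cnj (s \<eta>) * cis ((\<eta> - \<xi>) \<bullet> y)"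
        by (simp add: mult_ac)
    qed
    finally show ?thesis
      by (simp add: scaleR_conv_of_real sum_distrib_left mult_ac)
  qed
  note pt = this
  have "complex_of_real (\<integral>y. indicator (period_box a) y * (cmod (?g y))\<^sup>2 \<partial>lborel) =
     (\<integral>y. (\<Sum>\<xi>\<in>F. \<Sum>\<eta>\<in>F. s \<xi> * cnj (s \<eta>) * (indicator (period_box a) y *\<^sub>R cis ((\<eta> - \<xi>) \<bullet> y))) \<partial>lborel)"
    unfolding integral_complex_of_real[symmetric] pt ..
  also have "\<dots> = (\<Sum>\<xi>\<in>F. \<Sum>\<eta>\<in>F. s \<xi> * cnj (s \<eta>) * (\<integral>y. indicator (period_box a) y *\<^sub>R cis ((\<eta> - \<xi>) \<bullet> y) \<partial>lborel))"
    by (simp only: Bochner_Integration.integral_sum Bochner_Integration.integrable_sum integrable_mult_right int integral_mult_right_zero)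
  also have "\<dots> = (\<Sum>\<xi>\<in>F. \<Sum>\<eta>\<in>F. if \<eta> = \<xi> then s \<xi> * cnj (s \<eta>) * of_real (period_volume TYPE('n)) else 0)"
    using F(2) by (intro sum.cong refl) (subst integral_cis_period_box, auto intro: lattice_diff)
  also have "\<dots> = of_real (period_volume TYPE('n) * (\<Sum>\<xi>\<in>F. (cmod (s \<xi>))\<^sup>2))"
    using F(1) by (simp add: sum.delta complex_norm_square[symmetric] sum_distrib_left mult.commute)
  finally show ?thesis
    using of_real_eq_iff by blast
qed

section \<open>The Bessel inequality on finite sets of frequencies\<close>

definition L2_over :: "'a::euclidean_space set \<Rightarrow> ('a \<Rightarrow> complex) \<Rightarrow> real"
  where "L2_over K f = sqrt (\<integral>y. indicator K y * (cmod (f y))\<^sup>2 \<partial>lborel)"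

lemma L2_over_nonneg: "L2_over K f \<ge> 0"
  by (simp add: L2_over_def)

lemma integrable_cmod_square:
  assumes "compact K" "continuous_on K f"
  shows "integrable lborel (\<lambda>y::'a::euclidean_space. indicator K y * (cmod (f y))\<^sup>2)"
  using borel_integrable_compact[OF assms(1), of "\<lambda>y. (cmod (f y))\<^sup>2"] assms(2)
  by (simp add: continuous_on_power continuous_on_norm)

lemma Cauchy_Schwarz_compact:
  fixes f g :: "'a::euclidean_space \<Rightarrow> complex"
  assumes K: "compact K" and f: "continuous_on K f" and g: "continuous_on K g"
  shows "cmod (\<integral>y. indicator K y *\<^sub>R (f y * g y) \<partial>lborel) \<le> L2_over K f * L2_over K g"
proof -
  let ?F = "\<lambda>y. indicator K y * cmod (f y)" and ?G = "\<lambda>y. indicator K y * cmod (g y)"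
  have [measurable]: "?F \<in> borel_measurable borel" "?G \<in> borel_measurable borel"
    using borel_measurable_continuous_on_indicator[of K "\<lambda>y. cmod (f y)"]
      borel_measurable_continuous_on_indicator[of K "\<lambda>y. cmod (g y)"] borel_compact[OF K] f g
    by (simp_all add: continuous_on_norm)
  have int: "integrable lborel (\<lambda>y. ?F y * ?G y)"
  proof -
    have "integrable lborel (\<lambda>y. indicator K y *\<^sub>R (cmod (f y) * cmod (g y)))"
      by (intro borel_integrable_compact K continuous_intros f g)
    then show ?thesis by (rule Bochner_Integration.integrable_cong[THEN iffD1, rotated -1]) (auto simp: indicator_def)
  qed
  define X where "X = (\<integral>y. ?F y * ?G y \<partial>lborel)"
  have sq: "(\<integral>\<^sup>+y. (ennreal (indicator K y * cmod (h y)))\<^sup>2 \<partial>lborel) = ennreal ((L2_over K h)\<^sup>2)"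
    if "continuous_on K h" for h
  proof -
    have "(\<integral>\<^sup>+y. (ennreal (indicator K y * cmod (h y)))\<^sup>2 \<partial>lborel) = (\<integral>\<^sup>+y. ennreal (indicator K y * (cmod (h y))\<^sup>2) \<partial>lborel)"
      by (intro nn_integral_cong) (auto simp: ennreal_power indicator_def)
    also have "\<dots> = ennreal (\<integral>y. indicator K y * (cmod (h y))\<^sup>2 \<partial>lborel)"
      by (rule nn_integral_eq_integral[OF integrable_cmod_square[OF K that]]) auto
    finally show ?thesis
      by (simp add: L2_over_def)
  qed
  have "X \<ge> 0" by (auto simp: X_def)
  have "ennreal (X\<^sup>2) = (\<integral>\<^sup>+y. ennreal (?F y) * ennreal (?G y) \<partial>lborel)\<^sup>2"
    using nn_integral_eq_integral[OF int] \<open>X \<ge> 0\<close>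
    by (simp add: X_def ennreal_mult ennreal_power)
  also have "\<dots> \<le> (\<integral>\<^sup>+y. (ennreal (?F y))\<^sup>2 \<partial>lborel) * (\<integral>\<^sup>+y. (ennreal (?G y))\<^sup>2 \<partial>lborel)"
    by (rule Cauchy_Schwarz_nn_integral) auto
  also have "\<dots> = ennreal ((L2_over K f * L2_over K g)\<^sup>2)"
    unfolding sq[OF f] sq[OF g] by (simp add: ennreal_mult power_mult_distrib)
  finally have "X\<^sup>2 \<le> (L2_over K f * L2_over K g)\<^sup>2"
    by (subst (asm) ennreal_le_iff) auto
  then have "X \<le> L2_over K f * L2_over K g"
    by (rule power2_le_imp_le) (simp add: L2_over_nonneg)
  moreover have "cmod (\<integral>y. indicator K y *\<^sub>R (f y * g y) \<partial>lborel) \<le> X"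
    unfolding X_def
    by (rule order_trans[OF integral_norm_bound])
      (auto intro!: eq_refl Bochner_Integration.integral_cong simp: norm_mult indicator_def)
  ultimately show ?thesis by linarith
qed

lemma L2_over_mono:
  assumes "compact K" "compact K'" "K \<subseteq> K'" "continuous_on K f" "continuous_on K' g" "0 \<le> B"
    and "\<And>y. y \<in> K \<Longrightarrow> cmod (f y) \<le> B * cmod (g y)"
  shows "L2_over K f \<le> B * L2_over K' g"
proof -
  have "(\<integral>y. indicator K y * (cmod (f y))\<^sup>2 \<partial>lborel) \<le> (\<integral>y. B\<^sup>2 * (indicator K' y * (cmod (g y))\<^sup>2) \<partial>lborel)"
  proof (rule integral_mono)
    show "indicator K y * (cmod (f y))\<^sup>2 \<le> B\<^sup>2 * (indicator K' y * (cmod (g y))\<^sup>2)" for y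
      using assms(3,6) power_mono[OF assms(7), of y 2] by (auto simp: indicator_def power_mult_distrib)
  qed (auto intro!: integrable_cmod_square integrable_mult_right assms)
  then have "L2_over K f \<le> sqrt (B\<^sup>2 * (\<integral>y. indicator K' y * (cmod (g y))\<^sup>2 \<partial>lborel))"
    unfolding L2_over_def by simp
  then show ?thesis
    using assms(6) by (simp add: L2_over_def real_sqrt_mult)
qed

lemma fcoeff_eq_integral_over:
  assumes "test_fun K a"
  shows "fcoeff (\<lambda>y. a y * u y) \<xi> = (\<integral>y. indicator K y *\<^sub>R (u y * (a y * cis (- (\<xi> \<bullet> y)))) \<partial>lborel)"
  unfolding fcoeff_def using assms
  by (intro Bochner_Integration.integral_cong) (auto simp: test_fun_def indicator_def)

text \<open>
  The inequalities of Bessel and Cauchy--Schwarz in dual form: after multiplication by numbers of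
  modulus at most 1 the sum is a single integral of \<open>u\<close> against \<open>a\<close> times a trigonometric sum, whose
  \<open>L\<^sup>2\<close> norm over a period is given by Parseval.
\<close>

lemma sum_fcoeff_le:
  fixes a :: "real ^ 'n::finite \<Rightarrow> complex"
  assumes K: "compact K" "K \<subseteq> period_box x" and a: "test_fun K a" and u: "continuous_on K u"
    and F: "finite F" "F \<subseteq> lattice" and B: "\<And>y. cmod (a y) \<le> B"
  shows "(\<Sum>\<xi>\<in>F. cmod (fcoeff (\<lambda>y. a y * u y) \<xi>)) \<le> B * sqrt (period_volume TYPE('n) * card F) * L2_over K u"
proof -
  \<comment> \<open>multiplication by \<open>s \<xi>\<close> turns the coefficient into its absolute value\<close>
  define s where "s \<xi> = cnj (sgn (fcoeff (\<lambda>y. a y * u y) \<xi>))" for \<xi>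
  define g where "g y = (\<Sum>\<xi>\<in>F. s \<xi> * cis (- (\<xi> \<bullet> y)))" for y
  have s: "cmod (s \<xi>) \<le> 1" for \<xi> by (simp add: s_def norm_sgn)
  have B0: "B \<ge> 0" using B[of 0] norm_ge_zero order_trans by blast
  have g: "continuous_on S g" for S unfolding g_def by (intro continuous_intros)
  have ac: "continuous_on K a" by (rule test_fun_continuous[OF a])
  have "complex_of_real (\<Sum>\<xi>\<in>F. cmod (fcoeff (\<lambda>y. a y * u y) \<xi>)) = (\<Sum>\<xi>\<in>F. s \<xi> * fcoeff (\<lambda>y. a y * u y) \<xi>)"
  proof -
    have "complex_of_real (cmod z) = cnj (sgn z) * z" for z :: complex
      by (cases "z = 0") (simp_all add: sgn_eq complex_norm_square[symmetric] power2_eq_square field_simps)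
    then show ?thesis by (simp add: s_def)
  qed
  also have "\<dots> = (\<Sum>\<xi>\<in>F. \<integral>y. s \<xi> * (indicator K y *\<^sub>R (u y * (a y * cis (- (\<xi> \<bullet> y))))) \<partial>lborel)"
    by (simp only: fcoeff_eq_integral_over[OF a] integral_mult_right_zero)
  also have "\<dots> = (\<integral>y. (\<Sum>\<xi>\<in>F. s \<xi> * (indicator K y *\<^sub>R (u y * (a y * cis (- (\<xi> \<bullet> y)))))) \<partial>lborel)"
    by (subst Bochner_Integration.integral_sum)
      (auto intro!: integrable_mult_right borel_integrable_compact K continuous_intros u ac)
  also have "\<dots> = (\<integral>y. indicator K y *\<^sub>R (u y * (a y * g y)) \<partial>lborel)"
    by (intro Bochner_Integration.integral_cong refl) (simp add: g_def sum_distrib_left scaleR_conv_of_real mult_ac)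
  finally have "(\<Sum>\<xi>\<in>F. cmod (fcoeff (\<lambda>y. a y * u y) \<xi>)) = cmod (\<integral>y. indicator K y *\<^sub>R (u y * (a y * g y)) \<partial>lborel)"
    by (metis (no_types, lifting) abs_of_nonneg norm_ge_zero norm_of_real sum_nonneg)
  also have "\<dots> \<le> L2_over K u * L2_over K (\<lambda>y. a y * g y)"
    by (intro Cauchy_Schwarz_compact K u continuous_intros ac g)
  also have "\<dots> \<le> L2_over K u * (B * sqrt (period_volume TYPE('n) * card F))"
  proof (rule mult_left_mono[OF _ L2_over_nonneg])
    have "L2_over K (\<lambda>y. a y * g y) \<le> B * L2_over (period_box x) g"
      by (rule L2_over_mono[OF K(1) compact_period_box K(2) _ g B0])
        (auto intro!: continuous_intros ac g mult_right_mono B simp: norm_mult)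
    also have "L2_over (period_box x) g \<le> sqrt (period_volume TYPE('n) * card F)"
    proof -
      have "(\<Sum>\<xi>\<in>F. (cmod (s \<xi>))\<^sup>2) \<le> (\<Sum>\<xi>\<in>F. 1)"
        using s by (intro sum_mono) (simp add: power_le_one)
      then show ?thesis
        using period_volume_pos[where 'n='n] unfolding L2_over_def g_def parseval_trig_sum[OF F] by simp
    qed
    finally show "L2_over K (\<lambda>y. a y * g y) \<le> B * sqrt (period_volume TYPE('n) * card F)"
      using B0 by (simp add: mult_left_mono)
  qed
  finally show ?thesis
    by (simp add: mult_ac)
qed

section \<open>Bounding a function by its Fourier coefficients\<close>

text \<open>
  The normalised powers of \<open>w\<close> concentrate at its unique maximum \<open>x\<close>, so the averages of \<open>f\<close> against
  them tend to \<open>f x\<close>. The proof is by contradiction: if \<open>\<bar>f x\<bar> > M\<close> then \<open>h\<close>, obtained by subtracting \<open>M\<close>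
  from the component of \<open>f\<close> in the direction of \<open>f x\<close>, is bounded below by some \<open>\<epsilon> > 0\<close> near \<open>x\<close>,
  although its average against every power of \<open>w\<close> is at most 0.
\<close>

lemma peak_kernel_bound:
  fixes f :: "'a::euclidean_space \<Rightarrow> complex" and w :: "'a \<Rightarrow> real"
  assumes Q: "compact Q" and x: "x \<in> interior Q"
    and f: "continuous_on Q f" and w: "continuous_on Q w"
    and w01: "\<And>y. y \<in> Q \<Longrightarrow> 0 \<le> w y" and wx: "w x = 1"
    and w1: "\<And>y. y \<in> Q \<Longrightarrow> y \<noteq> x \<Longrightarrow> w y < 1"
    and bound: "\<And>N. cmod (\<integral>y. indicator Q y *\<^sub>R (f y * of_real (w y ^ N)) \<partial>lborel) \<le> M * (\<integral>y. indicator Q y * w y ^ N \<partial>lborel)"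
  shows "cmod (f x) \<le> M"
proof (rule ccontr)
  assume "\<not> cmod (f x) \<le> M"
  then have gt: "cmod (f x) > M" by simp
  have xQ: "x \<in> Q" using x interior_subset by blast
  define h where "h y = Re (f y * cnj (sgn (f x))) - M" for y
  have hc: "continuous_on Q h"
    unfolding h_def by (intro continuous_intros f)
  have hx: "h x > 0"
  proof -
    have "complex_of_real (cmod z) = z * cnj (sgn z)" for z :: complex
      by (cases "z = 0") (simp_all add: sgn_eq complex_norm_square[symmetric] power2_eq_square field_simps)
    then have "Re (f x * cnj (sgn (f x))) = cmod (f x)"
      by (metis Re_complex_of_real)
    then show ?thesis using gt by (simp add: h_def)
  qed
  define \<epsilon> where "\<epsilon> = h x / 2"
  have \<epsilon>: "\<epsilon> > 0" "\<epsilon> < h x" using hx by (auto simp: \<epsilon>_def)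
  obtain \<delta> where \<delta>: "\<delta> > 0" "\<And>y. y \<in> Q \<Longrightarrow> dist y x < \<delta> \<Longrightarrow> h y \<ge> \<epsilon>"
  proof -
    obtain \<delta> where "\<delta> > 0" "\<forall>y\<in>Q. dist y x < \<delta> \<longrightarrow> dist (h y) (h x) < \<epsilon>"
      using hc \<epsilon>(1) xQ unfolding continuous_on_iff by blast
    moreover have "h y \<ge> \<epsilon>" if "dist (h y) (h x) < \<epsilon>" for y
      using that unfolding \<epsilon>_def dist_real_def by linarith
    ultimately show thesis
      using that[of \<delta>] by blast
  qed
  obtain q where q: "0 \<le> q" "q < 1" "\<And>y. y \<in> Q \<Longrightarrow> \<delta> \<le> dist y x \<Longrightarrow> w y \<le> q"
  proof (cases "Q - ball x \<delta> = {}")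
    case True
    then have "dist y x < \<delta>" if "y \<in> Q" for y
      using that by (auto simp: dist_commute)
    then show thesis
      using that[of 0] by force
  next
    case False
    have "compact (Q - ball x \<delta>)"
      using Q by (intro compact_diff) auto
    then obtain z where z: "z \<in> Q - ball x \<delta>" "\<forall>y\<in>Q - ball x \<delta>. w y \<le> w z"
      using continuous_attains_sup[OF _ False continuous_on_subset[OF w]] by blast
    have "z \<noteq> x" using z(1) \<delta>(1) by auto
    then show thesis
      using that[of "w z"] z w01 w1 by (auto simp: dist_commute)
  qed
  \<comment> \<open>\<open>w \<le> q\<close> away from \<open>x\<close> but \<open>w \<ge> q'\<close> close to it, so the ratio of the two contributions decays like
  \<open>(q / q')\<^sup>N\<close>\<close>
  define q' where "q' = (1 + q) / 2"
  have q': "q < q'" "q' < 1" "0 < q'" using q by (auto simp: q'_def)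
  obtain \<eta> where \<eta>: "\<eta> > 0" "ball x \<eta> \<subseteq> Q" "\<eta> \<le> \<delta>" "\<And>y. y \<in> ball x \<eta> \<Longrightarrow> w y \<ge> q'"
  proof -
    obtain a where a: "a > 0" "\<forall>y\<in>Q. dist y x < a \<longrightarrow> dist (w y) (w x) < 1 - q'"
      using w q'(2) xQ unfolding continuous_on_iff by (metis diff_gt_0_iff_gt)
    obtain b where b: "b > 0" "ball x b \<subseteq> Q"
      using x mem_interior by blast
    have "w y \<ge> q'" if "y \<in> ball x (min \<delta> (min a b))" for y
    proof -
      have "y \<in> Q" "dist y x < a" using that b by (auto simp: dist_commute)
      then have "dist (w y) (w x) < 1 - q'" using a(2) by blast
      then show ?thesis unfolding wx dist_real_def by linarith
    qed
    moreover have "ball x (min \<delta> (min a b)) \<subseteq> Q" using b by auto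
    ultimately show thesis
      using that[of "min \<delta> (min a b)"] a(1) b(1) \<delta>(1) by auto
  qed
  obtain H where H: "H > 0" "\<And>y. y \<in> Q \<Longrightarrow> \<bar>h y\<bar> \<le> H"
    using compact_imp_bounded[OF compact_continuous_image[OF hc Q]] unfolding bounded_pos by auto
  have int1: "integrable lborel (\<lambda>y. indicator Q y * (g y :: real))" if "continuous_on Q g" for g
    using borel_integrable_compact[OF Q that] by simp
  have int2: "integrable lborel (\<lambda>y. indicator Q y *\<^sub>R (f y * of_real (w y ^ N)))" for N
    by (intro borel_integrable_compact Q continuous_intros f w)
  have wN: "continuous_on Q (\<lambda>y. w y ^ N)" for N by (intro continuous_intros w)
  have neg: "(\<integral>y. indicator Q y * (h y * w y ^ N) \<partial>lborel) \<le> 0" for N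
  proof -
    define I where "I = (\<integral>y. indicator Q y *\<^sub>R (f y * of_real (w y ^ N)) \<partial>lborel)"
    have "(\<integral>y. indicator Q y * (h y * w y ^ N) \<partial>lborel) =
      (\<integral>y. Re ((indicator Q y *\<^sub>R (f y * of_real (w y ^ N))) * cnj (sgn (f x))) - M * (indicator Q y * w y ^ N) \<partial>lborel)"
      by (intro Bochner_Integration.integral_cong refl) (simp add: h_def indicator_def algebra_simps)
    also have "\<dots> = Re (I * cnj (sgn (f x))) - M * (\<integral>y. indicator Q y * w y ^ N \<partial>lborel)"
    proof -
      define J where "J y = indicator Q y *\<^sub>R (f y * of_real (w y ^ N))" for y
      let ?d = "cnj (sgn (f x))"
      have iJ: "integrable lborel (\<lambda>y. J y * ?d)"
        unfolding J_def by (intro integrable_mult_left int2)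
      have "(\<integral>y. Re (J y * ?d) - M * (indicator Q y * w y ^ N) \<partial>lborel) =
          (\<integral>y. Re (J y * ?d) \<partial>lborel) - (\<integral>y. M * (indicator Q y * w y ^ N) \<partial>lborel)"
        using iJ int1[OF wN] by (intro Bochner_Integration.integral_diff integrable_mult_right integrable_Re)
      also have "(\<integral>y. Re (J y * ?d) \<partial>lborel) = Re (\<integral>y. J y * ?d \<partial>lborel)"
        by (rule integral_Re[OF iJ])
      also have "(\<integral>y. J y * ?d \<partial>lborel) = I * ?d"
        by (simp only: J_def I_def integral_mult_left_zero)
      finally show ?thesis
        by (simp only: J_def integral_mult_right_zero)
    qed
    also have "Re (I * cnj (sgn (f x))) \<le> cmod I"
    proof -
      have "Re (I * cnj (sgn (f x))) \<le> cmod I * cmod (sgn (f x))"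
        using complex_Re_le_cmod[of "I * cnj (sgn (f x))"] by (simp add: norm_mult)
      also have "\<dots> \<le> cmod I * 1" by (intro mult_left_mono) (auto simp: norm_sgn)
      finally show ?thesis by simp
    qed
    finally show ?thesis
      using bound[of N] by (simp add: I_def)
  qed
  define vb where "vb = measure lborel (ball x \<eta>)"
  define vq where "vq = measure lborel Q"
  have vb: "vb > 0" using \<eta>(1) by (simp add: vb_def content_ball_pos)
  have key: "\<epsilon> * q' ^ N * vb \<le> H * q ^ N * vq" for N
  proof -
    have ib: "integrable lborel (\<lambda>y. indicator (ball x \<eta>) y :: real)"
      using emeasure_lborel_ball_finite by (intro integrable_real_indicator) auto
    have iq: "integrable lborel (\<lambda>y. indicator Q y :: real)"
      using int1[of "\<lambda>_. 1"] by simp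
    have "\<epsilon> * q' ^ N * vb - H * q ^ N * vq =
      (\<integral>y. \<epsilon> * q' ^ N * indicator (ball x \<eta>) y - H * q ^ N * indicator Q y \<partial>lborel)"
      using ib iq borel_compact[OF Q] by (simp add: vb_def vq_def)
    also have "\<dots> \<le> (\<integral>y. indicator Q y * (h y * w y ^ N) \<partial>lborel)"
    proof (rule integral_mono)
      show "integrable lborel (\<lambda>y. indicator Q y * (h y * w y ^ N))"
        by (intro int1 continuous_intros hc w)
      show "\<epsilon> * q' ^ N * indicator (ball x \<eta>) y - H * q ^ N * indicator Q y \<le> indicator Q y * (h y * w y ^ N)" for y
      proof (cases "y \<in> Q")
        case False
        then show ?thesis using \<eta>(2) by (auto simp: indicator_def)
      next
        case True
        have H0: "0 \<le> H * q ^ N" using H q by simp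
        show ?thesis
        proof (cases "dist y x < \<delta>")
          case near: True
          then have hy: "h y \<ge> \<epsilon>" using \<delta>(2) True by blast
          show ?thesis
          proof (cases "y \<in> ball x \<eta>")
            case in_ball: True
            have "\<epsilon> * q' ^ N \<le> h y * w y ^ N"
              using \<epsilon>(1) hy q'(3) \<eta>(4)[OF in_ball] by (intro mult_mono power_mono) auto
            then show ?thesis using True in_ball H0 by simp
          next
            case False
            moreover have "0 \<le> h y * w y ^ N"
              using hy \<epsilon>(1) w01[OF True] by simp
            ultimately show ?thesis using True H0 by simp
          qed
        next
          case far: False
          then have nb: "y \<notin> ball x \<eta>" using \<eta>(3) by (auto simp: dist_commute)
          have "- (h y * w y ^ N) \<le> \<bar>h y\<bar> * w y ^ N"
            using w01[OF True] by (metis abs_ge_minus_self minus_mult_left mult_right_mono zero_le_power)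
          also have "\<dots> \<le> H * q ^ N"
            using H True far q w01[OF True] by (intro mult_mono power_mono) auto
          finally show ?thesis using True nb by simp
        qed
      qed
    qed (use ib iq in auto)
    also have "\<dots> \<le> 0" by (rule neg)
    finally show ?thesis by simp
  qed
  have "(\<lambda>N. H * vq * (q / q') ^ N) \<longlonglongrightarrow> H * vq * 0"
    using q q' by (intro tendsto_mult_left LIMSEQ_power_zero) auto
  moreover have "\<epsilon> * vb \<le> H * vq * (q / q') ^ N" for N
    using key[of N] q'(3) by (simp add: power_divide field_simps)
  ultimately have "\<epsilon> * vb \<le> 0"
    by (simp add: LIMSEQ_le_const)
  then show False
    using \<epsilon>(1) vb by (simp add: mult_le_0_iff)
qed

text \<open>
  Finite combinations of lattice exponentials. They are generated by adding single terms, which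
  makes closure under products an easy induction.
\<close>

inductive_set trig_poly :: "(real ^ 'n::finite \<Rightarrow> complex) set" where
  zero: "(\<lambda>_. 0) \<in> trig_poly"
| add: "g \<in> trig_poly \<Longrightarrow> \<xi> \<in> lattice \<Longrightarrow> (\<lambda>y. g y + c * cis (- (\<xi> \<bullet> y))) \<in> trig_poly"

lemma trig_poly_mult_cis:
  assumes "g \<in> trig_poly" "\<eta> \<in> lattice"
  shows "(\<lambda>y. g y * (d * cis (- (\<eta> \<bullet> y)))) \<in> trig_poly"
  using assms(1)
proof induction
  case (add g \<xi> c)
  have "(\<lambda>y. (g y + c * cis (- (\<xi> \<bullet> y))) * (d * cis (- (\<eta> \<bullet> y)))) =
     (\<lambda>y. g y * (d * cis (- (\<eta> \<bullet> y))) + (c * d) * cis (- ((\<xi> + \<eta>) \<bullet> y)))"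
    by (simp add: fun_eq_iff algebra_simps inner_add_left cis_mult[symmetric] cis_divide[symmetric] minus_add flip: cis_inverse)
       (simp add: cis_mult cis_divide algebra_simps inner_add_left divide_inverse)
  then show ?case
    using trig_poly.add[OF add.IH lattice_add[OF add.hyps(2) assms(2)]] by simp
qed (simp add: trig_poly.zero)

lemma trig_poly_add: "g \<in> trig_poly \<Longrightarrow> h \<in> trig_poly \<Longrightarrow> (\<lambda>y. h y + g y) \<in> trig_poly"
proof (induction rule: trig_poly.induct)
  case (add g \<xi> c)
  then show ?case
    using trig_poly.add[of "\<lambda>y. h y + g y" \<xi> c] by (simp add: add.assoc)
qed simp

lemma trig_poly_mult: "g \<in> trig_poly \<Longrightarrow> h \<in> trig_poly \<Longrightarrow> (\<lambda>y. h y * g y) \<in> trig_poly"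
proof (induction rule: trig_poly.induct)
  case (add g \<xi> c)
  then show ?case
    using trig_poly_add[OF trig_poly_mult_cis[of h \<xi> c], of "\<lambda>y. h y * g y"] by (simp add: distrib_left)
qed (simp add: trig_poly.zero)

lemma trig_poly_cis: "\<xi> \<in> lattice \<Longrightarrow> (\<lambda>y. c * cis (- (\<xi> \<bullet> y))) \<in> trig_poly"
  using trig_poly.add[OF trig_poly.zero, of \<xi> c] by simp

lemma trig_poly_const: "(\<lambda>y. c) \<in> trig_poly"
  using trig_poly_cis[OF lattice_0, of c] by simp

lemma trig_poly_prod:
  "finite I \<Longrightarrow> (\<And>i. i \<in> I \<Longrightarrow> g i \<in> trig_poly) \<Longrightarrow> (\<lambda>y. \<Prod>i\<in>I. g i y) \<in> trig_poly"
  by (induction I rule: finite_induct) (auto simp: trig_poly_const intro!: trig_poly_mult)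

text \<open>
  Repeated frequencies are collected here, so that orthogonality determines the coefficients.
\<close>

lemma trig_poly_expansion:
  assumes "g \<in> trig_poly"
  obtains F a where "finite F" "F \<subseteq> lattice" "g = (\<lambda>y. \<Sum>\<xi>\<in>F. a \<xi> * cis (- (\<xi> \<bullet> y)))"
proof -
  have "\<exists>F a. finite F \<and> F \<subseteq> lattice \<and> g = (\<lambda>y. \<Sum>\<xi>\<in>F. a \<xi> * cis (- (\<xi> \<bullet> y)))"
    using assms
  proof induction
    case zero
    show ?case by (intro exI[of _ "{}"]) auto
  next
    case (add g \<xi> c)
    then obtain F a where F: "finite F" "F \<subseteq> lattice" "g = (\<lambda>y. \<Sum>\<xi>\<in>F. a \<xi> * cis (- (\<xi> \<bullet> y)))"
      by blast
    \<comment> \<open>the new frequency may already occur in \<open>F\<close>\<close>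
    define a' where "a' \<zeta> = (if \<zeta> \<in> F then a \<zeta> else 0) + (if \<zeta> = \<xi> then c else 0)" for \<zeta>
    have "(\<Sum>\<zeta>\<in>insert \<xi> F. a' \<zeta> * cis (- (\<zeta> \<bullet> y))) = g y + c * cis (- (\<xi> \<bullet> y))" for y
    proof -
      have "(\<Sum>\<zeta>\<in>insert \<xi> F. a' \<zeta> * cis (- (\<zeta> \<bullet> y))) =
        (\<Sum>\<zeta>\<in>insert \<xi> F. if \<zeta> \<in> F then a \<zeta> * cis (- (\<zeta> \<bullet> y)) else 0) +
        (\<Sum>\<zeta>\<in>insert \<xi> F. if \<zeta> = \<xi> then c * cis (- (\<zeta> \<bullet> y)) else 0)"
        unfolding sum.distrib[symmetric] a'_def by (intro sum.cong) (auto simp: distrib_right)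
      also have "(\<Sum>\<zeta>\<in>insert \<xi> F. if \<zeta> \<in> F then a \<zeta> * cis (- (\<zeta> \<bullet> y)) else 0) = g y"
        unfolding F(3) using F(1) by (intro sum.mono_neutral_cong_right) auto
      finally show ?thesis using F(1) by (simp add: sum.delta)
    qed
    then show ?case
      using F add.hyps by (intro exI[of _ "insert \<xi> F"] exI[of _ a']) auto
  qed
  then show thesis using that by blast
qed

text \<open>
  Pairing \<open>f\<close> with \<open>g\<close> gives the sum of the coefficients of \<open>g\<close> times those of \<open>f\<close>, and by orthogonality
  each coefficient of \<open>g\<close> is at most its mean absolute value over a period.
\<close>

lemma trig_poly_pairing_bound:
  fixes g :: "real ^ 'n::finite \<Rightarrow> complex"
  assumes g: "g \<in> trig_poly" and f: "\<And>\<xi>. integrable lborel (\<lambda>y. f y * cis (- (\<xi> \<bullet> y)))"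
    and S: "\<And>F. finite F \<Longrightarrow> F \<subseteq> lattice \<Longrightarrow> (\<Sum>\<xi>\<in>F. cmod (fcoeff f \<xi>)) \<le> S"
  shows "period_volume TYPE('n) * cmod (\<integral>y. f y * g y \<partial>lborel)
    \<le> (\<integral>y. indicator (period_box x) y * cmod (g y) \<partial>lborel) * S"
proof -
  obtain F a where F: "finite F" "F \<subseteq> lattice" and ga: "g = (\<lambda>y. \<Sum>\<xi>\<in>F. a \<xi> * cis (- (\<xi> \<bullet> y)))"
    using trig_poly_expansion[OF g] .
  let ?V = "period_volume TYPE('n)"
  let ?G = "\<integral>y. indicator (period_box x) y * cmod (g y) \<partial>lborel"
  have gc: "continuous_on A g" for A unfolding ga by (intro continuous_intros)
  have coef: "?V * cmod (a \<xi>) \<le> ?G" if "\<xi> \<in> F" for \<xi>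
  proof -
    have int: "integrable lborel (\<lambda>y. indicator (period_box x) y *\<^sub>R cis (\<zeta> \<bullet> y))" for \<zeta>
      by (intro borel_integrable_compact compact_period_box continuous_intros)
    have "(\<integral>y. indicator (period_box x) y *\<^sub>R (g y * cis (\<xi> \<bullet> y)) \<partial>lborel) =
      (\<integral>y. (\<Sum>\<eta>\<in>F. a \<eta> * (indicator (period_box x) y *\<^sub>R cis ((\<xi> - \<eta>) \<bullet> y))) \<partial>lborel)"
    proof (intro Bochner_Integration.integral_cong refl)
      fix y
      have "cis ((\<xi> - \<eta>) \<bullet> y) = cis (- (\<eta> \<bullet> y)) * cis (\<xi> \<bullet> y)" for \<eta>
        by (simp add: cis_mult inner_diff_left)
      then show "indicator (period_box x) y *\<^sub>R (g y * cis (\<xi> \<bullet> y)) = (\<Sum>\<eta>\<in>F. a \<eta> * (indicator (period_box x) y *\<^sub>R cis ((\<xi> - \<eta>) \<bullet> y)))"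
        by (simp add: ga sum_distrib_left sum_distrib_right scaleR_conv_of_real mult_ac)
    qed
    also have "\<dots> = (\<Sum>\<eta>\<in>F. a \<eta> * (\<integral>y. indicator (period_box x) y *\<^sub>R cis ((\<xi> - \<eta>) \<bullet> y) \<partial>lborel))"
      by (simp only: Bochner_Integration.integral_sum Bochner_Integration.integrable_sum integrable_mult_right int integral_mult_right_zero)
    also have "\<dots> = (\<Sum>\<eta>\<in>F. if \<eta> = \<xi> then a \<eta> * of_real ?V else 0)"
      using F(2) that by (intro sum.cong refl) (subst integral_cis_period_box, auto intro: lattice_diff)
    also have "\<dots> = a \<xi> * of_real ?V"
      using F(1) that by (simp add: sum.delta)
    finally have "?V * cmod (a \<xi>) = cmod (\<integral>y. indicator (period_box x) y *\<^sub>R (g y * cis (\<xi> \<bullet> y)) \<partial>lborel)"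
      using period_volume_pos[where 'n='n] by (simp add: norm_mult)
    also have "\<dots> \<le> (\<integral>y. cmod (indicator (period_box x) y *\<^sub>R (g y * cis (\<xi> \<bullet> y))) \<partial>lborel)"
      by (rule integral_norm_bound)
    also have "\<dots> = ?G"
      by (simp add: norm_mult)
    finally show ?thesis .
  qed
  have "(\<integral>y. f y * g y \<partial>lborel) = (\<integral>y. (\<Sum>\<xi>\<in>F. a \<xi> * (f y * cis (- (\<xi> \<bullet> y)))) \<partial>lborel)"
    by (intro Bochner_Integration.integral_cong refl) (simp add: ga sum_distrib_left mult_ac)
  also have "\<dots> = (\<Sum>\<xi>\<in>F. a \<xi> * fcoeff f \<xi>)"
    unfolding fcoeff_def
    by (simp only: Bochner_Integration.integral_sum Bochner_Integration.integrable_sum integrable_mult_right f integral_mult_right_zero)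
  finally have "?V * cmod (\<integral>y. f y * g y \<partial>lborel) \<le> ?V * (\<Sum>\<xi>\<in>F. cmod (a \<xi>) * cmod (fcoeff f \<xi>))"
    using period_volume_pos[where 'n='n] by (simp add: norm_mult sum_norm_le)
  also have "\<dots> = (\<Sum>\<xi>\<in>F. (?V * cmod (a \<xi>)) * cmod (fcoeff f \<xi>))"
    by (simp add: sum_distrib_left mult.assoc)
  also have "\<dots> \<le> (\<Sum>\<xi>\<in>F. ?G * cmod (fcoeff f \<xi>))"
    using coef by (intro sum_mono mult_right_mono) auto
  also have "\<dots> = ?G * (\<Sum>\<xi>\<in>F. cmod (fcoeff f \<xi>))"
    by (simp add: sum_distrib_left)
  also have "\<dots> \<le> ?G * S"
    using S[OF F] by (intro mult_left_mono integral_nonneg_AE) auto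
  finally show ?thesis .
qed

text \<open>
  This inequality replaces Fourier inversion. The powers of the product of the
  \<open>(1 + cos (y\<^sub>i - x\<^sub>i)) / 2\<close> are non-negative trigonometric polynomials that peak at \<open>x\<close>; being
  non-negative, their mean absolute value is their mean, so the pairing bound controls the
  averages of \<open>f\<close> uniformly in the power.
\<close>

lemma pointwise_le_sum_fcoeff:
  fixes f :: "real ^ 'n::finite \<Rightarrow> complex"
  assumes K: "compact K" "K \<subseteq> period_box x" and f: "continuous_on UNIV f" "\<And>y. y \<notin> K \<Longrightarrow> f y = 0"
    and S: "\<And>F. finite F \<Longrightarrow> F \<subseteq> lattice \<Longrightarrow> (\<Sum>\<xi>\<in>F. cmod (fcoeff f \<xi>)) \<le> S"
  shows "period_volume TYPE('n) * cmod (f x) \<le> S"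
proof -
  let ?V = "period_volume TYPE('n)"
  have V: "?V > 0" by (rule period_volume_pos)
  define w where "w y = (\<Prod>i\<in>UNIV. (1 + cos (y $ i - x $ i)) / 2)" for y :: "real ^ 'n"
  have factor: "0 \<le> (1 + cos t) / 2" "(1 + cos t) / 2 \<le> 1" for t :: real
    using cos_ge_minus_one[of t] cos_le_one[of t] by (auto simp del: cos_le_one cos_ge_minus_one)
  have w0: "0 \<le> w y" for y unfolding w_def by (intro prod_nonneg ballI factor)
  have "(\<lambda>y. complex_of_real (w y)) \<in> trig_poly"
  proof -
    have "complex_of_real ((1 + cos (y $ i - x $ i)) / 2) =
        (1/2 + cis (x $ i) / 4 * cis (- (axis i 1 \<bullet> y))) + cis (- (x $ i)) / 4 * cis (- (axis i (-1) \<bullet> y))" for i y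
    proof -
      have "cis (x $ i) * cis (- (y $ i)) + cis (- (x $ i)) * cis (y $ i) = of_real (2 * cos (y $ i - x $ i))"
        by (simp add: cis_mult complex_eq_iff cos_diff sin_diff)
      then show ?thesis
        by (simp add: inner_axis' field_simps)
    qed
    moreover have "(\<lambda>y. (1/2 + cis (x $ i) / 4 * cis (- (axis i 1 \<bullet> y))) + cis (- (x $ i)) / 4 * cis (- (axis i (-1) \<bullet> y))) \<in> trig_poly" for i
      by (intro trig_poly.add trig_poly_const lattice_axis) auto
    ultimately have "(\<lambda>y. complex_of_real ((1 + cos (y $ i - x $ i)) / 2)) \<in> trig_poly" for i
      by presburger
    from trig_poly_prod[OF finite this] show ?thesis
      unfolding w_def by simp
  qed
  then have wN: "(\<lambda>y. complex_of_real (w y ^ N)) \<in> trig_poly" for N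
    by (induction N) (auto simp: trig_poly_const intro!: trig_poly_mult)
  have "cmod (f x) \<le> S / ?V"
  proof (rule peak_kernel_bound[OF compact_period_box[of x]])
    show "x \<in> interior (period_box x)"
      unfolding period_box_def interior_cbox by (simp add: mem_box_cart)
    show "continuous_on (period_box x) f" using f(1) continuous_on_subset by blast
    show "continuous_on (period_box x) w" unfolding w_def by (intro continuous_intros) simp
    show "0 \<le> w y" for y by (rule w0)
    show "w x = 1" by (simp add: w_def)
    show "w y < 1" if y: "y \<in> period_box x" "y \<noteq> x" for y
    proof -
      obtain i where i: "y $ i \<noteq> x $ i" using y(2) by (auto simp: vec_eq_iff)
      have "\<bar>y $ i - x $ i\<bar> \<le> pi" using y(1) by (simp add: mem_period_box)
      then have "cos \<bar>y $ i - x $ i\<bar> < cos 0"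
        using i by (intro cos_monotone_0_pi) auto
      then have lt: "(1 + cos (y $ i - x $ i)) / 2 < 1" by simp
      have "w y = (1 + cos (y $ i - x $ i)) / 2 * (\<Prod>j\<in>UNIV - {i}. (1 + cos (y $ j - x $ j)) / 2)"
        unfolding w_def by (rule prod.remove) auto
      also have "\<dots> \<le> (1 + cos (y $ i - x $ i)) / 2 * 1"
        using factor by (intro mult_left_mono prod_le_1) auto
      finally show ?thesis using lt by simp
    qed
    fix N
    have "?V * cmod (\<integral>y. f y * of_real (w y ^ N) \<partial>lborel) \<le>
        (\<integral>y. indicator (period_box x) y * cmod (of_real (w y ^ N)) \<partial>lborel) * S"
    proof (rule trig_poly_pairing_bound[OF wN _ S])
      show "integrable lborel (\<lambda>y. f y * cis (- (\<xi> \<bullet> y)))" for \<xi>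
        by (intro integrable_compact_support[OF K(1)] continuous_intros continuous_on_subset[OF f(1)]) (auto simp: f(2))
    qed
    moreover have "(\<integral>y. f y * of_real (w y ^ N) \<partial>lborel) = (\<integral>y. indicator (period_box x) y *\<^sub>R (f y * of_real (w y ^ N)) \<partial>lborel)"
      using K(2) f(2) by (intro Bochner_Integration.integral_cong refl) (auto simp: indicator_def)
    moreover have "cmod (of_real (w y ^ N)) = w y ^ N" for y
      using w0[of y] by (simp add: norm_power)
    ultimately show "cmod (\<integral>y. indicator (period_box x) y *\<^sub>R (f y * of_real (w y ^ N)) \<partial>lborel)
        \<le> S / ?V * (\<integral>y. indicator (period_box x) y * w y ^ N \<partial>lborel)"
      using V by (simp add: field_simps)
  qed
  then show ?thesis using V by (simp add: field_simps)
qed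

section \<open>Ellipticity and the near level set\<close>

definition monom_at :: "'n::finite multi_index \<Rightarrow> real ^ 'n \<Rightarrow> complex"
  where "monom_at \<alpha> \<xi> = (\<Prod>i\<in>UNIV. of_real (\<xi> $ i) ^ \<alpha> i)"

definition principal_symbol :: "('n::finite multi_index \<Rightarrow> complex) \<Rightarrow> nat \<Rightarrow> real ^ 'n \<Rightarrow> complex"
  where "principal_symbol c m \<xi> = (\<Sum>\<alpha> | mi_order \<alpha> = m. c \<alpha> * monom_at \<alpha> \<xi>)"

definition elliptic :: "('n::finite multi_index \<Rightarrow> complex) \<Rightarrow> nat \<Rightarrow> bool"
  where "elliptic c m \<longleftrightarrow> (\<exists>c0>0. \<forall>\<xi>. c0 * norm \<xi> ^ m \<le> cmod (principal_symbol c m \<xi>))"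

lemma op_symbol_monom_at: "op_symbol c m \<xi> = (\<Sum>\<alpha> | mi_order \<alpha> \<le> m. c \<alpha> * monom_at \<alpha> \<xi>)"
  by (simp add: op_symbol_def monom_at_def)

lemma norm_monom_at_le: "cmod (monom_at \<alpha> \<xi>) \<le> norm \<xi> ^ mi_order \<alpha>"
proof -
  have "cmod (monom_at \<alpha> \<xi>) = (\<Prod>i\<in>UNIV. \<bar>\<xi> $ i\<bar> ^ \<alpha> i)"
    by (simp add: monom_at_def prod_norm[symmetric] norm_power)
  also have "\<dots> \<le> (\<Prod>i\<in>UNIV. norm \<xi> ^ \<alpha> i)"
    by (intro prod_mono) (auto intro!: power_mono component_le_norm_cart)
  also have "\<dots> = norm \<xi> ^ mi_order \<alpha>"
    by (simp add: mi_order_def power_sum)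
  finally show ?thesis .
qed

lemma monom_at_scale: "monom_at \<alpha> (t *\<^sub>R \<xi>) = of_real t ^ mi_order \<alpha> * monom_at \<alpha> \<xi>"
  by (simp add: monom_at_def mi_order_def power_sum power_mult_distrib prod.distrib)

lemma finite_mi_order_eq: "finite {\<alpha> :: 'n::finite multi_index. mi_order \<alpha> = m}"
  by (rule finite_subset[OF _ finite_mi_order_le[of m]]) auto

lemma op_symbol_minus_principal_le:
  assumes "m \<ge> 1"
  shows "\<exists>C\<ge>0. \<forall>\<xi> :: real ^ 'n::finite. cmod (op_symbol c m \<xi> - principal_symbol c m \<xi>) \<le> C * (1 + norm \<xi>) ^ (m - 1)"
proof (intro exI conjI allI)
  let ?C = "\<Sum>\<alpha> :: 'n multi_index | mi_order \<alpha> < m. cmod (c \<alpha>)"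
  show "0 \<le> ?C" by (simp add: sum_nonneg)
  fix \<xi> :: "real ^ 'n"
  have "{\<alpha> :: 'n multi_index. mi_order \<alpha> \<le> m} = {\<alpha>. mi_order \<alpha> < m} \<union> {\<alpha>. mi_order \<alpha> = m}"
    by auto
  moreover have fin: "finite {\<alpha> :: 'n multi_index. mi_order \<alpha> < m}"
    by (rule finite_subset[OF _ finite_mi_order_le[of m]]) auto
  ultimately have "op_symbol c m \<xi> - principal_symbol c m \<xi> = (\<Sum>\<alpha> | mi_order \<alpha> < m. c \<alpha> * monom_at \<alpha> \<xi>)"
    unfolding op_symbol_monom_at principal_symbol_def
    by (simp add: sum.union_disjoint finite_mi_order_eq disjoint_iff)
  also have "cmod \<dots> \<le> (\<Sum>\<alpha> | mi_order \<alpha> < m. cmod (c \<alpha>) * (1 + norm \<xi>) ^ (m - 1))"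
  proof (rule sum_norm_le)
    fix \<alpha> :: "'n multi_index" assume "\<alpha> \<in> {\<alpha>. mi_order \<alpha> < m}"
    then have "(1 + norm \<xi>) ^ mi_order \<alpha> \<le> (1 + norm \<xi>) ^ (m - 1)"
      by (intro power_increasing) auto
    moreover have "norm \<xi> ^ mi_order \<alpha> \<le> (1 + norm \<xi>) ^ mi_order \<alpha>"
      by (intro power_mono) auto
    ultimately have "cmod (monom_at \<alpha> \<xi>) \<le> (1 + norm \<xi>) ^ (m - 1)"
      using norm_monom_at_le[of \<alpha> \<xi>] by linarith
    then show "cmod (c \<alpha> * monom_at \<alpha> \<xi>) \<le> cmod (c \<alpha>) * (1 + norm \<xi>) ^ (m - 1)"
      by (simp add: norm_mult mult_left_mono)
  qed
  finally show "cmod (op_symbol c m \<xi> - principal_symbol c m \<xi>) \<le> ?C * (1 + norm \<xi>) ^ (m - 1)"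
    by (simp add: sum_distrib_right)
qed

lemma op_symbol_le:
  "\<exists>C\<ge>0. \<forall>\<xi> :: real ^ 'n::finite. cmod (op_symbol c m \<xi>) \<le> C * (1 + norm \<xi>) ^ m"
proof (intro exI conjI allI)
  let ?C = "\<Sum>\<alpha> :: 'n multi_index | mi_order \<alpha> \<le> m. cmod (c \<alpha>)"
  show "0 \<le> ?C" by (simp add: sum_nonneg)
  fix \<xi> :: "real ^ 'n"
  have "cmod (op_symbol c m \<xi>) \<le> (\<Sum>\<alpha> | mi_order \<alpha> \<le> m. cmod (c \<alpha>) * (1 + norm \<xi>) ^ m)"
    unfolding op_symbol_monom_at
  proof (rule sum_norm_le)
    fix \<alpha> :: "'n multi_index" assume "\<alpha> \<in> {\<alpha>. mi_order \<alpha> \<le> m}"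
    then have "(1 + norm \<xi>) ^ mi_order \<alpha> \<le> (1 + norm \<xi>) ^ m"
      by (intro power_increasing) auto
    moreover have "norm \<xi> ^ mi_order \<alpha> \<le> (1 + norm \<xi>) ^ mi_order \<alpha>"
      by (intro power_mono) auto
    ultimately have "cmod (monom_at \<alpha> \<xi>) \<le> (1 + norm \<xi>) ^ m"
      using norm_monom_at_le[of \<alpha> \<xi>] by linarith
    then show "cmod (c \<alpha> * monom_at \<alpha> \<xi>) \<le> cmod (c \<alpha>) * (1 + norm \<xi>) ^ m"
      by (simp add: norm_mult mult_left_mono)
  qed
  then show "cmod (op_symbol c m \<xi>) \<le> ?C * (1 + norm \<xi>) ^ m"
    by (simp add: sum_distrib_right)
qed

lemma principal_symbol_scale: "principal_symbol c m (t *\<^sub>R \<xi>) = of_real t ^ m * principal_symbol c m \<xi>"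
  unfolding principal_symbol_def monom_at_scale sum_distrib_left by (intro sum.cong) auto

text \<open>
  The continuous function \<open>\<bar>P\<^sub>m\<bar>\<close> attains its minimum on the unit sphere, and by homogeneity a
  positive minimum is an ellipticity constant.
\<close>

lemma not_elliptic_zero:
  fixes c :: "'n::finite multi_index \<Rightarrow> complex"
  assumes "\<not> elliptic c m"
  obtains \<omega> where "norm \<omega> = 1" "principal_symbol c m \<omega> = 0"
proof -
  let ?S = "sphere (0 :: real ^ 'n) 1"
  have "continuous_on ?S (\<lambda>\<xi>. cmod (principal_symbol c m \<xi>))"
    unfolding principal_symbol_def monom_at_def by (intro continuous_intros)
  moreover have "?S \<noteq> {}"
    using norm_axis_1 by fastforce
  ultimately obtain \<omega> where \<omega>: "\<omega> \<in> ?S" "\<And>\<xi>. \<xi> \<in> ?S \<Longrightarrow> cmod (principal_symbol c m \<omega>) \<le> cmod (principal_symbol c m \<xi>)"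
    using continuous_attains_inf[OF compact_sphere] by meson
  have "cmod (principal_symbol c m \<omega>) * norm \<xi> ^ m \<le> cmod (principal_symbol c m \<xi>)" for \<xi>
  proof (cases "\<xi> = 0")
    case True
    have "principal_symbol c m \<xi> = 0 ^ m * principal_symbol c m \<omega>"
      using principal_symbol_scale[of c m 0 \<omega>] True by simp
    then show ?thesis using True by (simp add: norm_mult norm_power power_0_left)
  next
    case False
    have "principal_symbol c m \<xi> = of_real (norm \<xi>) ^ m * principal_symbol c m (\<xi> /\<^sub>R norm \<xi>)"
      using principal_symbol_scale[of c m "norm \<xi>" "\<xi> /\<^sub>R norm \<xi>"] False by simp
    moreover have "\<xi> /\<^sub>R norm \<xi> \<in> ?S" using False by simp
    ultimately show ?thesis
      using \<omega>(2) by (simp add: norm_mult norm_power mult_left_mono mult.commute)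
  qed
  then have "principal_symbol c m \<omega> = 0"
    using assms unfolding elliptic_def by (metis zero_less_norm_iff)
  then show thesis using that \<omega>(1) by simp
qed

lemma lattice_norm_ge_1:
  assumes "\<xi> \<in> lattice" "\<xi> \<noteq> 0"
  shows "norm \<xi> \<ge> 1"
proof -
  obtain i where "\<xi> $ i \<noteq> 0" using assms(2) by (auto simp: vec_eq_iff)
  then have "\<bar>\<xi> $ i\<bar> \<ge> 1"
    using assms(1) Ints_nonzero_abs_ge1 by (auto simp: lattice_def)
  then show ?thesis using component_le_norm_cart[of \<xi> i] by linarith
qed

text \<open>
  Along the sequence \<open>\<bar>P \<xi> - \<lambda>\<bar>\<close> grows at most like \<open>\<bar>\<xi>\<bar>\<^sup>p\<close>, which is eventually below \<open>\<bar>\<xi>\<bar>\<^bsup>m-1+\<delta>\<^esup>\<close>. So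
  the near level set is unbounded.
\<close>

lemma infinite_near_level_set:
  fixes \<xi> :: "nat \<Rightarrow> real ^ 'n::finite"
  assumes lat: "\<And>k. \<xi> k \<in> lattice" and large: "\<And>k. norm (\<xi> k) \<ge> real k - d"
    and P: "\<And>k. cmod (op_symbol c m (\<xi> k)) \<le> C * (1 + norm (\<xi> k)) ^ p"
    and p: "real p < real m - 1 + \<delta>" and C: "C \<ge> 0"
  shows "infinite (near_level_set c m \<delta> lam)"
proof
  assume fin: "finite (near_level_set c m \<delta> lam)"
  define e where "e = real m - 1 + \<delta>"
  define B where "B = C * 2 ^ p + cmod lam"
  have B: "B \<ge> 0" using C by (simp add: B_def)
  have "filterlim (\<lambda>t::real. t powr (e - real p)) at_top at_top"
  proof -
    have "e - real p > 0" using p by (simp add: e_def)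
    then show ?thesis by real_asymp
  qed
  then obtain T where T: "\<And>t. t \<ge> T \<Longrightarrow> B \<le> t powr (e - real p)"
    unfolding filterlim_at_top eventually_at_top_linorder by blast
  have near: "\<xi> k \<in> near_level_set c m \<delta> lam" if k: "norm (\<xi> k) \<ge> max 1 T" for k
  proof -
    define t where "t = norm (\<xi> k)"
    have t: "t \<ge> 1" "t \<ge> T" using k by (auto simp: t_def)
    have tp: "t ^ p \<ge> 1" using t(1) by simp
    have "cmod (op_symbol c m (\<xi> k) - lam) \<le> C * (1 + t) ^ p + cmod lam"
      using P[of k] norm_triangle_ineq4[of "op_symbol c m (\<xi> k)" lam] by (simp add: t_def)
    also have "C * (1 + t) ^ p \<le> C * (2 * t) ^ p"
      using C t by (intro mult_left_mono power_mono) auto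
    also have "C * (2 * t) ^ p + cmod lam \<le> C * (2 * t) ^ p + cmod lam * t ^ p"
      using tp mult_left_mono[of 1 "t ^ p" "cmod lam"] by simp
    also have "\<dots> = B * t ^ p" by (simp add: B_def power_mult_distrib algebra_simps)
    also have "\<dots> \<le> t powr (e - real p) * t ^ p"
      using T[OF t(2)] tp by (intro mult_right_mono) auto
    also have "\<dots> = t powr e"
      using t(1) by (simp add: powr_realpow[symmetric] powr_add[symmetric])
    finally show ?thesis
      using lat[of k] by (simp add: near_level_set_def lattice_def t_def e_def)
  qed
  obtain R where R: "\<And>\<eta>. \<eta> \<in> near_level_set c m \<delta> lam \<Longrightarrow> norm \<eta> \<le> R"
    using finite_imp_bounded[OF fin] unfolding bounded_iff by blast
  obtain k :: nat where "real k > max (max 1 T) R + d"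
    using reals_Archimedean2 by blast
  then have "norm (\<xi> k) > max (max 1 T) R" using large[of k] by linarith
  then show False using near[of k] R[of "\<xi> k"] by auto
qed

text \<open>
  Dividing both points by \<open>T\<close> moves them into the unit cube, where the product is Lipschitz in each
  factor; homogeneity then restores the power of \<open>T\<close>.
\<close>

lemma monom_at_diff_le:
  assumes T: "T > 0" and x: "\<And>i. \<bar>x $ i\<bar> \<le> T" and y: "\<And>i. \<bar>y $ i\<bar> \<le> T" and d: "\<And>i. \<bar>x $ i - y $ i\<bar> \<le> 1"
    and m: "mi_order \<alpha> \<ge> 1"
  shows "cmod (monom_at \<alpha> x - monom_at \<alpha> y) \<le> real (mi_order \<alpha>) * T ^ (mi_order \<alpha> - 1)"
proof -
  let ?m = "mi_order \<alpha>"
  let ?x = "(1 / T) *\<^sub>R x" and ?y = "(1 / T) *\<^sub>R y"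
  have "cmod (monom_at \<alpha> ?x - monom_at \<alpha> ?y) \<le> (\<Sum>i\<in>UNIV. cmod (of_real (?x $ i) ^ \<alpha> i - of_real (?y $ i) ^ \<alpha> i))"
    unfolding monom_at_def
    by (rule norm_prod_diff) (use T x y in \<open>auto simp: norm_power norm_divide abs_div intro!: power_le_one\<close>)
  also have "\<dots> \<le> (\<Sum>i\<in>UNIV. real (\<alpha> i) * (1 / T))"
  proof (rule sum_mono)
    fix i
    have "cmod (complex_of_real (?x $ i) ^ \<alpha> i - of_real (?y $ i) ^ \<alpha> i) \<le> real (\<alpha> i) * cmod (of_real (?x $ i) - complex_of_real (?y $ i))"
      by (rule norm_power_diff) (use T x y in \<open>auto simp: norm_divide\<close>)
    also have "cmod (of_real (?x $ i) - complex_of_real (?y $ i)) = \<bar>x $ i - y $ i\<bar> / T"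
    proof -
      have "complex_of_real (?x $ i) - of_real (?y $ i) = of_real ((x $ i - y $ i) / T)"
        by (simp add: diff_divide_distrib)
      then show ?thesis using T by (simp only: norm_of_real) (simp add: abs_div)
    qed
    also have "\<dots> \<le> 1 / T" using d T by (simp add: divide_right_mono)
    finally show "cmod (complex_of_real (?x $ i) ^ \<alpha> i - of_real (?y $ i) ^ \<alpha> i) \<le> real (\<alpha> i) * (1 / T)"
      by (simp add: mult_left_mono)
  qed
  also have "\<dots> = real ?m / T"
    by (simp add: mi_order_def sum_divide_distrib)
  finally have le: "cmod (monom_at \<alpha> ?x - monom_at \<alpha> ?y) \<le> real ?m / T" .
  have "monom_at \<alpha> z = of_real T ^ ?m * monom_at \<alpha> ((1 / T) *\<^sub>R z)" for z :: "real ^ 'a"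
    using monom_at_scale[of \<alpha> T "(1 / T) *\<^sub>R z"] T by simp
  then have "monom_at \<alpha> x - monom_at \<alpha> y = of_real T ^ ?m * (monom_at \<alpha> ?x - monom_at \<alpha> ?y)"
    by (metis right_diff_distrib)
  then have "cmod (monom_at \<alpha> x - monom_at \<alpha> y) = T ^ ?m * cmod (monom_at \<alpha> ?x - monom_at \<alpha> ?y)"
    using T by (simp add: norm_mult norm_power)
  also have "\<dots> \<le> T ^ ?m * (real ?m / T)"
    using T le by (intro mult_left_mono) auto
  also have "\<dots> = real ?m * T ^ (?m - 1)"
    using T m by (cases ?m) auto
  finally show ?thesis .
qed

text \<open>
  Take a real zero \<open>\<omega>\<close> of the principal symbol on the sphere and round \<open>k \<omega>\<close> to the lattice. The
  rounding error is bounded and the principal symbol vanishes at \<open>k \<omega>\<close>, so at the rounded point it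
  has size \<open>O(k\<^bsup>m-1\<^esup>)\<close>.
\<close>

lemma infinite_near_level_set_not_elliptic:
  fixes c :: "'n::finite multi_index \<Rightarrow> complex"
  assumes m: "m \<ge> 1" and \<delta>: "\<delta> > 0" and "\<not> elliptic c m"
  shows "infinite (near_level_set c m \<delta> lam)"
proof -
  obtain \<omega> where \<omega>: "norm \<omega> = 1" "principal_symbol c m \<omega> = 0"
    using not_elliptic_zero[OF assms(3)] .
  define \<xi> :: "nat \<Rightarrow> real ^ 'n" where "\<xi> k = (\<chi> i. of_int (round (real k * \<omega> $ i)))" for k
  define d where "d = real CARD('n)"
  have diff: "\<bar>\<xi> k $ i - (real k *\<^sub>R \<omega>) $ i\<bar> \<le> 1/2" for k i
    using of_int_round_abs_le[of "real k * \<omega> $ i"] by (simp add: \<xi>_def)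
  have nd: "norm (\<xi> k - real k *\<^sub>R \<omega>) \<le> d" for k
  proof -
    have "norm (\<xi> k - real k *\<^sub>R \<omega>) \<le> (\<Sum>i\<in>UNIV. \<bar>(\<xi> k - real k *\<^sub>R \<omega>) $ i\<bar>)"
      by (rule norm_le_l1_cart)
    also have "\<dots> \<le> (\<Sum>i\<in>(UNIV::'n set). 1)"
    proof (rule sum_mono)
      show "\<bar>(\<xi> k - real k *\<^sub>R \<omega>) $ i\<bar> \<le> 1" for i
        using diff[of k i] by simp
    qed
    finally show ?thesis by (simp add: d_def)
  qed
  have large: "norm (\<xi> k) \<ge> real k - d" for k
    using nd[of k] norm_triangle_ineq2[of "real k *\<^sub>R \<omega>" "\<xi> k"] \<omega>(1) by (simp add: norm_minus_commute)
  obtain C1 where C1: "C1 \<ge> 0" "\<And>\<xi> :: real ^ 'n. cmod (op_symbol c m \<xi> - principal_symbol c m \<xi>) \<le> C1 * (1 + norm \<xi>) ^ (m - 1)"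
    using op_symbol_minus_principal_le[OF m] by metis
  define A where "A = (\<Sum>\<alpha> :: 'n multi_index | mi_order \<alpha> = m. cmod (c \<alpha>))"
  have A: "A \<ge> 0" by (simp add: A_def sum_nonneg)
  have main: "cmod (principal_symbol c m (\<xi> k)) \<le> (A * real m * (1 + d) ^ (m - 1)) * (1 + norm (\<xi> k)) ^ (m - 1)" for k
  proof -
    let ?T = "real k + 1"
    have p0: "principal_symbol c m (real k *\<^sub>R \<omega>) = 0"
      using \<omega>(2) by (simp add: principal_symbol_scale)
    have comp: "\<bar>(real k *\<^sub>R \<omega>) $ i\<bar> \<le> real k" for i
      using component_le_norm_cart[of "real k *\<^sub>R \<omega>" i] \<omega>(1) by simp
    have "principal_symbol c m (\<xi> k) = principal_symbol c m (\<xi> k) - principal_symbol c m (real k *\<^sub>R \<omega>)"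
      using p0 by simp
    also have "\<dots> = (\<Sum>\<alpha> | mi_order \<alpha> = m. c \<alpha> * (monom_at \<alpha> (\<xi> k) - monom_at \<alpha> (real k *\<^sub>R \<omega>)))"
      unfolding principal_symbol_def by (simp only: sum_subtractf[symmetric] right_diff_distrib)
    also have "cmod \<dots> \<le> (\<Sum>\<alpha> :: 'n multi_index | mi_order \<alpha> = m. cmod (c \<alpha>) * (real m * ?T ^ (m - 1)))"
    proof (rule sum_norm_le)
      fix \<alpha> :: "'n multi_index" assume "\<alpha> \<in> {\<alpha>. mi_order \<alpha> = m}"
      then have \<alpha>: "mi_order \<alpha> = m" by simp
      have "cmod (monom_at \<alpha> (\<xi> k) - monom_at \<alpha> (real k *\<^sub>R \<omega>)) \<le> real (mi_order \<alpha>) * ?T ^ (mi_order \<alpha> - 1)"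
      proof (rule monom_at_diff_le)
        show "\<bar>\<xi> k $ i\<bar> \<le> ?T" "\<bar>(real k *\<^sub>R \<omega>) $ i\<bar> \<le> ?T" "\<bar>\<xi> k $ i - (real k *\<^sub>R \<omega>) $ i\<bar> \<le> 1" for i
          using diff[of k i] comp[of i] by linarith+
      qed (use m \<alpha> in auto)
      then show "cmod (c \<alpha> * (monom_at \<alpha> (\<xi> k) - monom_at \<alpha> (real k *\<^sub>R \<omega>))) \<le> cmod (c \<alpha>) * (real m * ?T ^ (m - 1))"
        unfolding \<alpha> norm_mult by (intro mult_left_mono) auto
    qed
    also have "\<dots> = A * real m * ?T ^ (m - 1)"
      by (simp add: A_def sum_distrib_right mult.assoc)
    also have "\<dots> \<le> A * real m * ((1 + d) * (1 + norm (\<xi> k))) ^ (m - 1)"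
    proof (intro mult_left_mono power_mono)
      have "real k + 1 \<le> norm (\<xi> k) + d + 1" using large[of k] by simp
      also have "\<dots> \<le> (1 + d) * (1 + norm (\<xi> k))"
        by (simp add: d_def algebra_simps)
      finally show "?T \<le> (1 + d) * (1 + norm (\<xi> k))" .
    qed (use A in auto)
    finally show ?thesis by (simp add: power_mult_distrib mult_ac)
  qed
  show ?thesis
  proof (rule infinite_near_level_set[where \<xi>=\<xi> and d=d and p="m - 1"])
    show "\<xi> k \<in> lattice" for k by (simp add: \<xi>_def lattice_def)
    show "real k - d \<le> norm (\<xi> k)" for k by (rule large)
    show "cmod (op_symbol c m (\<xi> k)) \<le> (C1 + A * real m * (1 + d) ^ (m - 1)) * (1 + norm (\<xi> k)) ^ (m - 1)" for k
      using C1(2)[of "\<xi> k"] main[of k] norm_triangle_ineq[of "op_symbol c m (\<xi> k) - principal_symbol c m (\<xi> k)" "principal_symbol c m (\<xi> k)"]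
      by (simp add: distrib_right)
    show "real (m - 1) < real m - 1 + \<delta>" using m \<delta> by (simp add: of_nat_diff)
    show "0 \<le> C1 + A * real m * (1 + d) ^ (m - 1)" using C1(1) A by (simp add: d_def)
  qed
qed

lemma infinite_near_level_set_large_exponent:
  fixes c :: "'n::finite multi_index \<Rightarrow> complex"
  assumes "\<delta> > 1"
  shows "infinite (near_level_set c m \<delta> lam)"
proof -
  obtain C where C: "C \<ge> 0" "\<And>\<xi> :: real ^ 'n. cmod (op_symbol c m \<xi>) \<le> C * (1 + norm \<xi>) ^ m"
    using op_symbol_le by metis
  have axis: "norm (axis i a :: real ^ 'n) = \<bar>a\<bar>" for i and a :: real
    by (simp add: norm_eq_sqrt_inner inner_axis_axis)
  show ?thesis
  proof (rule infinite_near_level_set[where \<xi>="\<lambda>k. axis undefined (real k)" and d=0 and p=m, OF _ _ C(2) _ C(1)])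
    show "axis undefined (real k) \<in> lattice" for k by (rule lattice_axis) auto
  qed (use assms axis in auto)
qed

text \<open>
  For \<open>\<bar>\<xi>\<bar> \<ge> K \<bar>\<lambda>\<bar>\<^bsup>1/m\<^esup>\<close> both \<open>\<bar>\<lambda>\<bar>\<close> and the lower order terms are at most a multiple of \<open>\<bar>\<xi>\<bar>\<^sup>m / K\<close>, which
  a large \<open>K\<close> makes smaller than half of the principal part.
\<close>

lemma elliptic_lower_bound:
  fixes c :: "'n::finite multi_index \<Rightarrow> complex"
  assumes m: "m \<ge> 1" and "elliptic c m"
  obtains K c1 where "K \<ge> 1" "c1 > 0"
    "\<And>lam (\<xi> :: real ^ 'n). cmod lam \<ge> 1 \<Longrightarrow> norm \<xi> \<ge> K * cmod lam powr (1 / real m) \<Longrightarrow>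
       c1 * norm \<xi> ^ m \<le> cmod (op_symbol c m \<xi> - lam)"
proof -
  obtain c0 where c0: "c0 > 0" "\<And>\<xi> :: real ^ 'n. c0 * norm \<xi> ^ m \<le> cmod (principal_symbol c m \<xi>)"
    using assms(2) unfolding elliptic_def by blast
  obtain C where C: "C \<ge> 0" "\<And>\<xi> :: real ^ 'n. cmod (op_symbol c m \<xi> - principal_symbol c m \<xi>) \<le> C * (1 + norm \<xi>) ^ (m - 1)"
    using op_symbol_minus_principal_le[OF m] by metis
  define E where "E = C * 2 ^ (m - 1) + 1"
  have E: "E \<ge> 1" using C by (simp add: E_def)
  define K where "K = max 1 (2 * E / c0)"
  have K: "K \<ge> 1" "E / K \<le> c0 / 2"
  proof -
    show "K \<ge> 1" by (simp add: K_def)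
    have "2 * E / c0 \<le> K" by (simp add: K_def)
    then show "E / K \<le> c0 / 2"
      using c0(1) \<open>K \<ge> 1\<close> by (simp add: field_simps)
  qed
  show thesis
  proof
    show "K \<ge> 1" "c0 / 2 > 0" using K c0 by auto
    fix lam and \<xi> :: "real ^ 'n"
    assume lam: "cmod lam \<ge> 1" and ge: "norm \<xi> \<ge> K * cmod lam powr (1 / real m)"
    define t where "t = norm \<xi>"
    have l1: "cmod lam powr (1 / real m) \<ge> 1"
      using lam by (simp add: ge_one_powr_ge_zero)
    have tK: "t \<ge> K"
    proof -
      have "K * 1 \<le> K * cmod lam powr (1 / real m)"
        using l1 K(1) by (intro mult_left_mono) auto
      then show ?thesis using ge by (simp add: t_def)
    qed
    have t1: "t \<ge> 1" using tK K(1) by simp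
    obtain m' where m': "m = Suc m'" using m by (cases m) auto
    have pm: "t ^ (m - 1) \<le> t ^ m / K"
      using tK K(1) t1 mult_right_mono[of K t "t ^ m'"] by (simp add: m' field_simps)
    have lamle: "cmod lam \<le> t ^ m / K"
    proof -
      have "(cmod lam powr (1 / real m)) ^ m = (cmod lam powr (1 / real m)) powr real m"
        by (rule powr_realpow[symmetric]) (use l1 in linarith)
      then have "cmod lam = (cmod lam powr (1 / real m)) ^ m"
        using lam m by (simp add: powr_powr)
      also have "\<dots> \<le> (t / K) ^ m"
        using ge K(1) by (intro power_mono) (auto simp: t_def field_simps)
      also have "\<dots> = t ^ m / K ^ m" by (simp add: power_divide)
      also have "\<dots> \<le> t ^ m / K"
        using K(1) t1 m power_increasing[of 1 m K] by (intro divide_left_mono) auto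
      finally show ?thesis .
    qed
    have "C * (1 + t) ^ (m - 1) \<le> C * (2 * t) ^ (m - 1)"
      using C(1) t1 by (intro mult_left_mono power_mono) auto
    also have "\<dots> = C * 2 ^ (m - 1) * t ^ (m - 1)" by (simp add: power_mult_distrib)
    also have "\<dots> \<le> C * 2 ^ (m - 1) * (t ^ m / K)"
      using pm C(1) by (intro mult_left_mono) auto
    finally have "C * (1 + t) ^ (m - 1) \<le> C * 2 ^ (m - 1) * (t ^ m / K)" .
    moreover have "E * (t ^ m / K) = C * 2 ^ (m - 1) * (t ^ m / K) + t ^ m / K"
      by (simp only: E_def distrib_right mult_1_left)
    ultimately have "C * (1 + t) ^ (m - 1) + cmod lam \<le> E * (t ^ m / K)"
      using lamle by linarith
    also have "\<dots> = E / K * t ^ m" by simp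
    also have "\<dots> \<le> c0 / 2 * t ^ m"
      using K(2) t1 by (intro mult_right_mono) auto
    finally have low': "C * (1 + t) ^ (m - 1) + cmod lam \<le> c0 / 2 * t ^ m" .
    have "cmod (principal_symbol c m \<xi>) \<le> cmod (op_symbol c m \<xi> - lam) + cmod lam + cmod (op_symbol c m \<xi> - principal_symbol c m \<xi>)"
    proof -
      have "principal_symbol c m \<xi> = (op_symbol c m \<xi> - lam) + lam - (op_symbol c m \<xi> - principal_symbol c m \<xi>)" by simp
      then show ?thesis
        using norm_triangle_ineq4 norm_triangle_ineq by (smt (verit))
    qed
    then show "c0 / 2 * norm \<xi> ^ m \<le> cmod (op_symbol c m \<xi> - lam)"
      using c0(2)[of \<xi>] C(2)[of \<xi>] low' unfolding t_def by linarith
  qed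
qed

text \<open>
  Frequencies of the near level set with \<open>\<bar>\<xi>\<bar>\<close> large compared to \<open>\<bar>\<lambda>\<bar>\<^bsup>1/m\<^esup>\<close> are included. For \<open>\<delta> = 1\<close>
  such frequencies can occur even if the near level set is finite, and Bessel alone would give
  the wrong power of \<open>\<bar>\<lambda>\<bar>\<close> for them.
\<close>

lemma symbol_lower_bound_off_near_set:
  fixes c :: "'n::finite multi_index \<Rightarrow> complex"
  assumes m: "m \<ge> 1" and "elliptic c m" and \<delta>: "\<delta> \<le> 1"
  obtains K c1 where "K \<ge> 1" "c1 > 0"
    "\<And>lam (\<xi> :: real ^ 'n). cmod lam \<ge> 1 \<Longrightarrow> \<xi> \<in> lattice \<Longrightarrow> \<xi> \<noteq> 0 \<Longrightarrow>
       \<xi> \<notin> near_level_set c m \<delta> lam \<or> norm \<xi> \<ge> K * cmod lam powr (1 / real m) \<Longrightarrow>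
       c1 * norm \<xi> powr (real m - 1 + \<delta>) \<le> cmod (op_symbol c m \<xi> - lam)"
proof (rule elliptic_lower_bound[OF assms(1,2)])
  fix K c1 :: real
  assume K: "K \<ge> 1" "c1 > 0"
    "\<And>lam (\<xi> :: real ^ 'n). cmod lam \<ge> 1 \<Longrightarrow> norm \<xi> \<ge> K * cmod lam powr (1 / real m) \<Longrightarrow>
       c1 * norm \<xi> ^ m \<le> cmod (op_symbol c m \<xi> - lam)"
  show thesis
  proof (rule that)
    show "K \<ge> 1" "min c1 1 > 0" using K by auto
    fix lam and \<xi> :: "real ^ 'n"
    assume lam: "cmod lam \<ge> 1" and \<xi>: "\<xi> \<in> lattice" "\<xi> \<noteq> 0"
      and "\<xi> \<notin> near_level_set c m \<delta> lam \<or> norm \<xi> \<ge> K * cmod lam powr (1 / real m)"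
    note this(4)
    moreover have p: "norm \<xi> powr (real m - 1 + \<delta>) \<le> norm \<xi> ^ m"
      using lattice_norm_ge_1[OF \<xi>] \<delta> powr_mono[of "real m - 1 + \<delta>" "real m" "norm \<xi>"] \<xi>(2)
      by (simp add: powr_realpow)
    moreover have "min c1 1 * norm \<xi> powr (real m - 1 + \<delta>) \<le> 1 * norm \<xi> powr (real m - 1 + \<delta>)"
      by (intro mult_right_mono) auto
    moreover have "min c1 1 * norm \<xi> powr (real m - 1 + \<delta>) \<le> c1 * norm \<xi> ^ m"
      using p K(2) by (intro mult_mono) auto
    ultimately show "min c1 1 * norm \<xi> powr (real m - 1 + \<delta>) \<le> cmod (op_symbol c m \<xi> - lam)"
      using K(3)[OF lam, of \<xi>] \<xi>(1) by (auto simp: near_level_set_def lattice_def)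
  qed
qed

section \<open>A convergent lattice sum\<close>

text \<open>
  At a lattice point other than 0 each \<open>1 + \<xi>\<^sub>i\<^sup>2\<close> is at most \<open>2 \<bar>\<xi>\<bar>\<^sup>2\<close>. Hence the sum is dominated by a
  product of one-dimensional sums of \<open>1 / (1 + k\<^sup>2)\<close>.
\<close>

lemma lattice_power_sum_bounded:
  "\<exists>Z\<ge>0. \<forall>F :: (real ^ 'n::finite) set. finite F \<longrightarrow> F \<subseteq> lattice - {0} \<longrightarrow>
     (\<Sum>\<xi>\<in>F. norm \<xi> powr (- 2 * real CARD('n))) \<le> Z"
proof -
  define h where "h k = 1 / (1 + (real_of_int k)\<^sup>2)" for k :: int
  have h0: "h k > 0" for k unfolding h_def by (simp add: add_pos_nonneg)
  have "h summable_on UNIV"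
  proof -
    have "summable (\<lambda>n. h (int n))"
    proof (rule summable_comparison_test'[where N=1])
      show "summable (\<lambda>n. inverse ((real n)\<^sup>2))" by (rule inverse_power_summable) simp
      show "norm (h (int n)) \<le> inverse ((real n)\<^sup>2)" if "n \<ge> 1" for n
        using that by (auto simp: h_def inverse_eq_divide intro!: divide_left_mono mult_pos_pos add_pos_nonneg)
    qed
    then have s: "(\<lambda>n. h (int n)) summable_on UNIV"
      using h0 by (intro summable_on_UNIV_nonneg_real_iff[THEN iffD2]) (auto intro: less_imp_le)
    have "h summable_on range int"
      using s by (subst summable_on_reindex) (auto simp: o_def)
    moreover have "h summable_on range (\<lambda>n. - int n)"
      using s by (subst summable_on_reindex) (auto simp: o_def h_def inj_def)
    ultimately have "h summable_on (range int \<union> range (\<lambda>n. - int n))"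
      by (rule summable_on_union)
    moreover have "range int \<union> range (\<lambda>n. - int n) = UNIV"
      by (auto intro: int_cases2)
    ultimately show ?thesis by simp
  qed
  then have hsum: "sum h B \<le> infsum h UNIV" if "finite B" for B
    using that h0 by (intro finite_sum_le_infsum) (auto intro: less_imp_le)
  have h00: "infsum h UNIV \<ge> 0"
    using h0 by (intro infsum_nonneg) (auto intro: less_imp_le)
  define Z where "Z = 2 ^ CARD('n) * infsum h UNIV ^ CARD('n)"
  have "(\<Sum>\<xi>\<in>F. norm \<xi> powr (- 2 * real CARD('n))) \<le> Z"
    if F: "finite F" "F \<subseteq> lattice - {0}" for F :: "(real ^ 'n) set"
  proof -
    define \<phi> where "\<phi> \<xi> = (\<lambda>i::'n. \<lfloor>\<xi> $ i\<rfloor>)" for \<xi> :: "real ^ 'n"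
    have \<phi>: "real_of_int (\<phi> \<xi> i) = \<xi> $ i" if "\<xi> \<in> F" for \<xi> i
    proof -
      have "\<xi> $ i \<in> \<int>" using that F(2) by (auto simp: lattice_def)
      then obtain n where "\<xi> $ i = of_int n" using Ints_cases by blast
      then show ?thesis by (simp add: \<phi>_def)
    qed
    have inj: "inj_on \<phi> F"
      by (rule inj_onI) (metis \<phi> vec_eq_iff)
    define B where "B = (\<Union>\<xi>\<in>F. range (\<phi> \<xi>))"
    have B: "finite B" unfolding B_def using F(1) by auto
    have "(\<Sum>\<xi>\<in>F. norm \<xi> powr (- 2 * real CARD('n))) \<le> (\<Sum>\<xi>\<in>F. 2 ^ CARD('n) * (\<Prod>i\<in>UNIV. h (\<phi> \<xi> i)))"
    proof (rule sum_mono)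
      fix \<xi> assume \<xi>: "\<xi> \<in> F"
      then have n1: "norm \<xi> \<ge> 1" using lattice_norm_ge_1 F(2) by blast
      have "(\<Prod>i\<in>(UNIV::'n set). 1 / (2 * (norm \<xi>)\<^sup>2)) \<le> (\<Prod>i\<in>UNIV. h (\<phi> \<xi> i))"
      proof (rule prod_mono)
        fix i
        have "(\<xi> $ i)\<^sup>2 \<le> (norm \<xi>)\<^sup>2"
          using component_le_norm_cart[of \<xi> i] by (simp add: abs_le_square_iff[symmetric])
        moreover have "1 \<le> (norm \<xi>)\<^sup>2" using n1 by simp
        ultimately have "1 + (\<xi> $ i)\<^sup>2 \<le> 2 * (norm \<xi>)\<^sup>2" by simp
        then show "0 \<le> 1 / (2 * (norm \<xi>)\<^sup>2) \<and> 1 / (2 * (norm \<xi>)\<^sup>2) \<le> h (\<phi> \<xi> i)"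
          using \<xi> n1 by (auto simp: h_def \<phi> intro!: divide_left_mono mult_pos_pos add_pos_nonneg)
      qed
      moreover have "norm \<xi> powr (- 2 * real CARD('n)) = 2 ^ CARD('n) * (\<Prod>i\<in>(UNIV::'n set). 1 / (2 * (norm \<xi>)\<^sup>2))"
      proof -
        have "norm \<xi> powr (- 2 * real CARD('n)) = inverse (norm \<xi> powr real (2 * CARD('n)))"
          by (simp add: powr_minus[symmetric])
        also have "\<dots> = inverse (norm \<xi> ^ (2 * CARD('n)))"
          using n1 by (subst powr_realpow) auto
        also have "\<dots> = inverse ((norm \<xi>)\<^sup>2) ^ CARD('n)"
          by (simp only: power_mult power_inverse)
        also have "inverse ((norm \<xi>)\<^sup>2) = 2 * (1 / (2 * (norm \<xi>)\<^sup>2))"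
          by (simp add: inverse_eq_divide)
        finally show ?thesis
          by (simp only: prod_constant power_mult_distrib)
      qed
      ultimately show "norm \<xi> powr (- 2 * real CARD('n)) \<le> 2 ^ CARD('n) * (\<Prod>i\<in>UNIV. h (\<phi> \<xi> i))"
        by simp
    qed
    also have "\<dots> = 2 ^ CARD('n) * (\<Sum>p\<in>\<phi> ` F. \<Prod>i\<in>UNIV. h (p i))"
      by (simp add: sum.reindex[OF inj] sum_distrib_left)
    also have "\<dots> \<le> 2 ^ CARD('n) * (\<Sum>p\<in>PiE (UNIV::'n set) (\<lambda>_. B). \<Prod>i\<in>UNIV. h (p i))"
    proof (rule mult_left_mono)
      have "finite (PiE (UNIV::'n set) (\<lambda>_. B))" using B by (intro finite_PiE) auto
      moreover have "\<phi> ` F \<subseteq> PiE (UNIV::'n set) (\<lambda>_. B)" by (auto simp: B_def)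
      ultimately show "(\<Sum>p\<in>\<phi> ` F. \<Prod>i\<in>UNIV. h (p i)) \<le> (\<Sum>p\<in>PiE (UNIV::'n set) (\<lambda>_. B). \<Prod>i\<in>UNIV. h (p i))"
        by (rule sum_mono2) (auto intro!: prod_nonneg less_imp_le[OF h0])
    qed simp
    also have "\<dots> = 2 ^ CARD('n) * (\<Prod>i\<in>(UNIV::'n set). \<Sum>k\<in>B. h k)"
      using B by (subst prod_sum_PiE) auto
    also have "\<dots> = 2 ^ CARD('n) * (\<Sum>k\<in>B. h k) ^ CARD('n)" by simp
    also have "\<dots> \<le> Z"
      unfolding Z_def using hsum[OF B] by (intro mult_left_mono power_mono sum_nonneg) (auto intro: less_imp_le[OF h0])
    finally show ?thesis .
  qed
  moreover have "Z \<ge> 0" using h00 by (simp add: Z_def)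
  ultimately show ?thesis by blast
qed

section \<open>Decay of the Fourier coefficients of a solution\<close>

text \<open>
  A single list of first order factors makes the results on \<open>foldr D1\<close>, proved by induction on
  lists, applicable to \<open>D\<close>.
\<close>

definition mi_list :: "'n::{finite,linorder} multi_index \<Rightarrow> 'n list"
  where "mi_list \<alpha> = concat (map (\<lambda>i. replicate (\<alpha> i) i) (sorted_list_of_set UNIV))"

lemma D_eq_foldr_D1:
  fixes f :: "real ^ 'n::{finite,linorder} \<Rightarrow> complex"
  shows "D \<alpha> f = foldr D1 (mi_list \<alpha>) f"
proof -
  have rep: "foldr D1 (replicate n i) g = (D1 i ^^ n) g" for n i and g :: "real ^ 'n::_ \<Rightarrow> complex"
    by (induction n) auto
  have "foldr (\<lambda>i. D1 i ^^ \<alpha> i) js f = foldr D1 (concat (map (\<lambda>i. replicate (\<alpha> i) i) js)) f" for js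
    by (induction js) (auto simp: rep)
  then show ?thesis unfolding D_def mi_list_def .
qed

lemma length_mi_list: "length (mi_list \<alpha>) = mi_order \<alpha>"
proof -
  have "length (mi_list \<alpha>) = (\<Sum>i\<leftarrow>sorted_list_of_set UNIV. \<alpha> i)"
    by (simp add: mi_list_def length_concat o_def)
  also have "\<dots> = mi_order \<alpha>"
    unfolding mi_order_def by (subst sum_list_distinct_conv_sum_set) auto
  finally show ?thesis .
qed

lemma prod_list_mi_list: "(\<Prod>i\<leftarrow>mi_list \<alpha>. of_real (\<xi> $ i)) = monom_at \<alpha> \<xi>"
proof -
  have "(\<Prod>i\<leftarrow>concat (map (\<lambda>i. replicate (\<alpha> i) i) js). complex_of_real (\<xi> $ i)) = (\<Prod>i\<leftarrow>js. of_real (\<xi> $ i) ^ \<alpha> i)" for js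
    by (induction js) auto
  then have "(\<Prod>i\<leftarrow>mi_list \<alpha>. of_real (\<xi> $ i)) = (\<Prod>i\<leftarrow>sorted_list_of_set UNIV. complex_of_real (\<xi> $ i) ^ \<alpha> i)"
    by (simp add: mi_list_def)
  also have "\<dots> = monom_at \<alpha> \<xi>"
    unfolding monom_at_def by (subst prod.distinct_set_conv_list[symmetric]) auto
  finally show ?thesis .
qed

lemma foldr_D1_cong:
  assumes "open S" "x \<in> S" "\<And>y. y \<in> S \<Longrightarrow> f y = g y"
  shows "foldr D1 js f x = foldr D1 js g x"
  using assms(2)
proof (induction js arbitrary: x)
  case (Cons i js)
  have "partial i (foldr D1 js f) x = partial i (foldr D1 js g) x"
    by (rule partial_cong[OF assms(1) Cons.prems Cons.IH])
  then show ?case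
    by (simp add: D1_def[of i "foldr D1 js f"] D1_def[of i "foldr D1 js g"])
qed (use assms in auto)

definition solution_on ::
    "('n::{finite,linorder} multi_index \<Rightarrow> complex) \<Rightarrow> nat \<Rightarrow> (real ^ 'n::_ \<Rightarrow> complex) \<Rightarrow> (real ^ 'n::_) set
      \<Rightarrow> complex \<Rightarrow> (real ^ 'n::_ \<Rightarrow> complex) \<Rightarrow> bool"
  where "solution_on c m V \<Omega> lam \<psi> \<longleftrightarrow>
    smooth_on \<Omega> \<psi> \<and> (\<forall>y\<in>\<Omega>. diff_op c m \<psi> y + V y * \<psi> y = lam * \<psi> y)"

text \<open>
  The equation multiplied by \<open>a\<close>: up to commutators the operator acts on the coefficient as
  multiplication by its symbol, and \<open>a V\<close> is one more test function.
\<close>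

lemma fcoeff_equation_bound:
  fixes c :: "'n::{finite,linorder} multi_index \<Rightarrow> complex"
  assumes m: "m \<ge> 1" and \<Omega>: "open \<Omega>" and V: "smooth_on \<Omega> V" and K: "compact K" "K \<subseteq> \<Omega>"
    and a: "test_fun K a"
  shows "\<exists>A C. 0 \<le> C \<and> (\<forall>b\<in>set A. test_fun K b) \<and>
    (\<forall>lam \<psi> \<xi>. solution_on c m V \<Omega> lam \<psi> \<longrightarrow>
      cmod (op_symbol c m \<xi> - lam) * cmod (fcoeff (\<lambda>y. a y * \<psi> y) \<xi>) * (1 + norm \<xi>)
        \<le> C * (1 + norm \<xi>) ^ m * (\<Sum>b\<leftarrow>A. cmod (fcoeff (\<lambda>y. b y * \<psi> y) \<xi>)))"
proof -
  let ?I = "{\<alpha> :: 'n multi_index. mi_order \<alpha> \<le> m}"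
  have Kc: "closed K" using K compact_imp_closed by blast
  have "\<forall>\<alpha> :: 'n multi_index. \<exists>A. (\<forall>b\<in>set A. test_fun K b) \<and>
    (\<forall>u \<xi>. smooth_on \<Omega> u \<longrightarrow>
      cmod (fcoeff (\<lambda>y. a y * D \<alpha> u y) \<xi> - monom_at \<alpha> \<xi> * fcoeff (\<lambda>y. a y * u y) \<xi>) * (1 + norm \<xi>)
        \<le> (1 + norm \<xi>) ^ mi_order \<alpha> * (\<Sum>b\<leftarrow>A. cmod (fcoeff (\<lambda>y. b y * u y) \<xi>)))"
    using fcoeff_commutator[OF \<Omega> K a] unfolding D_eq_foldr_D1 prod_list_mi_list[symmetric] length_mi_list[symmetric]
    by blast
  from choice[OF this] obtain AA where AA: "\<And>\<alpha> b. b \<in> set (AA \<alpha>) \<Longrightarrow> test_fun K b"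
    "\<And>\<alpha> u \<xi>. smooth_on \<Omega> u \<Longrightarrow>
      cmod (fcoeff (\<lambda>y. a y * D \<alpha> u y) \<xi> - monom_at \<alpha> \<xi> * fcoeff (\<lambda>y. a y * u y) \<xi>) * (1 + norm \<xi>)
        \<le> (1 + norm \<xi>) ^ mi_order \<alpha> * (\<Sum>b\<leftarrow>AA \<alpha>. cmod (fcoeff (\<lambda>y. b y * u y) \<xi>))"
    by blast
  obtain \<alpha>s where \<alpha>s: "set \<alpha>s = ?I" "distinct \<alpha>s"
    using finite_distinct_list[OF finite_mi_order_le] by blast
  define A where "A = (\<lambda>y. a y * V y) # concat (map AA \<alpha>s)"
  define C where "C = 1 + (\<Sum>\<alpha>\<in>?I. cmod (c \<alpha>))"
  have taV: "test_fun K (\<lambda>y. a y * V y)"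
    using test_fun_mult[OF \<Omega> Kc K(2) a V] .
  have "cmod (op_symbol c m \<xi> - lam) * cmod (fcoeff (\<lambda>y. a y * \<psi> y) \<xi>) * (1 + norm \<xi>)
        \<le> C * (1 + norm \<xi>) ^ m * (\<Sum>b\<leftarrow>A. cmod (fcoeff (\<lambda>y. b y * \<psi> y) \<xi>))"
    if sol: "solution_on c m V \<Omega> lam \<psi>" for lam \<psi> \<xi>
  proof -
    have \<psi>: "smooth_on \<Omega> \<psi>" and eq: "\<And>y. y \<in> \<Omega> \<Longrightarrow> diff_op c m \<psi> y + V y * \<psi> y = lam * \<psi> y"
      using sol by (auto simp: solution_on_def)
    define f where "f = fcoeff (\<lambda>y. a y * \<psi> y) \<xi>"
    define v where "v = fcoeff (\<lambda>y. a y * V y * \<psi> y) \<xi>"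
    define R where "R \<alpha> = fcoeff (\<lambda>y. a y * D \<alpha> \<psi> y) \<xi>" for \<alpha>
    define S where "S \<alpha> = (\<Sum>b\<leftarrow>AA \<alpha>. cmod (fcoeff (\<lambda>y. b y * \<psi> y) \<xi>))" for \<alpha>
    define N where "N = 1 + norm \<xi>"
    have N: "N \<ge> 1" by (simp add: N_def)
    have S0: "S \<alpha> \<ge> 0" for \<alpha> by (auto simp: S_def intro!: sum_list_nonneg)
    have iR: "integrable lborel (\<lambda>y. (a y * D \<alpha> \<psi> y) * cis (- (\<xi> \<bullet> y)))" for \<alpha>
      unfolding D_eq_foldr_D1
      by (intro test_fun_fcoeff_integrable[OF K(1)] test_fun_mult[OF \<Omega> Kc K(2) a] smooth_on_foldr_D1 \<Omega> \<psi>)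
    have if': "integrable lborel (\<lambda>y. (a y * \<psi> y) * cis (- (\<xi> \<bullet> y)))"
      by (intro test_fun_fcoeff_integrable[OF K(1)] test_fun_mult[OF \<Omega> Kc K(2) a] \<psi>)
    have iv: "integrable lborel (\<lambda>y. (a y * V y * \<psi> y) * cis (- (\<xi> \<bullet> y)))"
      by (intro test_fun_fcoeff_integrable[OF K(1)] test_fun_mult[OF \<Omega> Kc K(2) taV] \<psi>)
    have pt: "(\<Sum>\<alpha>\<in>?I. c \<alpha> * (a y * D \<alpha> \<psi> y)) = lam * (a y * \<psi> y) - a y * V y * \<psi> y" for y
    proof (cases "y \<in> K")
      case True
      then have E1: "diff_op c m \<psi> y = lam * \<psi> y - V y * \<psi> y"
        using eq[of y] K(2) by (simp add: eq_diff_eq subset_iff)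
      have E2: "(\<Sum>\<alpha>\<in>?I. c \<alpha> * (a y * D \<alpha> \<psi> y)) = a y * diff_op c m \<psi> y"
        by (simp add: diff_op_def sum_distrib_left mult_ac)
      show ?thesis unfolding E2 E1 by (simp add: algebra_simps)
    next
      case False
      then show ?thesis using a by (simp add: test_fun_def)
    qed
    have "(\<Sum>\<alpha>\<in>?I. c \<alpha> * R \<alpha>) = (\<integral>y. (\<Sum>\<alpha>\<in>?I. c \<alpha> * ((a y * D \<alpha> \<psi> y) * cis (- (\<xi> \<bullet> y)))) \<partial>lborel)"
      unfolding R_def fcoeff_def
      by (simp only: Bochner_Integration.integral_sum integrable_mult_right iR integral_mult_right_zero)
    also have "\<dots> = (\<integral>y. lam * ((a y * \<psi> y) * cis (- (\<xi> \<bullet> y))) - (a y * V y * \<psi> y) * cis (- (\<xi> \<bullet> y)) \<partial>lborel)"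
    proof (intro Bochner_Integration.integral_cong refl)
      fix y
      have "(\<Sum>\<alpha>\<in>?I. c \<alpha> * ((a y * D \<alpha> \<psi> y) * cis (- (\<xi> \<bullet> y)))) = (\<Sum>\<alpha>\<in>?I. c \<alpha> * (a y * D \<alpha> \<psi> y)) * cis (- (\<xi> \<bullet> y))"
        by (simp only: sum_distrib_right mult.assoc)
      then show "(\<Sum>\<alpha>\<in>?I. c \<alpha> * ((a y * D \<alpha> \<psi> y) * cis (- (\<xi> \<bullet> y)))) = lam * ((a y * \<psi> y) * cis (- (\<xi> \<bullet> y))) - (a y * V y * \<psi> y) * cis (- (\<xi> \<bullet> y))"
        unfolding pt by (simp only: left_diff_distrib mult.assoc)
    qed
    also have "\<dots> = lam * f - v"
      unfolding f_def v_def fcoeff_def using if' iv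
      by (subst Bochner_Integration.integral_diff) (auto simp only: integrable_mult_right integral_mult_right_zero)
    finally have R: "(\<Sum>\<alpha>\<in>?I. c \<alpha> * R \<alpha>) = lam * f - v" .
    have "(op_symbol c m \<xi> - lam) * f = (\<Sum>\<alpha>\<in>?I. c \<alpha> * (monom_at \<alpha> \<xi> * f)) - (lam * f - v) - v"
      by (simp add: op_symbol_monom_at sum_distrib_right left_diff_distrib mult.assoc)
    also have "\<dots> = (\<Sum>\<alpha>\<in>?I. c \<alpha> * (monom_at \<alpha> \<xi> * f - R \<alpha>)) - v"
      unfolding R[symmetric] by (simp only: sum_subtractf[symmetric] right_diff_distrib)
    finally have id: "(op_symbol c m \<xi> - lam) * f = (\<Sum>\<alpha>\<in>?I. c \<alpha> * (monom_at \<alpha> \<xi> * f - R \<alpha>)) - v" .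
    have "cmod (op_symbol c m \<xi> - lam) * cmod f = cmod ((op_symbol c m \<xi> - lam) * f)"
      by (simp add: norm_mult)
    also have "\<dots> \<le> cmod (\<Sum>\<alpha>\<in>?I. c \<alpha> * (monom_at \<alpha> \<xi> * f - R \<alpha>)) + cmod v"
      unfolding id by (rule norm_triangle_ineq4)
    also have "\<dots> \<le> (\<Sum>\<alpha>\<in>?I. cmod (c \<alpha>) * cmod (R \<alpha> - monom_at \<alpha> \<xi> * f)) + cmod v"
      by (intro add_right_mono sum_norm_le) (simp add: norm_mult norm_minus_commute)
    finally have "cmod (op_symbol c m \<xi> - lam) * cmod f * N \<le>
        ((\<Sum>\<alpha>\<in>?I. cmod (c \<alpha>) * cmod (R \<alpha> - monom_at \<alpha> \<xi> * f)) + cmod v) * N"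
      using N by (intro mult_right_mono) auto
    also have "\<dots> = (\<Sum>\<alpha>\<in>?I. cmod (c \<alpha>) * (cmod (R \<alpha> - monom_at \<alpha> \<xi> * f) * N)) + N * cmod v"
      by (simp only: distrib_right sum_distrib_right mult.assoc mult.commute[of N "cmod v"])
    also have "\<dots> \<le> (\<Sum>\<alpha>\<in>?I. C * (N ^ m * S \<alpha>)) + C * (N ^ m * cmod v)"
    proof (intro add_mono sum_mono)
      have C1: "C \<ge> 1" by (simp add: C_def sum_nonneg)
      fix \<alpha> assume \<alpha>: "\<alpha> \<in> ?I"
      have cC: "cmod (c \<alpha>) \<le> C"
      proof -
        have "cmod (c \<alpha>) \<le> (\<Sum>\<alpha>\<in>?I. cmod (c \<alpha>))"
          by (rule member_le_sum[OF \<alpha>]) (auto simp: finite_mi_order_le)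
        then show ?thesis unfolding C_def by linarith
      qed
      have "cmod (R \<alpha> - monom_at \<alpha> \<xi> * f) * N \<le> N ^ mi_order \<alpha> * S \<alpha>"
        using AA(2)[OF \<psi>] by (simp add: R_def f_def N_def S_def)
      also have "\<dots> \<le> N ^ m * S \<alpha>"
        using N \<alpha> S0 by (intro mult_right_mono power_increasing) auto
      finally show "cmod (c \<alpha>) * (cmod (R \<alpha> - monom_at \<alpha> \<xi> * f) * N) \<le> C * (N ^ m * S \<alpha>)"
        using C1 N by (intro mult_mono[OF cC]) auto
    next
      have C1: "C \<ge> 1" by (simp add: C_def sum_nonneg)
      have "N \<le> N ^ m" using N m power_increasing[of 1 m N] by simp
      also have "\<dots> \<le> C * N ^ m" using C1 N mult_right_mono[of 1 C "N ^ m"] by simp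
      finally show "N * cmod v \<le> C * (N ^ m * cmod v)"
        by (simp add: mult_right_mono flip: mult.assoc)
    qed
    also have "\<dots> = C * N ^ m * ((\<Sum>\<alpha>\<in>?I. S \<alpha>) + cmod v)"
      by (simp add: sum_distrib_left distrib_left mult.assoc)
    also have "(\<Sum>\<alpha>\<in>?I. S \<alpha>) + cmod v = (\<Sum>b\<leftarrow>A. cmod (fcoeff (\<lambda>y. b y * \<psi> y) \<xi>))"
    proof -
      have "(\<Sum>b\<leftarrow>concat (map AA \<beta>s). cmod (fcoeff (\<lambda>y. b y * \<psi> y) \<xi>)) = (\<Sum>\<alpha>\<leftarrow>\<beta>s. S \<alpha>)" for \<beta>s
        by (induction \<beta>s) (auto simp: S_def)
      moreover have "(\<Sum>\<alpha>\<leftarrow>\<alpha>s. S \<alpha>) = (\<Sum>\<alpha>\<in>?I. S \<alpha>)"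
        using \<alpha>s by (metis sum_list_distinct_conv_sum_set)
      ultimately show ?thesis by (simp add: A_def v_def)
    qed
    finally show ?thesis unfolding f_def N_def .
  qed
  moreover have "\<forall>b\<in>set A. test_fun K b" using AA(1) taV by (auto simp: A_def)
  moreover have "0 \<le> C" by (simp add: C_def sum_nonneg add_nonneg_nonneg)
  ultimately show ?thesis by blast
qed

lemma fcoeff_le_L2_over:
  assumes K: "compact K" and a: "test_fun K a" and u: "continuous_on K u"
  shows "cmod (fcoeff (\<lambda>y. a y * u y) \<xi>) \<le> L2_over K a * L2_over K u"
proof -
  have ac: "continuous_on K a" by (rule test_fun_continuous[OF a])
  have "cmod (fcoeff (\<lambda>y. a y * u y) \<xi>) \<le> L2_over K u * L2_over K (\<lambda>y. a y * cis (- (\<xi> \<bullet> y)))"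
    unfolding fcoeff_eq_integral_over[OF a]
    by (intro Cauchy_Schwarz_compact K u continuous_intros ac)
  also have "L2_over K (\<lambda>y. a y * cis (- (\<xi> \<bullet> y))) = L2_over K a"
    by (simp add: L2_over_def norm_mult)
  finally show ?thesis by (simp add: mult.commute)
qed

text \<open>
  Each use of the equation trades the coefficient of \<open>a \<psi>\<close> for a factor \<open>\<bar>\<xi>\<bar>\<^bsup>-\<delta>\<^esup>\<close> and coefficients of
  other \<open>b \<psi>\<close> at the same frequency, to which the induction hypothesis applies.
\<close>

lemma fcoeff_decay:
  fixes c :: "'n::{finite,linorder} multi_index \<Rightarrow> complex"
  assumes m: "m \<ge> 1" and \<Omega>: "open \<Omega>" and V: "smooth_on \<Omega> V" and K: "compact K" "K \<subseteq> \<Omega>"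
    and c1: "c1 > 0" and a: "test_fun K a"
  shows "\<exists>C\<ge>0. \<forall>lam \<psi> \<xi>. solution_on c m V \<Omega> lam \<psi> \<longrightarrow> norm \<xi> \<ge> 1 \<longrightarrow>
      c1 * norm \<xi> powr (real m - 1 + \<delta>) \<le> cmod (op_symbol c m \<xi> - lam) \<longrightarrow>
      cmod (fcoeff (\<lambda>y. a y * \<psi> y) \<xi>) \<le> C * norm \<xi> powr (- (real k * \<delta>)) * L2_over K \<psi>"
  using a
proof (induction k arbitrary: a)
  case 0
  show ?case
  proof (intro exI[of _ "L2_over K a"] conjI allI impI L2_over_nonneg)
    fix lam \<psi> and \<xi> :: "real ^ 'n::_" assume "solution_on c m V \<Omega> lam \<psi>" "1 \<le> norm \<xi>"
    then show "cmod (fcoeff (\<lambda>y. a y * \<psi> y) \<xi>) \<le> L2_over K a * norm \<xi> powr (- (real 0 * \<delta>)) * L2_over K \<psi>"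
      using fcoeff_le_L2_over[OF K(1) 0, of \<psi> \<xi>] continuous_on_subset[OF smooth_on_continuous K(2)]
      by (auto simp: solution_on_def)
  qed
next
  case (Suc k)
  obtain A C where A: "0 \<le> C" "\<And>b. b \<in> set A \<Longrightarrow> test_fun K b"
    "\<And>lam \<psi> \<xi>. solution_on c m V \<Omega> lam \<psi> \<Longrightarrow>
      cmod (op_symbol c m \<xi> - lam) * cmod (fcoeff (\<lambda>y. a y * \<psi> y) \<xi>) * (1 + norm \<xi>)
        \<le> C * (1 + norm \<xi>) ^ m * (\<Sum>b\<leftarrow>A. cmod (fcoeff (\<lambda>y. b y * \<psi> y) \<xi>))"
    using fcoeff_equation_bound[OF m \<Omega> V K Suc.prems] by blast
  have "\<forall>b\<in>set A. \<exists>C. 0 \<le> C \<and> (\<forall>lam \<psi> \<xi>. solution_on c m V \<Omega> lam \<psi> \<longrightarrow> norm \<xi> \<ge> 1 \<longrightarrow>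
      c1 * norm \<xi> powr (real m - 1 + \<delta>) \<le> cmod (op_symbol c m \<xi> - lam) \<longrightarrow>
      cmod (fcoeff (\<lambda>y. b y * \<psi> y) \<xi>) \<le> C * norm \<xi> powr (- (real k * \<delta>)) * L2_over K \<psi>)"
    using Suc.IH A(2) by blast
  from bchoice[OF this] obtain Cb where Cb: "\<And>b. b \<in> set A \<Longrightarrow> 0 \<le> Cb b"
    "\<And>b lam \<psi> \<xi>. b \<in> set A \<Longrightarrow> solution_on c m V \<Omega> lam \<psi> \<Longrightarrow> norm \<xi> \<ge> 1 \<Longrightarrow>
      c1 * norm \<xi> powr (real m - 1 + \<delta>) \<le> cmod (op_symbol c m \<xi> - lam) \<Longrightarrow>
      cmod (fcoeff (\<lambda>y. b y * \<psi> y) \<xi>) \<le> Cb b * norm \<xi> powr (- (real k * \<delta>)) * L2_over K \<psi>"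
    by blast
  define CA where "CA = (\<Sum>b\<leftarrow>A. Cb b)"
  have CA: "CA \<ge> 0" unfolding CA_def using Cb(1) by (auto intro!: sum_list_nonneg)
  show ?case
  proof (intro exI[of _ "C * 2 ^ (m - 1) / c1 * CA"] conjI allI impI)
    show "0 \<le> C * 2 ^ (m - 1) / c1 * CA" using A(1) c1 CA by simp
    fix lam \<psi> and \<xi> :: "real ^ 'n::_"
    assume sol: "solution_on c m V \<Omega> lam \<psi>" and n1: "1 \<le> norm \<xi>"
      and low: "c1 * norm \<xi> powr (real m - 1 + \<delta>) \<le> cmod (op_symbol c m \<xi> - lam)"
    define t where "t = norm \<xi>"
    have t: "t \<ge> 1" using n1 by (simp add: t_def)
    define f where "f = cmod (fcoeff (\<lambda>y. a y * \<psi> y) \<xi>)"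
    define M where "M = L2_over K \<psi>"
    have M: "M \<ge> 0" by (simp add: M_def L2_over_nonneg)
    have sum: "(\<Sum>b\<leftarrow>A. cmod (fcoeff (\<lambda>y. b y * \<psi> y) \<xi>)) \<le> CA * t powr (- (real k * \<delta>)) * M"
    proof -
      have "(\<Sum>b\<leftarrow>A. cmod (fcoeff (\<lambda>y. b y * \<psi> y) \<xi>)) \<le> (\<Sum>b\<leftarrow>A. Cb b * (t powr (- (real k * \<delta>)) * M))"
        using Cb(2)[OF _ sol n1 low] by (intro sum_list_mono) (simp add: t_def M_def mult.assoc)
      then show ?thesis by (simp add: CA_def sum_list_mult_const mult.assoc)
    qed
    have "c1 * t powr (real m - 1 + \<delta>) * f * (1 + t) \<le> cmod (op_symbol c m \<xi> - lam) * f * (1 + t)"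
      using low t by (intro mult_right_mono) (auto simp: t_def f_def)
    also have "\<dots> \<le> C * (1 + t) ^ m * (CA * t powr (- (real k * \<delta>)) * M)"
      using A(3)[OF sol, of \<xi>] sum A(1) t unfolding f_def t_def
      by (meson mult_left_mono mult_nonneg_nonneg order_trans zero_le_power add_nonneg_nonneg norm_ge_zero zero_le_one)
    also have "(1 + t) ^ m = (1 + t) ^ (m - 1) * (1 + t)"
      using m by (cases m) auto
    finally have "(c1 * t powr (real m - 1 + \<delta>) * f) * (1 + t) \<le> (C * (1 + t) ^ (m - 1) * (CA * t powr (- (real k * \<delta>)) * M)) * (1 + t)"
      by (simp add: mult_ac)
    then have "c1 * t powr (real m - 1 + \<delta>) * f \<le> C * (1 + t) ^ (m - 1) * (CA * t powr (- (real k * \<delta>)) * M)"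
      using t by (simp add: mult_le_cancel_right)
    also have "\<dots> \<le> C * (2 * t) ^ (m - 1) * (CA * t powr (- (real k * \<delta>)) * M)"
      using A(1) t CA M by (intro mult_right_mono mult_left_mono power_mono mult_nonneg_nonneg) auto
    also have "(2 * t) ^ (m - 1) = 2 ^ (m - 1) * t powr (real m - 1)"
      using t m by (simp add: power_mult_distrib powr_realpow[symmetric] of_nat_diff)
    finally have "t powr (real m - 1 + \<delta>) * f * c1 \<le> t powr (real m - 1) * (C * 2 ^ (m - 1) * CA * t powr (- (real k * \<delta>)) * M)"
      by (simp add: mult_ac)
    then have "t powr (real m - 1) * (t powr \<delta> * f) \<le> t powr (real m - 1) * (C * 2 ^ (m - 1) / c1 * CA * t powr (- (real k * \<delta>)) * M)"
      using c1 unfolding powr_add by (simp add: field_simps)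
    then have "t powr \<delta> * f \<le> C * 2 ^ (m - 1) / c1 * CA * t powr (- (real k * \<delta>)) * M"
      by (rule mult_left_le_imp_le) (use t in simp)
    then have "t powr (- \<delta>) * (t powr \<delta> * f) \<le> t powr (- \<delta>) * (C * 2 ^ (m - 1) / c1 * CA * t powr (- (real k * \<delta>)) * M)"
      by (intro mult_left_mono) auto
    moreover have "t powr (- \<delta>) * (t powr \<delta> * f) = f"
      using t by (simp add: mult.assoc[symmetric] powr_add[symmetric])
    ultimately have "f \<le> t powr (- \<delta>) * (C * 2 ^ (m - 1) / c1 * CA * t powr (- (real k * \<delta>)) * M)"
      by simp
    also have "\<dots> = C * 2 ^ (m - 1) / c1 * CA * (t powr (- \<delta>) * t powr (- (real k * \<delta>))) * M"
      by (simp only: mult_ac)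
    also have "t powr (- \<delta>) * t powr (- (real k * \<delta>)) = t powr (- (real (Suc k) * \<delta>))"
      by (simp add: powr_add[symmetric] algebra_simps)
    finally show "cmod (fcoeff (\<lambda>y. a y * \<psi> y) \<xi>) \<le> C * 2 ^ (m - 1) / c1 * CA * norm \<xi> powr (- (real (Suc k) * \<delta>)) * L2_over K \<psi>"
      unfolding f_def t_def M_def .
  qed
qed

section \<open>Pointwise bounds for derivatives\<close>

lemma derivative_le_sum_fcoeff:
  fixes x0 :: "real ^ 'n::{finite,linorder}"
  assumes \<Omega>: "open \<Omega>" and \<rho>: "\<rho> \<le> 1" and K: "cball x0 \<rho> \<subseteq> \<Omega>"
    and a: "test_fun (cball x0 \<rho>) a" "\<And>y. y \<in> ball x0 (\<rho>/2) \<Longrightarrow> a y = 1"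
    and \<psi>: "smooth_on \<Omega> \<psi>" and x: "x \<in> ball x0 (\<rho>/2)"
    and S: "\<And>F. finite F \<Longrightarrow> F \<subseteq> lattice \<Longrightarrow>
      (\<Sum>\<xi>\<in>F. cmod (monom_at \<gamma> \<xi>) * cmod (fcoeff (\<lambda>y. a y * \<psi> y) \<xi>)) \<le> S"
  shows "period_volume TYPE('n) * cmod (D \<gamma> \<psi> x) \<le> S"
proof -
  define g where "g = foldr D1 (mi_list \<gamma>) (\<lambda>y. a y * \<psi> y)"
  have "0 \<le> dist x0 x" "dist x0 x < \<rho> / 2" using x by auto
  then have "dist x0 x \<le> \<rho>" by linarith
  then have x1: "x \<in> cball x0 \<rho>" by simp
  have t: "test_fun (cball x0 \<rho>) (\<lambda>y. a y * \<psi> y)"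
    using test_fun_mult[OF \<Omega> closed_cball K a(1) \<psi>] .
  have tg: "test_fun (cball x0 \<rho>) g" and fg: "fcoeff g \<xi> = monom_at \<gamma> \<xi> * fcoeff (\<lambda>y. a y * \<psi> y) \<xi>" for \<xi>
    using fcoeff_foldr_D1[OF compact_cball t, of "mi_list \<gamma>" \<xi>] unfolding g_def prod_list_mi_list by auto
  have "period_volume TYPE('n) * cmod (g x) \<le> S"
  proof (rule pointwise_le_sum_fcoeff[OF compact_cball[of x0 \<rho>]])
    have "x \<in> cball x0 1" using x1 \<rho> by auto
    from cball_subset_period_box[OF this] show "cball x0 \<rho> \<subseteq> period_box x"
      using \<rho> subset_cball by blast
    show "continuous_on UNIV g" by (rule test_fun_continuous[OF tg])
    show "g y = 0" if "y \<notin> cball x0 \<rho>" for y using tg that by (simp add: test_fun_def)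
    show "(\<Sum>\<xi>\<in>F. cmod (fcoeff g \<xi>)) \<le> S" if "finite F" "F \<subseteq> lattice" for F
      using S[OF that] by (simp add: fg norm_mult)
  qed
  moreover have "g x = D \<gamma> \<psi> x"
    unfolding g_def D_eq_foldr_D1 by (rule foldr_D1_cong[OF open_ball x]) (simp add: a(2))
  ultimately show ?thesis by simp
qed

lemma test_bump_exists:
  fixes x0 :: "real ^ 'n::finite"
  assumes "\<rho> > 0"
  obtains a where "test_fun (cball x0 \<rho>) a" "\<And>y. y \<in> ball x0 (\<rho>/2) \<Longrightarrow> a y = 1"
  using smooth_bump_exists[OF assms, of x0] unfolding test_fun_def by metis

text \<open>
  The qualitative statement used when the near level set is infinite.
\<close>

lemma derivative_eq_0:
  fixes x0 :: "real ^ 'n::{finite,linorder}"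
  assumes \<Omega>: "open \<Omega>" and \<rho>: "0 < \<rho>" "\<rho> \<le> 1" and K: "cball x0 \<rho> \<subseteq> \<Omega>"
    and \<psi>: "smooth_on \<Omega> \<psi>" and x: "x \<in> ball x0 (\<rho>/2)" and 0: "L2_over (cball x0 \<rho>) \<psi> = 0"
  shows "D \<gamma> \<psi> x = 0"
proof -
  obtain a where a: "test_fun (cball x0 \<rho>) a" "\<And>y. y \<in> ball x0 (\<rho>/2) \<Longrightarrow> a y = 1"
    using test_bump_exists[OF \<rho>(1), of x0] by metis
  have "fcoeff (\<lambda>y. a y * \<psi> y) \<xi> = 0" for \<xi>
    using fcoeff_le_L2_over[OF compact_cball a(1) continuous_on_subset[OF smooth_on_continuous[OF \<psi>] K], of \<xi>] 0
    by simp
  then have "period_volume TYPE('n) * cmod (D \<gamma> \<psi> x) \<le> 0"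
    by (intro derivative_le_sum_fcoeff[OF \<Omega> \<rho>(2) K a \<psi> x]) auto
  then show ?thesis
    using period_volume_pos[where 'n='n] by (simp add: mult_le_0_iff)
qed

text \<open>
  The frequencies are split into 0, the bad ones (near, and smaller than \<open>Q \<bar>\<lambda>\<bar>\<^bsup>1/m\<^esup>\<close>) and the rest.
  The frequency 0 is separate because powers of \<open>\<bar>\<xi>\<bar>\<close> are useless there.
\<close>

lemma local_derivative_bound:
  fixes c :: "'n::{finite,linorder} multi_index \<Rightarrow> complex"
  assumes m: "m \<ge> 1" and \<Omega>: "open \<Omega>" and V: "smooth_on \<Omega> V"
    and \<rho>: "0 < \<rho>" "\<rho> \<le> 1" and K: "cball x0 \<rho> \<subseteq> \<Omega>"
    and ell: "elliptic c m" and \<delta>: "0 < \<delta>" "\<delta> \<le> 1"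
  shows "\<exists>C>0. \<forall>lam \<psi> x. cmod lam \<ge> 1 \<longrightarrow> solution_on c m V \<Omega> lam \<psi> \<longrightarrow> x \<in> ball x0 (\<rho>/2) \<longrightarrow>
     finite (near_level_set c m \<delta> lam) \<longrightarrow>
     cmod (D \<gamma> \<psi> x) \<le> C * cmod lam powr (real (mi_order \<gamma>) / real m) *
       (1 + sqrt (card (near_level_set c m \<delta> lam))) * L2_over (cball x0 \<rho>) \<psi>"
proof -
  let ?K = "cball x0 \<rho>"
  let ?V = "period_volume TYPE('n)"
  let ?g = "mi_order \<gamma>"
  have V0: "?V > 0" by (rule period_volume_pos)
  obtain a where a: "test_fun ?K a" "\<And>y. y \<in> ball x0 (\<rho>/2) \<Longrightarrow> a y = 1"
    using test_bump_exists[OF \<rho>(1), of x0] by metis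
  obtain B where B: "B > 0" "\<And>y. cmod (a y) \<le> B"
  proof -
    have "bounded (a ` ?K)"
      by (intro compact_imp_bounded compact_continuous_image test_fun_continuous[OF a(1)] compact_cball)
    then obtain B where "B > 0" "\<And>y. y \<in> ?K \<Longrightarrow> cmod (a y) \<le> B"
      unfolding bounded_pos by auto
    then show thesis
      using that[of B] a(1) unfolding test_fun_def by (metis less_imp_le norm_zero)
  qed
  \<comment> \<open>enough decay to absorb \<open>\<bar>\<xi>\<bar>\<^bsup>\<bar>\<gamma>\<bar>\<^esup>\<close> and still leave the summable \<open>\<bar>\<xi>\<bar>\<^bsup>-2d\<^esup>\<close>\<close>
  obtain k :: nat where k: "real k > (real ?g + 2 * real CARD('n)) / \<delta>"
    using reals_Archimedean2 by blast
  have k': "real ?g - real k * \<delta> \<le> - 2 * real CARD('n)"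
    using k \<delta>(1) by (simp add: field_simps)
  obtain Z where Z: "Z \<ge> 0" "\<And>F :: (real ^ 'n::_) set. finite F \<Longrightarrow> F \<subseteq> lattice - {0} \<Longrightarrow>
     (\<Sum>\<xi>\<in>F. norm \<xi> powr (- 2 * real CARD('n))) \<le> Z"
    using lattice_power_sum_bounded[where 'n='n] by blast
  show ?thesis
  proof (rule symbol_lower_bound_off_near_set[OF m ell \<delta>(2)])
    fix Q c1 :: real
    assume Q: "Q \<ge> 1" and c1: "c1 > 0" and low: "\<And>lam (\<xi> :: real ^ 'n::_). cmod lam \<ge> 1 \<Longrightarrow> \<xi> \<in> lattice \<Longrightarrow> \<xi> \<noteq> 0 \<Longrightarrow>
       \<xi> \<notin> near_level_set c m \<delta> lam \<or> norm \<xi> \<ge> Q * cmod lam powr (1 / real m) \<Longrightarrow>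
       c1 * norm \<xi> powr (real m - 1 + \<delta>) \<le> cmod (op_symbol c m \<xi> - lam)"
    obtain C where C: "C \<ge> 0" "\<And>lam \<psi> \<xi>. solution_on c m V \<Omega> lam \<psi> \<Longrightarrow> norm \<xi> \<ge> 1 \<Longrightarrow>
      c1 * norm \<xi> powr (real m - 1 + \<delta>) \<le> cmod (op_symbol c m \<xi> - lam) \<Longrightarrow>
      cmod (fcoeff (\<lambda>y. a y * \<psi> y) \<xi>) \<le> C * norm \<xi> powr (- (real k * \<delta>)) * L2_over ?K \<psi>"
      using fcoeff_decay[OF m \<Omega> V compact_cball K c1 a(1), of c \<delta> k] by blast
    define E where "E = L2_over ?K a + C * Z + Q ^ ?g * (B * sqrt ?V)"
    have E: "E > 0"
    proof -
      have "0 < Q ^ ?g * (B * sqrt ?V)" using Q B(1) V0 by simp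
      then show ?thesis using L2_over_nonneg[of ?K a] C(1) Z(1) by (simp add: E_def add_nonneg_pos)
    qed
    show ?thesis
    proof (intro exI[of _ "E / ?V"] conjI allI impI)
      show "E / ?V > 0" using E V0 by simp
      fix lam \<psi> x
      assume lam: "1 \<le> cmod lam" and sol: "solution_on c m V \<Omega> lam \<psi>" and x: "x \<in> ball x0 (\<rho>/2)"
        and fin: "finite (near_level_set c m \<delta> lam)"
      define W where "W = near_level_set c m \<delta> lam"
      define M where "M = L2_over ?K \<psi>"
      define \<Lambda> where "\<Lambda> = cmod lam powr (1 / real m)"
      define f where "f \<xi> = cmod (fcoeff (\<lambda>y. a y * \<psi> y) \<xi>)" for \<xi>
      define T where "T \<xi> = cmod (monom_at \<gamma> \<xi>) * f \<xi>" for \<xi>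
      have M: "M \<ge> 0" by (simp add: M_def L2_over_nonneg)
      have f0: "f \<xi> \<ge> 0" for \<xi> by (simp add: f_def)
      have \<Lambda>: "\<Lambda> \<ge> 1" using lam by (simp add: \<Lambda>_def ge_one_powr_ge_zero)
      have \<Lambda>g: "\<Lambda> ^ ?g = cmod lam powr (real ?g / real m)"
      proof -
        have "\<Lambda> ^ ?g = \<Lambda> powr real ?g" using \<Lambda> by (simp add: powr_realpow)
        then show ?thesis by (simp add: \<Lambda>_def powr_powr)
      qed
      have \<psi>: "smooth_on \<Omega> \<psi>" using sol by (simp add: solution_on_def)
      have \<psi>c: "continuous_on ?K \<psi>" using continuous_on_subset[OF smooth_on_continuous[OF \<psi>] K] .
      have "?V * cmod (D \<gamma> \<psi> x) \<le> E * \<Lambda> ^ ?g * (1 + sqrt (card W)) * M"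
      proof (rule derivative_le_sum_fcoeff[OF \<Omega> \<rho>(2) K a \<psi> x])
        fix F :: "(real ^ 'n::_) set" assume F: "finite F" "F \<subseteq> lattice"
        define bad where "bad = {\<xi>\<in>F. \<xi> \<in> W \<and> norm \<xi> < Q * \<Lambda>}"
        define good where "good = F - {0} - bad"
        have zero: "T 0 \<le> L2_over ?K a * M"
        proof -
          have "cmod (monom_at \<gamma> 0) \<le> 1"
            using norm_monom_at_le[of \<gamma> 0] by (cases "mi_order \<gamma>") auto
          then have "T 0 \<le> 1 * f 0" unfolding T_def by (intro mult_right_mono f0)
          also have "\<dots> \<le> L2_over ?K a * M"
            using fcoeff_le_L2_over[OF compact_cball a(1) \<psi>c] by (simp add: f_def M_def)
          finally show ?thesis .
        qed
        have bad: "(\<Sum>\<xi>\<in>bad. T \<xi>) \<le> Q ^ ?g * \<Lambda> ^ ?g * (B * sqrt ?V * sqrt (card W) * M)"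
        proof -
          have fb: "finite bad" "bad \<subseteq> lattice" "card bad \<le> card W"
            using F fin by (auto simp: bad_def W_def intro!: card_mono)
          have "(\<Sum>\<xi>\<in>bad. T \<xi>) \<le> (\<Sum>\<xi>\<in>bad. (Q * \<Lambda>) ^ ?g * f \<xi>)"
          proof (rule sum_mono)
            fix \<xi> assume "\<xi> \<in> bad"
            then have "norm \<xi> ^ ?g \<le> (Q * \<Lambda>) ^ ?g" by (intro power_mono) (auto simp: bad_def)
            then show "T \<xi> \<le> (Q * \<Lambda>) ^ ?g * f \<xi>"
              unfolding T_def using norm_monom_at_le[of \<gamma> \<xi>] by (intro mult_right_mono f0) linarith
          qed
          also have "\<dots> = (Q * \<Lambda>) ^ ?g * (\<Sum>\<xi>\<in>bad. f \<xi>)" by (simp add: sum_distrib_left)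
          also have "\<dots> \<le> (Q * \<Lambda>) ^ ?g * (B * sqrt (?V * card bad) * M)"
          proof (rule mult_left_mono)
            have "x0 \<in> cball x0 1" by simp
            from cball_subset_period_box[OF this] have "?K \<subseteq> period_box x0"
              using \<rho>(2) subset_cball by blast
            from sum_fcoeff_le[OF compact_cball this a(1) \<psi>c fb(1,2) B(2)]
            show "(\<Sum>\<xi>\<in>bad. f \<xi>) \<le> B * sqrt (?V * card bad) * M"
              by (simp add: f_def M_def)
          qed (use Q \<Lambda> in simp)
          also have "\<dots> \<le> (Q * \<Lambda>) ^ ?g * (B * sqrt (?V * card W) * M)"
            using Q \<Lambda> B(1) M V0 fb(3) by (intro mult_left_mono mult_right_mono) auto
          finally show ?thesis by (simp add: power_mult_distrib real_sqrt_mult mult_ac)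
        qed
        have good: "(\<Sum>\<xi>\<in>good. T \<xi>) \<le> C * Z * M"
        proof -
          have "T \<xi> \<le> norm \<xi> powr (- 2 * real CARD('n)) * (C * M)" if \<xi>: "\<xi> \<in> good" for \<xi>
          proof -
            have \<xi>': "\<xi> \<in> lattice" "\<xi> \<noteq> 0" "\<xi> \<notin> near_level_set c m \<delta> lam \<or> norm \<xi> \<ge> Q * cmod lam powr (1 / real m)"
              using \<xi> F(2) by (auto simp: good_def bad_def W_def \<Lambda>_def)
            have n1: "norm \<xi> \<ge> 1" using lattice_norm_ge_1 \<xi>' by blast
            have "T \<xi> \<le> norm \<xi> ^ ?g * (C * norm \<xi> powr (- (real k * \<delta>)) * M)"
              unfolding T_def f_def M_def
              using norm_monom_at_le C(2)[OF sol n1 low[OF lam \<xi>']] by (intro mult_mono) auto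
            also have "\<dots> = norm \<xi> powr (real ?g - real k * \<delta>) * (C * M)"
            proof -
              have "norm \<xi> ^ ?g = norm \<xi> powr real ?g"
                by (rule powr_realpow[symmetric]) (use n1 in linarith)
              then show ?thesis
                by (simp only: powr_diff powr_minus divide_inverse mult_ac)
            qed
            also have "\<dots> \<le> norm \<xi> powr (- 2 * real CARD('n)) * (C * M)"
              using n1 k' C(1) M by (intro mult_right_mono powr_mono) auto
            finally show ?thesis .
          qed
          then have "(\<Sum>\<xi>\<in>good. T \<xi>) \<le> (\<Sum>\<xi>\<in>good. norm \<xi> powr (- 2 * real CARD('n)) * (C * M))"
            by (rule sum_mono)
          also have "\<dots> = (\<Sum>\<xi>\<in>good. norm \<xi> powr (- 2 * real CARD('n))) * (C * M)"
            by (simp add: sum_distrib_right)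
          also have "\<dots> \<le> Z * (C * M)"
            using F C(1) M by (intro mult_right_mono Z(2)) (auto simp: good_def)
          finally show ?thesis by (simp add: mult_ac)
        qed
        have T0: "T \<xi> \<ge> 0" for \<xi> by (simp add: T_def f_def)
        have "(\<Sum>\<xi>\<in>F. T \<xi>) \<le> (\<Sum>\<xi>\<in>insert 0 (bad \<union> good). T \<xi>)"
          using F(1) T0 by (intro sum_mono2) (auto simp: good_def bad_def)
        also have "\<dots> \<le> T 0 + (\<Sum>\<xi>\<in>bad \<union> good. T \<xi>)"
          using F(1) T0[of 0] by (subst sum.insert_if) (auto simp: good_def bad_def)
        also have "\<dots> = T 0 + ((\<Sum>\<xi>\<in>bad. T \<xi>) + (\<Sum>\<xi>\<in>good. T \<xi>))"
          using F(1) by (subst sum.union_disjoint) (auto simp: good_def bad_def)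
        also have "\<dots> \<le> L2_over ?K a * M + (Q ^ ?g * \<Lambda> ^ ?g * (B * sqrt ?V * sqrt (card W) * M) + C * Z * M)"
          using zero bad good by linarith
        also have "\<dots> \<le> E * \<Lambda> ^ ?g * (1 + sqrt (card W)) * M"
        proof -
          define s where "s = sqrt (card W)"
          have s: "s \<ge> 0" by (simp add: s_def)
          have L1: "\<Lambda> ^ ?g \<ge> 1" using \<Lambda> by simp
          define u where "u = L2_over ?K a + C * Z"
          define v where "v = Q ^ ?g * (B * sqrt ?V)"
          have uv: "u \<ge> 0" "v \<ge> 0" using L2_over_nonneg[of ?K a] C(1) Z(1) Q B(1) V0 by (auto simp: u_def v_def)
          have "1 \<le> \<Lambda> ^ ?g * (1 + s)" using L1 s mult_mono[of 1 "\<Lambda> ^ ?g" 1 "1 + s"] by simp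
          then have "u * 1 \<le> u * (\<Lambda> ^ ?g * (1 + s))" using uv by (intro mult_left_mono)
          moreover have "v * (\<Lambda> ^ ?g * s) \<le> v * (\<Lambda> ^ ?g * (1 + s))" using uv \<Lambda> by (intro mult_left_mono) auto
          ultimately have "u + v * (\<Lambda> ^ ?g * s) \<le> (u + v) * (\<Lambda> ^ ?g * (1 + s))" by (simp add: distrib_right)
          then have "(u + v * (\<Lambda> ^ ?g * s)) * M \<le> (u + v) * (\<Lambda> ^ ?g * (1 + s)) * M"
            using M by (rule mult_right_mono)
          then show ?thesis
            by (simp add: u_def v_def E_def s_def[symmetric] algebra_simps)
        qed
        finally show "(\<Sum>\<xi>\<in>F. cmod (monom_at \<gamma> \<xi>) * cmod (fcoeff (\<lambda>y. a y * \<psi> y) \<xi>)) \<le> E * \<Lambda> ^ ?g * (1 + sqrt (card W)) * M"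
          unfolding T_def f_def .
      qed
      then show "cmod (D \<gamma> \<psi> x) \<le> E / ?V * cmod lam powr (real (mi_order \<gamma>) / real m) *
         (1 + sqrt (card (near_level_set c m \<delta> lam))) * L2_over ?K \<psi>"
        unfolding \<Lambda>g W_def M_def using V0 by (simp add: field_simps)
    qed
  qed
qed

lemma L2_over_le_L2_norm_on:
  fixes \<psi> :: "real ^ 'n::finite \<Rightarrow> complex"
  assumes K: "compact K" "K \<subseteq> S" and \<psi>: "continuous_on K \<psi>"
  shows "ennreal (L2_over K \<psi>) \<le> L2_norm_on S \<psi>"
proof -
  define I where "I = (\<integral>\<^sup>+ y\<in>S. ennreal ((cmod (\<psi> y))\<^sup>2) \<partial>lborel)"
  have "ennreal ((L2_over K \<psi>)\<^sup>2) = ennreal (\<integral>y. indicator K y * (cmod (\<psi> y))\<^sup>2 \<partial>lborel)"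
    by (simp add: L2_over_def)
  also have "\<dots> = (\<integral>\<^sup>+ y. ennreal (indicator K y * (cmod (\<psi> y))\<^sup>2) \<partial>lborel)"
    by (rule nn_integral_eq_integral[OF integrable_cmod_square[OF K(1) \<psi>], symmetric]) auto
  also have "\<dots> \<le> I"
    unfolding I_def using K(2) by (intro nn_integral_mono) (auto simp: indicator_def)
  finally have le: "ennreal ((L2_over K \<psi>)\<^sup>2) \<le> I" .
  show ?thesis
  proof (cases "I = \<infinity>")
    case True
    then show ?thesis by (simp add: L2_norm_on_def I_def[symmetric] ennsqrt_def)
  next
    case False
    then have "(L2_over K \<psi>)\<^sup>2 \<le> enn2real I"
      using le by (metis enn2real_ennreal enn2real_mono infinity_ennreal_def top.not_eq_extremum zero_le_power2)
    then have "L2_over K \<psi> \<le> sqrt (enn2real I)"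
      by (rule real_le_rsqrt)
    then show ?thesis
      using False by (simp add: L2_norm_on_def I_def[symmetric] ennsqrt_def ennreal_leI)
  qed
qed

theorem theorem1:
  fixes c :: "'n::{finite,linorder} multi_index \<Rightarrow> complex"
    and m :: nat
    and \<Omega> X :: "(real ^ 'n::_) set"
    and V :: "real ^ 'n::_ \<Rightarrow> complex"
    and \<delta> r :: real
    and \<gamma> :: "'n multi_index"
  assumes "m \<ge> 1"
    and "\<exists>\<alpha>. mi_order \<alpha> = m \<and> c \<alpha> \<noteq> 0"
    and "open \<Omega>"
    and "smooth_on \<Omega> V"
    and "\<delta> > 0" and "r > 0"
    and "bounded X"
  shows "\<exists>C::real. C > 0 \<and>
    (\<forall>(lam::complex) \<psi> x.
       cmod lam \<ge> 1 \<and> smooth_on \<Omega> \<psi> \<and>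
       (\<forall>y\<in>\<Omega>. diff_op c m \<psi> y + V y * \<psi> y = lam * \<psi> y) \<and>
       x \<in> X \<and> ball x r \<subseteq> \<Omega> \<longrightarrow>
       ennreal (cmod (D \<gamma> \<psi> x))
         \<le> ennreal (C * cmod lam powr (real (mi_order \<gamma>) / real m))
             * (1 + ennsqrt (near_level_count c m \<delta> lam)) * L2_norm_on (ball x r) \<psi>)"
proof -
  \<comment> \<open>\<open>\<rho> \<le> 1\<close> makes the ball fit into one period; \<open>\<rho> \<le> r / 2\<close> keeps it inside \<open>ball x r\<close> for every \<open>x\<close>
  within \<open>\<rho> / 2\<close> of its centre\<close>
  define \<rho> where "\<rho> = min 1 (r / 2)"
  have \<rho>: "\<rho> > 0" "\<rho> \<le> 1" "\<rho> \<le> r / 2" using assms(6) by (auto simp: \<rho>_def)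
  define Y where "Y = {x \<in> X. ball x r \<subseteq> \<Omega>}"
  have sub: "cball x0 \<rho> \<subseteq> \<Omega>" if "x0 \<in> Y" for x0
  proof -
    have "cball x0 \<rho> \<subseteq> ball x0 r" using \<rho>(3) assms(6) by auto
    then show ?thesis using that by (auto simp: Y_def)
  qed
  obtain T where T: "T \<subseteq> Y" "finite T" "Y \<subseteq> (\<Union>x0\<in>T. ball x0 (\<rho> / 2))"
  proof -
    have comp: "compact (closure Y)"
      using assms(7) bounded_subset[of X Y] by (auto simp: Y_def compact_closure)
    have cover: "closure Y \<subseteq> (\<Union>x0\<in>Y. ball x0 (\<rho> / 2))"
    proof
      fix z assume "z \<in> closure Y"
      then obtain x0 where "x0 \<in> Y" "dist x0 z < \<rho> / 2"
        using \<rho>(1) closure_approachable[of z Y] by (metis half_gt_zero)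
      then show "z \<in> (\<Union>x0\<in>Y. ball x0 (\<rho> / 2))" by auto
    qed
    obtain T where T: "T \<subseteq> Y" "finite T" "closure Y \<subseteq> (\<Union>x0\<in>T. ball x0 (\<rho> / 2))"
      by (rule compactE_image[OF comp _ cover]) auto
    show thesis
      by (rule that[OF T(1,2) order_trans[OF closure_subset T(3)]])
  qed
  let ?bound = "\<lambda>C x0. \<forall>lam \<psi> x. cmod lam \<ge> 1 \<longrightarrow> solution_on c m V \<Omega> lam \<psi> \<longrightarrow> x \<in> ball x0 (\<rho>/2) \<longrightarrow>
     finite (near_level_set c m \<delta> lam) \<longrightarrow>
     cmod (D \<gamma> \<psi> x) \<le> C * cmod lam powr (real (mi_order \<gamma>) / real m) *
       (1 + sqrt (card (near_level_set c m \<delta> lam))) * L2_over (cball x0 \<rho>) \<psi>"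
  have "\<forall>x0\<in>T. \<exists>C>0. ?bound C x0"
  proof
    fix x0 assume "x0 \<in> T"
    then have K: "cball x0 \<rho> \<subseteq> \<Omega>" using sub T(1) by blast
    show "\<exists>C>0. ?bound C x0"
    proof (cases "elliptic c m \<and> \<delta> \<le> 1")
      case True
      then show ?thesis
        using local_derivative_bound[OF assms(1,3,4) \<rho>(1,2) K _ assms(5)] by simp
    next
      case False
      \<comment> \<open>the bound speaks of finite near level sets only, so any constant will do\<close>
      then have "infinite (near_level_set c m \<delta> lam)" for lam
        using infinite_near_level_set_not_elliptic[OF assms(1,5)]
          infinite_near_level_set_large_exponent[of \<delta> c m lam] by auto
      then show ?thesis by (intro exI[of _ 1]) auto
    qed
  qed
  from bchoice[OF this] obtain Cx where Cx: "\<And>x0. x0 \<in> T \<Longrightarrow> Cx x0 > 0" "\<And>x0. x0 \<in> T \<Longrightarrow> ?bound (Cx x0) x0"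
    by blast
  define C where "C = 1 + sum Cx T"
  have CT: "Cx x0 \<le> C" if "x0 \<in> T" for x0
  proof -
    have "Cx x0 \<le> sum Cx T"
      by (rule member_le_sum[OF that]) (use Cx(1) T(2) in \<open>auto intro: less_imp_le\<close>)
    then show ?thesis by (simp add: C_def)
  qed
  have C: "C > 0"
    using sum_nonneg[of T Cx] Cx(1) by (force simp: C_def intro: less_imp_le)
  show ?thesis
  proof (intro exI[of _ C] conjI C allI impI)
    fix lam \<psi> x
    assume "1 \<le> cmod lam \<and> smooth_on \<Omega> \<psi> \<and>
       (\<forall>y\<in>\<Omega>. diff_op c m \<psi> y + V y * \<psi> y = lam * \<psi> y) \<and> x \<in> X \<and> ball x r \<subseteq> \<Omega>"
    then have lam: "1 \<le> cmod lam" and sol: "solution_on c m V \<Omega> lam \<psi>" and \<psi>: "smooth_on \<Omega> \<psi>" and x: "x \<in> Y"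
      by (auto simp: solution_on_def Y_def)
    define W where "W = near_level_set c m \<delta> lam"
    define P where "P = cmod lam powr (real (mi_order \<gamma>) / real m)"
    have P: "P > 0" using lam by (auto simp: P_def)
    have cont: "continuous_on (cball x0 \<rho>) \<psi>" if "x0 \<in> Y" for x0
      using continuous_on_subset[OF smooth_on_continuous[OF \<psi>] sub[OF that]] .
    show "ennreal (cmod (D \<gamma> \<psi> x)) \<le> ennreal (C * cmod lam powr (real (mi_order \<gamma>) / real m))
             * (1 + ennsqrt (near_level_count c m \<delta> lam)) * L2_norm_on (ball x r) \<psi>"
    proof (cases "finite W")
      case True
      obtain x0 where x0: "x0 \<in> T" "x \<in> ball x0 (\<rho> / 2)" using T(3) x by blast
      let ?M = "L2_over (cball x0 \<rho>) \<psi>"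
      have "cmod (D \<gamma> \<psi> x) \<le> Cx x0 * P * (1 + sqrt (card W)) * ?M"
        using Cx(2)[OF x0(1)] lam sol x0(2) True unfolding W_def P_def by blast
      also have "\<dots> \<le> C * P * (1 + sqrt (card W)) * ?M"
        using CT[OF x0(1)] P L2_over_nonneg by (intro mult_right_mono) auto
      finally have "ennreal (cmod (D \<gamma> \<psi> x)) \<le> ennreal (C * P * (1 + sqrt (card W)) * ?M)"
        by (rule ennreal_leI)
      also have "\<dots> = ennreal (C * P) * (1 + ennreal (sqrt (card W))) * ennreal ?M"
        using C P L2_over_nonneg[of "cball x0 \<rho>" \<psi>] by (simp add: ennreal_mult ennreal_plus)
      also have "ennreal (sqrt (card W)) = ennsqrt (near_level_count c m \<delta> lam)"
        using True by (simp add: near_level_count_def ennsqrt_def W_def emeasure_count_space_finite)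
      also have "ennreal ?M \<le> L2_norm_on (ball x r) \<psi>"
      proof (rule L2_over_le_L2_norm_on[OF compact_cball _ cont])
        show "cball x0 \<rho> \<subseteq> ball x r"
        proof
          fix y assume "y \<in> cball x0 \<rho>"
          then have "dist x y < \<rho> / 2 + \<rho>"
            using x0(2) dist_triangle[of x y x0] by (simp add: dist_commute)
          then show "y \<in> ball x r" using \<rho>(3) assms(6) by simp
        qed
      qed (use x0(1) T(1) in blast)
      finally show ?thesis
        unfolding P_def by (simp add: mult_left_mono)
    next
      case False
      show ?thesis
      proof (cases "L2_over (cball x \<rho>) \<psi> = 0")
        case True
        have "D \<gamma> \<psi> x = 0"
          using derivative_eq_0[OF assms(3) \<rho>(1,2) sub[OF x] \<psi> _ True] \<rho>(1) by simp
        then show ?thesis by simp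
      next
        case nz: False
        have "cball x \<rho> \<subseteq> ball x r" using \<rho>(3) assms(6) by auto
        from L2_over_le_L2_norm_on[OF compact_cball this cont[OF x]]
        have "L2_norm_on (ball x r) \<psi> \<noteq> 0"
          using nz L2_over_nonneg[of "cball x \<rho>" \<psi>] by (auto simp: ennreal_eq_0_iff)
        moreover have "ennsqrt (near_level_count c m \<delta> lam) = \<infinity>"
          using False by (simp add: near_level_count_def ennsqrt_def W_def)
        ultimately show ?thesis
          using C P unfolding P_def by (simp add: ennreal_mult_top ennreal_top_mult)
      qed
    qed
  qed
qed

end
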